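(* Let $m\in\mathbb{N}$. Up to gauge transformation, for all $n_1,n_2>m$, $x_1,x_2\in\mathbb{R}$ and $x^{(m)}\in\mathrm{Conf}_m^0(\mathbb{R})$, $$\lim_{N\to\infty}\sqrt{N/2}\;K_{\mathbf P(N)}\big(N+m-n_1,\lfloor x_1\sqrt{N/2}\rfloor;\,N+m-n_2,\lfloor x_2\sqrt{N/2}\rfloor\big)=K^{\mathrm{GUE}}_{x^{(m)}}(n_1,x_1;n_2,x_2),$$ the limit being taken along even integers $N$. Here "up to gauge transformation" means that the left-hand kernel may be multiplied, before the limit, by $g_N(n_1,x_1)/g_N(n_2,x_2)$ for nowhere-vanishing functions $g_N$.
   Context: $\mathrm{Conf}_m^0(\mathbb{R})$ is the set of $m$-tuples $x_1^{(m)}>\dots>x_m^{(m)}$ of reals. Limit kernel (kernel of the rising GUE eigenvalue process started at $x^{(m)}$): for $n_1,n_2>m$, $$K^{\mathrm{GUE}}_{x^{(m)}}(n_1,x_1;n_2,x_2)=\frac{(n_1-m)!}{(n_2-m-1)!}\frac{-1}{(2\pi i)^2}\int_\Gamma dz\oint_{c(x_1)}dw\frac{(z-x_2)^{n_2-m-1}}{(w-x_1)^{n_1-m+1}}\frac{e^{z^2/2-w^2/2}}{w-z}\prod_{r=1}^m\frac{w-x_r^{(m)}}{z-x_r^{(m)}},$$ where $\Gamma=b+i\mathbb{R}$ is oriented upward with $x_2<b$, $b<x_j^{(m)}$ whenever $x_j^{(m)}>x_2$, and $b<x_1$ if $x_2<x_1$; $c(x_1)$ is a small positively oriented contour around $x_1$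 not meeting $\Gamma$ and containing no $x_j^{(m)}$ unless $x_j^{(m)}=x_1$. Lozenge kernel: for even $N$, $K_{\mathbf P(N)}$ is the specialization of Petrov's correlation kernel for uniformly random lozenge tilings of a polygon with top-boundary parameters $A_1=-N-\tfrac12$, $B_1=-\tfrac N2-\tfrac12$, $A_{m+2}=\tfrac N2-\tfrac12$, $B_{m+2}=N-\tfrac12$, and $A_i=\lfloor\sqrt{N/2}\,x^{(m)}_{m+2-i}\rfloor-\tfrac12$, $B_i=A_i+1$ for $2\le i\le m+1$. Explicitly, for levels $1\le n_1\le N+m$, $1\le n_2\le N+m-1$ and integers $x_1,x_2$, $$K_{\mathbf P(N)}(n_1,x_1;n_2,x_2)=-\mathbf 1_{n_2<n_1}\mathbf 1_{x_2\le x_1}\frac{\prod_{\ell=1}^{n_1-n_2-1}(x_1-x_2+\ell)}{(n_1-n_2-1)!}+\frac{(N-n_1)!}{(N-n_2-1)!}\frac1{(2\pi i)^2}\oint dz\oint dw\,\frac{\prod_{\ell=1}^{N-n_2-1}(z-x_2+\ell)}{\prod_{\ell=0}^{N-n_1}(w-x_1+\ell)}\frac1{w-z}$$ $$\times\prod_{r=1}^m\frac{\lfloor\sqrt{N/2}\,x_r^{(m)}\rfloor-w}{\lfloor\sqrt{N/2}\,x_r^{(m)}\rfloor-z}\cdot\frac{(-N-w)_{N/2}\,(\tfrac N2-w)_{N/2}}{(-N-z)_{N/2}\,(\tfrac N2-z)_{N/2}},$$ with $(a)_k=a(a+1)\cdots(a+k-1)$. Both contours are positively oriented; the $z$-contour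 encircles the real poles in $z$ (of the product factors) that are $\ge x_2$, and no others; the $w$-contour encloses the $z$-contour and the interval $[-N,N]$; neither contour crosses the real axis at an integer.
   Formalization: Two tie cases where the claim as written fails under every gauge are excluded: n_2 = n_1+1 with x_1 = x_2 (the limit is K^GUE − 1), and n_2 = m+1 with x_2 = x_j^{(m)} for some j (an extra residue at x_j^{(m)} survives in the limit). *)

theory Defs
  imports "HOL-Complex_Analysis.Complex_Analysis"
begin

text \<open>An \<open>m\<close>-tuple of reals is an extensional function on the index set \<open>{1..m}\<close>.\<close>

definition Conf0 :: "nat \<Rightarrow> (nat \<Rightarrow> real) set" where
  "Conf0 m = {x \<in> {1..m} \<rightarrow>\<^sub>E UNIV. \<forall>i\<in>{1..m}. \<forall>j\<in>{1..m}. i < j \<longrightarrow> x j < x i}"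

definition positive_contour :: "(real \<Rightarrow> complex) \<Rightarrow> bool" where
  "positive_contour \<gamma> \<longleftrightarrow>
     valid_path \<gamma> \<and> simple_path \<gamma> \<and> pathfinish \<gamma> = pathstart \<gamma> \<and>
     (\<forall>p\<in>inside (path_image \<gamma>). winding_number \<gamma> p = 1)"

text \<open>The integral over the upward oriented vertical line \<open>b + \<i>\<real>\<close>.\<close>

definition vertical_line_integral :: "real \<Rightarrow> (complex \<Rightarrow> complex) \<Rightarrow> complex" where
  "vertical_line_integral b f = \<i> * (\<integral>t. f (Complex b t) \<partial>lborel)"


definition gue_integrand ::
  "nat \<Rightarrow> (nat \<Rightarrow> real) \<Rightarrow> nat \<Rightarrow> real \<Rightarrow> nat \<Rightarrow> real \<Rightarrow> complex \<Rightarrow> complex \<Rightarrow> complex" where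
  "gue_integrand m x n1 x1 n2 x2 z w =
     (z - of_real x2) ^ (n2 - m - 1) / (w - of_real x1) ^ (n1 - m + 1) *
     (exp (z\<^sup>2 / 2 - w\<^sup>2 / 2) / (w - z)) *
     (\<Prod>r\<in>{1..m}. (w - of_real (x r)) / (z - of_real (x r)))"

definition gue_contours ::
  "nat \<Rightarrow> (nat \<Rightarrow> real) \<Rightarrow> real \<Rightarrow> real \<Rightarrow> real \<Rightarrow> (real \<Rightarrow> complex) \<Rightarrow> bool" where
  "gue_contours m x x1 x2 b c \<longleftrightarrow>
     x2 < b \<and> (\<forall>j\<in>{1..m}. x2 < x j \<longrightarrow> b < x j) \<and> (x2 < x1 \<longrightarrow> b < x1) \<and>
     positive_contour c \<and> of_real x1 \<in> inside (path_image c) \<and>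
     path_image c \<inter> {z. Re z = b} = {} \<and>
     (\<forall>j\<in>{1..m}. x j \<noteq> x1 \<longrightarrow> of_real (x j) \<in> outside (path_image c))"

text \<open>
  The description operator expresses that the double integral has the same value for all
  admissible contours. The kernel is meant for \<open>n1, n2 > m\<close> only.
\<close>

definition K_GUE ::
  "nat \<Rightarrow> (nat \<Rightarrow> real) \<Rightarrow> nat \<Rightarrow> real \<Rightarrow> nat \<Rightarrow> real \<Rightarrow> complex" where
  "K_GUE m x n1 x1 n2 x2 =
     (THE v. \<exists>b c. gue_contours m x x1 x2 b c \<and>
        v = fact (n1 - m) / fact (n2 - m - 1) * (- 1 / (2 * of_real pi * \<i>)\<^sup>2) *
            vertical_line_integral b
              (\<lambda>z. contour_integral c (\<lambda>w. gue_integrand m x n1 x1 n2 x2 z w)))"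


definition micro_pos :: "nat \<Rightarrow> real \<Rightarrow> int" where
  "micro_pos N a = \<lfloor>sqrt (real N / 2) * a\<rfloor>"

text \<open>
  The factors coming from the top boundary of the polygon; the ratio of the values at \<open>w\<close>
  and \<open>z\<close> enters the kernel, so its zeros are the poles in \<open>z\<close>.
\<close>

definition boundary_factor :: "nat \<Rightarrow> (nat \<Rightarrow> real) \<Rightarrow> nat \<Rightarrow> complex \<Rightarrow> complex" where
  "boundary_factor m x N u =
     (\<Prod>r\<in>{1..m}. of_int (micro_pos N (x r)) - u) *
     (pochhammer (- of_nat N - u) (N div 2) * pochhammer (of_nat (N div 2) - u) (N div 2))"

definition lozenge_integrand ::
  "nat \<Rightarrow> (nat \<Rightarrow> real) \<Rightarrow> nat \<Rightarrow> nat \<Rightarrow> int \<Rightarrow> nat \<Rightarrow> int \<Rightarrow> complex \<Rightarrow> complex \<Rightarrow> complex" where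
  "lozenge_integrand m x N n1 x1 n2 x2 z w =
     (\<Prod>l\<in>{1..N - n2 - 1}. z - of_int x2 + of_nat l) /
     (\<Prod>l\<in>{0..N - n1}. w - of_int x1 + of_nat l) *
     (1 / (w - z)) * (boundary_factor m x N w / boundary_factor m x N z)"

definition lozenge_contours ::
  "nat \<Rightarrow> (nat \<Rightarrow> real) \<Rightarrow> nat \<Rightarrow> int \<Rightarrow> (real \<Rightarrow> complex) \<Rightarrow> (real \<Rightarrow> complex) \<Rightarrow> bool" where
  "lozenge_contours m x N x2 \<gamma>z \<gamma>w \<longleftrightarrow>
     positive_contour \<gamma>z \<and> positive_contour \<gamma>w \<and>
     (\<forall>p. boundary_factor m x N p = 0 \<longrightarrow>
        (if of_int x2 \<le> Re p then p \<in> inside (path_image \<gamma>z)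
         else p \<in> outside (path_image \<gamma>z))) \<and>
     path_image \<gamma>z \<subseteq> inside (path_image \<gamma>w) \<and>
     complex_of_real ` {- real N..real N} \<subseteq> inside (path_image \<gamma>w) \<and>
     path_image \<gamma>z \<inter> \<int> = {} \<and> path_image \<gamma>w \<inter> \<int> = {}"

text \<open>
  The kernel is meant for even \<open>N\<close> and for levels \<open>n1 \<le> N\<close>, \<open>n2 < N\<close>, where none of the
  natural number subtractions truncates. The description operator is used as above.
\<close>

definition K_lozenge ::
  "nat \<Rightarrow> (nat \<Rightarrow> real) \<Rightarrow> nat \<Rightarrow> nat \<Rightarrow> int \<Rightarrow> nat \<Rightarrow> int \<Rightarrow> complex" where
  "K_lozenge m x N n1 x1 n2 x2 =
     - (if n2 < n1 \<and> x2 \<le> x1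
        then (\<Prod>l\<in>{1..n1 - n2 - 1}. of_int (x1 - x2 + int l)) / fact (n1 - n2 - 1)
        else 0) +
     (THE v. \<exists>\<gamma>z \<gamma>w. lozenge_contours m x N x2 \<gamma>z \<gamma>w \<and>
        v = fact (N - n1) / fact (N - n2 - 1) * (1 / (2 * of_real pi * \<i>)\<^sup>2) *
            contour_integral \<gamma>z
              (\<lambda>z. contour_integral \<gamma>w (\<lambda>w. lozenge_integrand m x N n1 x1 n2 x2 z w)))"

end

theory Submission
  imports Defs "HOL-Probability.Sinc_Integral" "HOL-Real_Asymp.Real_Asymp"
begin

text \<open>
  The proof rewrites the lozenge kernel, exactly and for each large even \<open>N = 2 h\<close>, as an integral over
  a vertical line that has the shape of the limit kernel, and passes to the limit there.

  Integrating out \<open>w\<close>. Write \<open>B\<close> for the boundary polynomial with zero set \<open>S\<close>, \<open>Q\<close> for the polynomial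
  with the consecutive zeros \<open>T = {x1 - n, \<dots>, x1}\<close>, and \<open>P\<close> for the rising factorial in the numerator.
  The residue at \<open>w = z\<close> gives \<open>P/Q\<close>, those at the points of \<open>T\<close> give a rational function \<open>E\<close>
  (\<open>reduced_kernel\<close>). In the sum \<open>E + P/Q\<close> the poles on \<open>T\<close> cancel, so the \<open>z\<close>-integral is the sum of
  residues (\<open>pole_weight\<close>) over the zeros of \<open>B\<close> that are at least \<open>x2\<close>. This depends on the contours only
  through the encircled zeros, so the kernel is well defined (\<open>K_lozenge_eq_pole_sum\<close>).

  From residues to a line. Since \<open>E\<close> decays at least quadratically, its residues to the right of
  a vertical line sum up to the integral over the line (\<open>vertical_line_integral_reduced_kernel\<close>).
  The difference to the previous sum consists of residues of \<open>P/Q\<close> on \<open>T\<close>. They add up to a backward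
  difference of a rising factorial (\<open>level_poly_divided_difference\<close>), and this is exactly the
  indicator term of the lozenge kernel.

  The limit. Let \<open>s = sqrt h\<close> and rescale all positions by \<open>s\<close>. The zeros of \<open>B\<close> at distance at least \<open>h\<close>
  contribute \<open>far_factor\<close>, which tends to \<open>exp (- w\<^sup>2 / 2)\<close> because \<open>h\<close> times the sum of \<open>1 / j\<^sup>2\<close> over
  \<open>h < j < 2 h\<close> tends to \<open>1/2\<close>. The sum over \<open>T\<close> inside \<open>E\<close> is a Cauchy integral over a fixed circle
  around \<open>x1\<close>. Dominated convergence is applied on the circle and then on the line; the
  majorant on the line comes from \<open>far_factor_lower_bound\<close>, by which \<open>far_factor\<close> outgrows every
  power of the height. The powers of \<open>s\<close> that remain are absorbed by the gauge factor \<open>s ^ n\<close>.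

  The exceptional cases. If some \<open>x r\<close> equals \<open>x2\<close>, the zero \<open>\<lfloor>s x2\<rfloor>\<close> is encircled in the lozenge kernel
  but lies to the left of the line; its gauged weight has order \<open>s\<close> to the power \<open>- (n2 - m - 1)\<close>. If
  \<open>x1 = x2\<close> and \<open>n1 < n2\<close>, the indicator is not compensated; after gauging it has order \<open>s\<close> to the power
  \<open>- (n2 - n1 - 1)\<close>. Both vanish in the limit precisely outside the two excluded cases.

  That the double integral defining the limit kernel does not depend on its contours needs no
  separate deformation argument: the same sequence of lozenge kernels converges to its value for
  every admissible pair of contours, so the values agree by uniqueness of limits.
\<close>

section \<open>Double contour integrals of rational functions\<close>

text \<open>
  Keeping the winding numbers lets one formula serve circles, rectangles and arbitrary admissible
  contours.
\<close>

lemma has_contour_integral_simple_poles: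
  assumes A: "finite A" and F: "F holomorphic_on UNIV"
    and g: "valid_path \<gamma>" "pathfinish \<gamma> = pathstart \<gamma>" "path_image \<gamma> \<inter> A = {}"
  shows "((\<lambda>z. F z / (\<Prod>a\<in>A. z - a)) has_contour_integral
          2 * of_real pi * \<i> * (\<Sum>a\<in>A. winding_number \<gamma> a * (F a / (\<Prod>b\<in>A - {a}. a - b)))) \<gamma>"
proof -
  let ?f = "\<lambda>z. F z / (\<Prod>a\<in>A. z - a)"
  have hol: "?f holomorphic_on UNIV - A"
    using A F by (intro holomorphic_intros holomorphic_on_subset[OF F]) auto
  have res: "residue ?f a = F a / (\<Prod>b\<in>A - {a}. a - b)" if "a \<in> A" for a
  proof -
    have eq: "?f = (\<lambda>z. F z / (\<Prod>b\<in>A - {a}. z - b) / (z - a))"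
      using that A by (auto simp: prod.remove fun_eq_iff divide_simps)
    have "open (UNIV - (A - {a}))" using A by (intro open_Diff finite_imp_closed) auto
    moreover have "(\<lambda>z. F z / (\<Prod>b\<in>A - {a}. z - b)) holomorphic_on (UNIV - (A - {a}))"
      using A F by (intro holomorphic_intros holomorphic_on_subset[OF F]) auto
    ultimately show ?thesis
      unfolding eq by (intro residue_simple[where s="UNIV - (A - {a})"]) auto
  qed
  have "?f contour_integrable_on \<gamma>"
    using A g by (intro contour_integrable_holomorphic_simple[OF hol])
       (auto intro!: open_Diff finite_imp_closed)
  moreover have "contour_integral \<gamma> ?f = 2 * of_real pi * \<i> * (\<Sum>a\<in>A. winding_number \<gamma> a * residue ?f a)"
    using Residue_theorem[OF _ _ A hol g(1,2)] g(3) by auto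
  ultimately show ?thesis
    using res has_contour_integral_integral[of ?f \<gamma>] by (simp cong: sum.cong)
qed

text \<open>
  For \<open>a\<close> in \<open>A\<close>, the derivative at \<open>a\<close> of the monic polynomial with simple zeros \<open>A\<close>.
\<close>

definition lagrange_denom :: "complex set \<Rightarrow> complex \<Rightarrow> complex" where
  "lagrange_denom A a = (\<Prod>b\<in>A - {a}. a - b)"

lemma lagrange_denom_nonzero: "finite A \<Longrightarrow> lagrange_denom A a \<noteq> 0"
  by (auto simp: lagrange_denom_def)

definition node_prod :: "complex set \<Rightarrow> complex \<Rightarrow> complex" where
  "node_prod A u = (\<Prod>a\<in>A. u - a)"

text \<open>
  For \<open>t \<noteq> a\<close> the quotient \<open>node_prod S t / (t - a)\<close> equals \<open>node_prod (S - {a}) t\<close>. Written this way,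
  the residue at \<open>a\<close> of the \<open>z\<close>-integrand makes sense also when \<open>a\<close> is a point of \<open>T\<close>.
\<close>

definition pole_weight :: "complex set \<Rightarrow> complex set \<Rightarrow> (complex \<Rightarrow> complex) \<Rightarrow> complex \<Rightarrow> complex" where
  "pole_weight S T P a =
     P a / lagrange_denom S a * (\<Sum>t\<in>T. node_prod (S - {a}) t / lagrange_denom T t)"

text \<open>
  The contribution of the poles on \<open>T\<close> to the \<open>w\<close>-integral of the kernel, as a function of \<open>z\<close>.
\<close>

definition reduced_kernel :: "complex set \<Rightarrow> complex set \<Rightarrow> (complex \<Rightarrow> complex) \<Rightarrow> complex \<Rightarrow> complex" where
  "reduced_kernel S T P z =
     P z / node_prod S z * (\<Sum>t\<in>T. node_prod S t / (lagrange_denom T t * (t - z)))"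

lemma node_prod_remove: "finite S \<Longrightarrow> a \<in> S \<Longrightarrow> node_prod S u = (u - a) * node_prod (S - {a}) u"
  by (simp add: node_prod_def prod.remove)

lemma node_prod_eq_0: "finite S \<Longrightarrow> node_prod S u = 0 \<longleftrightarrow> u \<in> S"
  by (auto simp: node_prod_def)

text \<open>
  Every summand is a rational function with simple poles: if \<open>t\<close> lies in \<open>S\<close>, the factor
  \<open>node_prod S t\<close> kills the summand that would have a double pole at \<open>t\<close>. In that case the formula still
  holds, because the two terms on the right that belong to \<open>t\<close> cancel.
\<close>

lemma has_contour_integral_reduced_kernel:
  assumes S: "finite S" and T: "finite T" and P: "P holomorphic_on UNIV"
    and g: "valid_path \<gamma>" "pathfinish \<gamma> = pathstart \<gamma>" "path_image \<gamma> \<inter> (S \<union> T) = {}"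
  shows "(reduced_kernel S T P has_contour_integral
           2 * of_real pi * \<i> * ((\<Sum>a\<in>S. winding_number \<gamma> a * pole_weight S T P a)
              - (\<Sum>t\<in>T. winding_number \<gamma> t * (P t / lagrange_denom T t)))) \<gamma>"
proof -
  let ?W = "winding_number \<gamma>"
  define V where "V t = (\<Sum>a\<in>S. ?W a * (P a / lagrange_denom S a) * (node_prod (S - {a}) t / lagrange_denom T t))
                        - ?W t * (P t / lagrange_denom T t)" for t
  have summand: "((\<lambda>z. P z / node_prod S z * (node_prod S t / (lagrange_denom T t * (t - z))))
        has_contour_integral 2 * of_real pi * \<i> * V t) \<gamma>" if t: "t \<in> T" for t
  proof (cases "t \<in> S")
    case True
    have 0: "node_prod S t = 0" using True S by (simp add: node_prod_eq_0)
    have z: "node_prod (S - {a}) t = 0" if "a \<in> S" "a \<noteq> t" for a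
      using S True that by (subst node_prod_eq_0) auto
    have "(\<Sum>a\<in>S. ?W a * (P a / lagrange_denom S a) * (node_prod (S - {a}) t / lagrange_denom T t))
       = ?W t * (P t / lagrange_denom S t) * (node_prod (S - {t}) t / lagrange_denom T t)"
      using z True S by (subst sum.remove[of _ t]) (auto intro!: sum.neutral)
    also have "node_prod (S - {t}) t = lagrange_denom S t" by (simp add: node_prod_def lagrange_denom_def)
    finally have "V t = 0" using lagrange_denom_nonzero[OF S, of t] by (simp add: V_def)
    with 0 show ?thesis by (simp add: has_contour_integral_0)
  next
    case False
    have h: "((\<lambda>z. P z / (\<Prod>a\<in>insert t S. z - a)) has_contour_integral
          2 * of_real pi * \<i> * (\<Sum>a\<in>insert t S. ?W a * (P a / (\<Prod>b\<in>insert t S - {a}. a - b)))) \<gamma>"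
      using S P g t by (intro has_contour_integral_simple_poles) auto
    have nz: "node_prod S t \<noteq> 0" using False S by (simp add: node_prod_eq_0)
    have "(\<Sum>a\<in>S. ?W a * (P a / (\<Prod>b\<in>insert t S - {a}. a - b)))
      = - (\<Sum>a\<in>S. ?W a * (P a / lagrange_denom S a) * node_prod (S - {a}) t) / node_prod S t"
      unfolding sum_negf[symmetric] sum_divide_distrib
    proof (intro sum.cong refl)
      fix a assume a: "a \<in> S"
      have e1: "insert t S - {a} = insert t (S - {a})" using a False by auto
      have e2: "(\<Prod>b\<in>insert t S - {a}. a - b) = (a - t) * lagrange_denom S a"
        unfolding e1 lagrange_denom_def using S False by simp
      have at: "a - t \<noteq> 0" using a False by auto
      have "node_prod S t = - (a - t) * node_prod (S - {a}) t"
        using node_prod_remove[OF S a, of t] by simp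
      with nz at show "?W a * (P a / (\<Prod>b\<in>insert t S - {a}. a - b)) =
         - (?W a * (P a / lagrange_denom S a) * node_prod (S - {a}) t) / node_prod S t"
        unfolding e2 by (auto simp: divide_simps) (auto simp: algebra_simps)
    qed
    moreover have "insert t S - {t} = S" using False by auto
    moreover have V_eq: "V t = (\<Sum>a\<in>S. ?W a * (P a / lagrange_denom S a) * node_prod (S - {a}) t) / lagrange_denom T t
        - ?W t * (P t / lagrange_denom T t)"
      by (simp add: V_def sum_divide_distrib)
    ultimately have sum: "(\<Sum>a\<in>insert t S. ?W a * (P a / (\<Prod>b\<in>insert t S - {a}. a - b)))
      = - V t * lagrange_denom T t / node_prod S t"
      using S False nz lagrange_denom_nonzero[OF T, of t]
      by (simp add: V_eq node_prod_def[symmetric] divide_simps)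
    have eq: "(\<lambda>z. P z / node_prod S z * (node_prod S t / (lagrange_denom T t * (t - z)))) =
       (\<lambda>z. - (node_prod S t / lagrange_denom T t) * (P z / (\<Prod>a\<in>insert t S. z - a)))"
      using S False by (auto simp: fun_eq_iff node_prod_def divide_simps) (auto simp: algebra_simps)
    show ?thesis
      using has_contour_integral_lmul[OF h, of "- (node_prod S t / lagrange_denom T t)"] nz lagrange_denom_nonzero[OF T, of t]
      unfolding eq sum by (simp add: field_simps)
  qed
  have "(reduced_kernel S T P has_contour_integral (\<Sum>t\<in>T. 2 * of_real pi * \<i> * V t)) \<gamma>"
    unfolding reduced_kernel_def sum_distrib_left using summand T by (intro has_contour_integral_sum) auto
  also have "(\<Sum>t\<in>T. 2 * of_real pi * \<i> * V t) =  2 * of_real pi * \<i> * ((\<Sum>a\<in>S. ?W a * pole_weight S T P a)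
              - (\<Sum>t\<in>T. ?W t * (P t / lagrange_denom T t)))"
    unfolding V_def sum_distrib_left[symmetric] sum_subtractf pole_weight_def
    by (subst sum.swap) (simp add: sum_distrib_left mult.assoc)
  finally show ?thesis .
qed

text \<open>
  The residue of the \<open>w\<close>-integrand at \<open>w = z\<close> contributes \<open>P z / node_prod T z\<close>, whose residues on \<open>T\<close>
  cancel those of the reduced kernel; only the zeros of \<open>S\<close> survive.
\<close>

lemma contour_integral_double_kernel:
  assumes S: "finite S" and T: "finite T" and P: "P holomorphic_on UNIV"
    and gz: "valid_path \<gamma>" "pathfinish \<gamma> = pathstart \<gamma>" "path_image \<gamma> \<inter> (S \<union> T) = {}"
    and gw: "valid_path \<gamma>'" "pathfinish \<gamma>' = pathstart \<gamma>'"
       "path_image \<gamma>' \<inter> (path_image \<gamma> \<union> T) = {}" "\<And>p. p \<in> path_image \<gamma> \<union> T \<Longrightarrow> winding_number \<gamma>' p = 1"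
  shows "contour_integral \<gamma> (\<lambda>z. contour_integral \<gamma>' (\<lambda>w.
            P z / node_prod T w * (1 / (w - z)) * (node_prod S w / node_prod S z)))
         = (2 * of_real pi * \<i>)\<^sup>2 * (\<Sum>a\<in>S. winding_number \<gamma> a * pole_weight S T P a)"
proof -
  have inner: "contour_integral \<gamma>' (\<lambda>w. P z / node_prod T w * (1 / (w - z)) * (node_prod S w / node_prod S z))
      = 2 * of_real pi * \<i> * (reduced_kernel S T P z + P z / node_prod T z)" if z: "z \<in> path_image \<gamma>" for z
  proof -
    have zT: "z \<notin> T" "z \<notin> S" using z gz by auto
    have nz: "node_prod T z \<noteq> 0" "node_prod S z \<noteq> 0" using zT S T by (auto simp: node_prod_eq_0)
    have "node_prod S holomorphic_on UNIV" unfolding node_prod_def by (intro holomorphic_intros)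
    then have "((\<lambda>w. node_prod S w / (\<Prod>a\<in>insert z T. w - a)) has_contour_integral
          2 * of_real pi * \<i> * (\<Sum>a\<in>insert z T. winding_number \<gamma>' a * (node_prod S a / (\<Prod>b\<in>insert z T - {a}. a - b)))) \<gamma>'"
      using T gw z by (intro has_contour_integral_simple_poles) auto
    moreover have "(\<Sum>a\<in>insert z T. winding_number \<gamma>' a * (node_prod S a / (\<Prod>b\<in>insert z T - {a}. a - b)))
       = node_prod S z / node_prod T z + (\<Sum>t\<in>T. node_prod S t / (lagrange_denom T t * (t - z)))"
    proof -
      have "(\<Sum>t\<in>T. winding_number \<gamma>' t * (node_prod S t / (\<Prod>b\<in>insert z T - {t}. t - b))) =
         (\<Sum>t\<in>T. node_prod S t / (lagrange_denom T t * (t - z)))"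
      proof (intro sum.cong refl)
        fix t assume t: "t \<in> T"
        have e1: "insert z T - {t} = insert z (T - {t})" using t zT by auto
        have e2: "(\<Prod>b\<in>insert z T - {t}. t - b) = lagrange_denom T t * (t - z)"
          unfolding e1 lagrange_denom_def using T zT by simp
        show "winding_number \<gamma>' t * (node_prod S t / (\<Prod>b\<in>insert z T - {t}. t - b)) =
           node_prod S t / (lagrange_denom T t * (t - z))"
          unfolding e2 using t gw by simp
      qed
      moreover have "insert z T - {z} = T" using zT by auto
      ultimately show ?thesis using zT T gw z by (simp add: node_prod_def)
    qed
    ultimately have "((\<lambda>w. node_prod S w / (\<Prod>a\<in>insert z T. w - a)) has_contour_integral
          2 * of_real pi * \<i> * (node_prod S z / node_prod T z + (\<Sum>t\<in>T. node_prod S t / (lagrange_denom T t * (t - z))))) \<gamma>'"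
      by simp
    from has_contour_integral_lmul[OF this, of "P z / node_prod S z"]
    have "((\<lambda>w. P z / node_prod S z * (node_prod S w / (\<Prod>a\<in>insert z T. w - a))) has_contour_integral
       2 * of_real pi * \<i> * (reduced_kernel S T P z + P z / node_prod T z)) \<gamma>'"
      using nz by (simp add: reduced_kernel_def ring_distribs mult_ac add_ac)
    moreover have "(\<lambda>w. P z / node_prod S z * (node_prod S w / (\<Prod>a\<in>insert z T. w - a))) =
       (\<lambda>w. P z / node_prod T w * (1 / (w - z)) * (node_prod S w / node_prod S z))"
      using zT T by (auto simp: node_prod_def)
    ultimately show ?thesis by (simp add: contour_integral_unique)
  qed
  have a: "(reduced_kernel S T P has_contour_integral
           2 * of_real pi * \<i> * ((\<Sum>a\<in>S. winding_number \<gamma> a * pole_weight S T P a)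
              - (\<Sum>t\<in>T. winding_number \<gamma> t * (P t / lagrange_denom T t)))) \<gamma>"
    using assms by (intro has_contour_integral_reduced_kernel) auto
  have b: "((\<lambda>z. P z / node_prod T z) has_contour_integral
           2 * of_real pi * \<i> * (\<Sum>t\<in>T. winding_number \<gamma> t * (P t / lagrange_denom T t))) \<gamma>"
    unfolding node_prod_def lagrange_denom_def
    using assms by (intro has_contour_integral_simple_poles) auto
  have "((\<lambda>z. 2 * of_real pi * \<i> * (reduced_kernel S T P z + P z / node_prod T z)) has_contour_integral
      (2 * of_real pi * \<i>)\<^sup>2 * (\<Sum>a\<in>S. winding_number \<gamma> a * pole_weight S T P a)) \<gamma>"
    using has_contour_integral_lmul[OF has_contour_integral_add[OF a b], of "2 * of_real pi * \<i>"]
    by (simp add: power2_eq_square algebra_simps)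
  then show ?thesis
    using inner by (subst contour_integral_eq[OF inner]) (auto simp: contour_integral_unique)
qed

section \<open>Vertical lines and residues\<close>

lemma integrable_inverse_one_plus_square: "integrable lborel (\<lambda>t::real. 1 / (1 + t\<^sup>2))"
  using integrable_inverse_1_plus_square by (simp add: set_integrable_def divide_inverse)

lemma continuous_on_vertical_line:
  assumes "continuous_on {z. Re z = \<beta>} f"
  shows "continuous_on UNIV (\<lambda>t. f (Complex \<beta> t))"
  by (rule continuous_on_compose2[OF assms]) (auto intro!: continuous_intros simp: Complex_eq)

text \<open>
  The line is the left side of a growing rectangle, traversed downwards, which explains the sign.
  The other three sides have length of order \<open>R\<close> and carry values of order \<open>1 / R\<^sup>2\<close>.
\<close>

lemma vertical_line_integral_eq_rectangle:
  assumes A: "finite A" "\<And>a. a \<in> A \<Longrightarrow> Re a \<noteq> \<beta>"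
    and f: "f holomorphic_on UNIV - A"
    and decay: "\<And>z. R0 \<le> norm z \<Longrightarrow> norm (f z) \<le> C / (norm z)\<^sup>2" and R0: "R0 > 0"
    and V: "eventually (\<lambda>R. contour_integral (rectpath (Complex \<beta> (-R)) (Complex (\<beta> + R) R)) f = V) at_top"
  shows "vertical_line_integral \<beta> f = - V"
proof -
  have C: "C \<ge> 0"
  proof -
    have "0 \<le> norm (f (of_real R0))" by simp
    also have "\<dots> \<le> C / R0\<^sup>2" using decay[of "of_real R0"] R0 by simp
    finally show ?thesis using R0 by (simp add: zero_le_divide_iff)
  qed
  let ?g = "\<lambda>t. f (Complex \<beta> t)"
  have contf: "continuous_on (UNIV - A) f" using f by (rule holomorphic_on_imp_continuous_on)
  have contg: "continuous_on UNIV ?g"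
    by (intro continuous_on_vertical_line continuous_on_subset[OF contf]) (use A in auto)
  have "bounded (?g ` {-max R0 1..max R0 1})"
    by (intro compact_imp_bounded compact_continuous_image continuous_on_subset[OF contg]) auto
  then obtain K where K': "\<forall>t\<in>{-max R0 1..max R0 1}. norm (?g t) \<le> K"
    unfolding bounded_iff by auto
  have K: "norm (?g t) \<le> K" if "\<bar>t\<bar> \<le> max R0 1" for t
    using K' that by (auto simp: abs_le_iff)
  have K0: "K \<ge> 0" using K[of 0] norm_ge_zero[of "?g 0"] by linarith
  \<comment> \<open>A common constant for the compact part of the line, where the function is bounded by \<open>K\<close>, and for the rest.\<close>
  define D where "D = 2 * C + K * (1 + (max R0 1)\<^sup>2)"
  have gb: "norm (?g t) \<le> D * (1 / (1 + t\<^sup>2))" for t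
  proof (cases "\<bar>t\<bar> \<le> max R0 1")
    case True
    then have "t\<^sup>2 \<le> (max R0 1)\<^sup>2" by (metis abs_ge_zero power2_abs power_mono)
    then have "K * (1 + t\<^sup>2) \<le> D" unfolding D_def using K0 C
      by (smt (verit) mult_left_mono)
    moreover have "0 < 1 + t\<^sup>2" by (simp add: add_pos_nonneg)
    ultimately have "K \<le> D * (1 / (1 + t\<^sup>2))" by (simp add: pos_le_divide_eq)
    with K[OF True] show ?thesis by linarith
  next
    case False
    have n: "\<bar>t\<bar> \<le> norm (Complex \<beta> t)" using abs_Im_le_cmod[of "Complex \<beta> t"] by simp
    have "norm (?g t) \<le> C / (norm (Complex \<beta> t))\<^sup>2" using n False by (intro decay) auto
    also have "\<dots> \<le> C / t\<^sup>2"
    proof (intro divide_left_mono mult_pos_pos)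
      have "t \<noteq> 0" using False by auto
      then show "0 < t\<^sup>2" "0 < (norm (Complex \<beta> t))\<^sup>2" by (auto simp: complex_eq_iff)
    qed (use n C in \<open>auto simp: abs_le_square_iff[symmetric]\<close>)
    also have "\<dots> \<le> D / (1 + t\<^sup>2)"
    proof -
      have "1 \<le> t\<^sup>2" using False abs_le_square_iff[of 1 t] by auto
      then have "C * (1 + t\<^sup>2) \<le> 2 * C * t\<^sup>2" using C mult_left_mono[of 1 "t\<^sup>2" C] by (simp add: algebra_simps)
      also have "\<dots> \<le> D * t\<^sup>2" unfolding D_def using K0 by (intro mult_right_mono) auto
      finally show ?thesis using \<open>1 \<le> t\<^sup>2\<close> False by (auto simp: divide_simps)
    qed
    finally show ?thesis by simp
  qed
  have gm[measurable]: "?g \<in> borel_measurable borel"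
    using contg by (rule borel_measurable_continuous_onI)
  have intg: "integrable lborel ?g"
  proof (rule Bochner_Integration.integrable_bound[where f="\<lambda>t. D * (1 / (1 + t\<^sup>2))"])
    show "integrable lborel (\<lambda>t. D * (1 / (1 + t\<^sup>2)))"
      by (intro integrable_mult_right integrable_inverse_one_plus_square)
    show "AE t in lborel. norm (?g t) \<le> norm (D * (1 / (1 + t\<^sup>2)))"
    proof (intro AE_I2)
      fix t
      show "norm (?g t) \<le> norm (D * (1 / (1 + t\<^sup>2)))"
        unfolding real_norm_def using gb[of t] abs_ge_self[of "D * (1 / (1 + t\<^sup>2))"] by linarith
    qed
  qed auto
  have lim1: "((\<lambda>R. integral {-R..R} ?g) \<longlongrightarrow> (\<integral>t. ?g t \<partial>lborel)) at_top"
  proof -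
    have "((\<lambda>R. \<integral>t. indicator {-R..R} t *\<^sub>R ?g t \<partial>lborel) \<longlongrightarrow> (\<integral>t. ?g t \<partial>lborel)) at_top"
    proof (rule integral_dominated_convergence_at_top[where w="\<lambda>t. norm (?g t)"])
      show "AE t in lborel. ((\<lambda>R. indicator {-R..R} t *\<^sub>R ?g t) \<longlongrightarrow> ?g t) at_top"
      proof (intro AE_I2 tendsto_eventually)
        fix t :: real
        show "\<forall>\<^sub>F R in at_top. indicator {-R..R} t *\<^sub>R ?g t = ?g t"
          using eventually_ge_at_top[of "\<bar>t\<bar>"] by eventually_elim (auto simp: indicator_def abs_le_iff)
      qed
    qed (use intg in \<open>auto split: split_indicator\<close>)
    moreover have "(\<integral>t. indicator {-R..R} t *\<^sub>R ?g t \<partial>lborel) = integral {-R..R} ?g" for R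
    proof -
      have "set_integrable lborel {-R..R} ?g"
        by (intro borel_integrable_atLeastAtMost' continuous_on_subset[OF contg]) auto
      from set_borel_integral_eq_integral(2)[OF this] show ?thesis by (simp add: set_lebesgue_integral_def)
    qed
    ultimately show ?thesis by simp
  qed
  have "finite (Re ` A \<union> Im ` A)" using A by auto
  then obtain L where L: "\<And>a. a \<in> A \<Longrightarrow> \<bar>Re a\<bar> \<le> L \<and> \<bar>Im a\<bar> \<le> L"
    using finite_imp_bounded[of "Re ` A \<union> Im ` A"] unfolding bounded_real by auto
  have est: "\<forall>\<^sub>F R in at_top. norm (V + \<i> * integral {-R..R} ?g) \<le> 10 * C / R"
    using V eventually_gt_at_top[of "R0 + \<bar>\<beta>\<bar>"] eventually_gt_at_top[of R0]  eventually_gt_at_top[of "L + \<bar>\<beta>\<bar>"] eventually_gt_at_top[of "2 * \<bar>\<beta>\<bar> "] eventually_gt_at_top[of "L + 2 * \<bar>\<beta>\<bar> + R0"]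
  proof eventually_elim
    case (elim R)
    have R: "R > 0" "R \<ge> R0" "\<beta> + R > 0" "\<beta> + R \<ge> R / 2" using elim R0 by auto
    let ?p1 = "Complex \<beta> (-R)" and ?p2 = "Complex (\<beta> + R) (-R)" and ?p3 = "Complex (\<beta> + R) R" and ?p4 = "Complex \<beta> R"
    have avoid: "path_image (rectpath ?p1 ?p3) \<inter> A = {}"
    proof -
      have "a \<notin> path_image (rectpath ?p1 ?p3)" if "a \<in> A" for a
        using L[OF that] A(2)[OF that] elim R by (auto simp: path_image_rectpath)
      then show ?thesis by blast
    qed
    have pi: "path_image (rectpath ?p1 ?p3) = closed_segment ?p1 ?p2 \<union> closed_segment ?p2 ?p3 \<union> closed_segment ?p3 ?p4 \<union> closed_segment ?p4 ?p1"
      unfolding rectpath_def Let_def by (auto simp: path_image_join)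
    have ci: "f contour_integrable_on linepath a b"
      if "closed_segment a b \<subseteq> path_image (rectpath ?p1 ?p3)" for a b
      using that avoid by (intro contour_integrable_continuous_linepath continuous_on_subset[OF contf]) auto
    have c: "f contour_integrable_on linepath ?p1 ?p2" "f contour_integrable_on linepath ?p2 ?p3"
      "f contour_integrable_on linepath ?p3 ?p4" "f contour_integrable_on linepath ?p4 ?p1"
      by (rule ci; auto simp: pi)+
    have "V = contour_integral (linepath ?p1 ?p2) f + contour_integral (linepath ?p2 ?p3) f + contour_integral (linepath ?p3 ?p4) f
        + contour_integral (linepath ?p4 ?p1) f"
      unfolding elim(1)[symmetric] rectpath_def Let_def using c by simp
    also have "contour_integral (linepath ?p4 ?p1) f = - contour_integral (linepath ?p1 ?p4) f"
      using contour_integral_reversepath[of "linepath ?p1 ?p4" f] by simp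
    also have "contour_integral (linepath ?p1 ?p4) f = \<i> * integral {-R..R} ?g"
      using R by (intro contour_integral_linepath_same_Re) auto
    finally have eq: "V + \<i> * integral {-R..R} ?g = contour_integral (linepath ?p1 ?p2) f + contour_integral (linepath ?p2 ?p3) f + contour_integral (linepath ?p3 ?p4) f"
      by simp
    have dec: "norm (f z) \<le> C / M\<^sup>2" if "M \<le> \<bar>Re z\<bar> \<or> M \<le> \<bar>Im z\<bar>" "M \<ge> R0" for z M
    proof -
      have n: "M \<le> norm z" using that abs_Re_le_cmod[of z] abs_Im_le_cmod[of z] by linarith
      have "norm (f z) \<le> C / (norm z)\<^sup>2" using n that by (intro decay) auto
      also have "\<dots> \<le> C / M\<^sup>2" using n C that R0 by (intro divide_left_mono power_mono mult_pos_pos) auto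
      finally show ?thesis .
    qed
    have b1: "norm (contour_integral (linepath ?p1 ?p2) f) \<le> C / R\<^sup>2 * norm (?p2 - ?p1)"
      using C R by (intro contour_integral_bound_linepath c dec) (auto simp: closed_segment_same_Im)
    have b3: "norm (contour_integral (linepath ?p3 ?p4) f) \<le> C / R\<^sup>2 * norm (?p4 - ?p3)"
      using C R by (intro contour_integral_bound_linepath c dec) (auto simp: closed_segment_same_Im)
    have b2: "norm (contour_integral (linepath ?p2 ?p3) f) \<le> C / (\<beta> + R)\<^sup>2 * norm (?p3 - ?p2)"
      using C R elim R0 by (intro contour_integral_bound_linepath c dec) (auto simp: closed_segment_same_Re)
    have len: "norm (?p2 - ?p1) = R" "norm (?p3 - ?p2) = 2 * R" "norm (?p4 - ?p3) = R"
      using R by (simp_all add: complex_diff complex_norm real_sqrt_mult)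
    have "norm (V + \<i> * integral {-R..R} ?g) \<le> C / R\<^sup>2 * R + C / (\<beta> + R)\<^sup>2 * (2 * R) + C / R\<^sup>2 * R"
      unfolding eq using b1[unfolded len] b2[unfolded len] b3[unfolded len]
        norm_triangle_ineq[of "contour_integral (linepath ?p1 ?p2) f + contour_integral (linepath ?p2 ?p3) f" "contour_integral (linepath ?p3 ?p4) f"]
        norm_triangle_ineq[of "contour_integral (linepath ?p1 ?p2) f" "contour_integral (linepath ?p2 ?p3) f"]
      by linarith
    also have "\<dots> \<le> C / R\<^sup>2 * R + C / (R / 2)\<^sup>2 * (2 * R) + C / R\<^sup>2 * R"
      using R C by (intro add_mono mult_right_mono divide_left_mono power_mono) auto
    also have "\<dots> = 10 * C / R" using R by (simp add: power2_eq_square field_simps)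
    finally show ?case .
  qed
  have "((\<lambda>R. V + \<i> * integral {-R..R} ?g) \<longlongrightarrow> 0) at_top"
    by (rule Lim_null_comparison[OF est]) (real_asymp)
  moreover have "((\<lambda>R. V + \<i> * integral {-R..R} ?g) \<longlongrightarrow> V + vertical_line_integral \<beta> f) at_top"
    unfolding vertical_line_integral_def by (intro tendsto_intros lim1)
  ultimately have "V + vertical_line_integral \<beta> f = 0"
    by (intro tendsto_unique[OF trivial_limit_at_top_linorder])
  then show ?thesis by (simp add: eq_neg_iff_add_eq_0 add.commute)
qed

lemma node_prod_lower_bound:
  assumes "finite S" "\<And>a. a \<in> S \<Longrightarrow> 2 * norm a \<le> norm z"
  shows "(norm z / 2) ^ card S \<le> norm (node_prod S z)"
proof -
  have "(norm z / 2) ^ card S = (\<Prod>a\<in>S. norm z / 2)" by simp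
  also have "\<dots> \<le> (\<Prod>a\<in>S. norm (z - a))"
  proof (intro prod_mono conjI)
    fix a assume "a \<in> S"
    then show "norm z / 2 \<le> norm (z - a)" using assms(2)[of a] norm_triangle_ineq2[of z a] by linarith
  qed auto
  finally show ?thesis by (simp add: node_prod_def prod_norm)
qed

text \<open>
  The degree condition makes the reduced kernel decay quadratically: its numerator has degree \<open>k\<close>,
  its denominators have degree \<open>card S + 1 \<ge> k + 2\<close>.
\<close>

lemma vertical_line_integral_reduced_kernel:
  assumes S: "finite S" and T: "finite T" and P: "P holomorphic_on UNIV"
    and deg: "\<And>z. 1 \<le> norm z \<Longrightarrow> norm (P z) \<le> C * norm z ^ k" "k < card S"
    and \<beta>: "\<And>a. a \<in> S \<union> T \<Longrightarrow> Re a \<noteq> \<beta>"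
  shows "vertical_line_integral \<beta> (reduced_kernel S T P) =
     - (2 * of_real pi * \<i>) * ((\<Sum>a\<in>{a\<in>S. \<beta> < Re a}. pole_weight S T P a)
              - (\<Sum>t\<in>{t\<in>T. \<beta> < Re t}. P t / lagrange_denom T t))"
proof -
  have C: "C \<ge> 0" using deg(1)[of 1] norm_ge_zero[of "P 1"] by (simp del: norm_ge_zero)
  obtain L where L: "\<And>a. a \<in> S \<union> T \<Longrightarrow> norm a \<le> L"
    using finite_imp_bounded[of "S \<union> T"] S T unfolding bounded_iff by auto
  define D where "D = (\<Sum>t\<in>T. C * 2 ^ (card S + 1) * norm (node_prod S t / lagrange_denom T t))"
  have decay: "norm (reduced_kernel S T P z) \<le> D / (norm z)\<^sup>2" if z: "norm z \<ge> 2 * \<bar>L\<bar> + 1" for z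
  proof -
    have z1: "norm z \<ge> 1" using z by auto
    have bnd: "2 * norm a \<le> norm z" if "a \<in> S \<union> T" for a using L[OF that] z by auto
    have "norm (reduced_kernel S T P z) = norm (\<Sum>t\<in>T. P z / (node_prod S z * (t - z)) * (node_prod S t / lagrange_denom T t))"
      unfolding reduced_kernel_def sum_distrib_left by (intro arg_cong[where f=norm] sum.cong) auto
    also have "\<dots> \<le> (\<Sum>t\<in>T. C * 2 ^ (card S + 1) / (norm z)\<^sup>2 * norm (node_prod S t / lagrange_denom T t))"
    proof (rule sum_norm_le)
      fix t assume t: "t \<in> T"
      have "norm (t - z) \<ge> norm z / 2" using bnd[of t] t norm_triangle_ineq2[of z t] by (auto simp: norm_minus_commute)
      then have "(norm z / 2) ^ card S * (norm z / 2) \<le> norm (node_prod S z * (t - z))"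
        unfolding norm_mult using S bnd by (intro mult_mono node_prod_lower_bound) auto
      then have "norm (P z / (node_prod S z * (t - z))) \<le> C * norm z ^ k / ((norm z / 2) ^ card S * (norm z / 2))"
        unfolding norm_divide using z1 deg(1)[OF z1] C
        by (intro frac_le mult_pos_pos zero_less_power) auto
      also have "\<dots> = C * 2 ^ (card S + 1) * norm z ^ k / norm z ^ (card S + 1)"
        by (simp add: power_divide field_simps)
      also have "\<dots> \<le> C * 2 ^ (card S + 1) / (norm z)\<^sup>2"
      proof -
        have "norm z ^ k * (norm z)\<^sup>2 \<le> norm z ^ (card S + 1)"
          unfolding power_add[symmetric] using z1 deg(2) by (intro power_increasing) auto
        then have "norm z ^ k / norm z ^ (card S + 1) \<le> 1 / (norm z)\<^sup>2" using z1 by (auto simp: divide_simps)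
        from mult_left_mono[OF this, of "C * 2 ^ (card S + 1)"] C show ?thesis by simp
      qed
      finally show "norm (P z / (node_prod S z * (t - z)) * (node_prod S t / lagrange_denom T t)) \<le>
         C * 2 ^ (card S + 1) / (norm z)\<^sup>2 * norm (node_prod S t / lagrange_denom T t)"
        unfolding norm_mult by (intro mult_right_mono) auto
    qed
    also have "\<dots> = D / (norm z)\<^sup>2" by (simp add: D_def sum_divide_distrib)
    finally show ?thesis .
  qed
  have "node_prod S holomorphic_on UNIV - (S \<union> T)"
    unfolding node_prod_def by (intro holomorphic_intros)
  moreover have "P holomorphic_on UNIV - (S \<union> T)" by (rule holomorphic_on_subset[OF P]) auto
  moreover have "node_prod S z \<noteq> 0" "lagrange_denom T t * (t - z) \<noteq> 0" if "z \<in> UNIV - (S \<union> T)" "t \<in> T" for z t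
    using that by (auto simp: node_prod_eq_0[OF S] lagrange_denom_nonzero[OF T])
  moreover have "node_prod S z \<noteq> 0" if "z \<in> UNIV - (S \<union> T)" for z
    using that by (auto simp: node_prod_eq_0[OF S])
  ultimately have hol: "reduced_kernel S T P holomorphic_on UNIV - (S \<union> T)"
    unfolding reduced_kernel_def by (intro holomorphic_intros) blast+
  let ?V = "2 * of_real pi * \<i> * ((\<Sum>a\<in>{a\<in>S. \<beta> < Re a}. pole_weight S T P a)
              - (\<Sum>t\<in>{t\<in>T. \<beta> < Re t}. P t / lagrange_denom T t))"
  have V: "\<forall>\<^sub>F R in at_top. contour_integral (rectpath (Complex \<beta> (-R)) (Complex (\<beta> + R) R)) (reduced_kernel S T P) = ?V"
    using eventually_gt_at_top[of "\<bar>L\<bar> + \<bar>\<beta>\<bar>"]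
  proof eventually_elim
    case (elim R)
    let ?p1 = "Complex \<beta> (-R)" and ?p3 = "Complex (\<beta> + R) R"
    have loc: "\<bar>Re a\<bar> \<le> L" "\<bar>Im a\<bar> \<le> L" "Re a \<noteq> \<beta>" if "a \<in> S \<union> T" for a
      using L[OF that] \<beta>[OF that] abs_Re_le_cmod[of a] abs_Im_le_cmod[of a] by linarith+
    have avoid: "path_image (rectpath ?p1 ?p3) \<inter> (S \<union> T) = {}"
    proof -
      have "a \<notin> path_image (rectpath ?p1 ?p3)" if "a \<in> S \<union> T" for a
        using loc[OF that] elim by (auto simp: path_image_rectpath)
      then show ?thesis by blast
    qed
    have w: "winding_number (rectpath ?p1 ?p3) a = (if \<beta> < Re a then 1 else 0)" if "a \<in> S \<union> T" for a
    proof (cases "\<beta> < Re a")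
      case True
      then show ?thesis using loc[OF that] elim
        by (auto intro!: winding_number_rectpath simp: in_box_complex_iff)
    next
      case False
      then show ?thesis using loc[OF that] elim
        by (auto intro!: winding_number_rectpath_outside simp: in_cbox_complex_iff)
    qed
    have "contour_integral (rectpath ?p1 ?p3) (reduced_kernel S T P) = 2 * of_real pi * \<i> * ((\<Sum>a\<in>S. winding_number (rectpath ?p1 ?p3) a * pole_weight S T P a)
              - (\<Sum>t\<in>T. winding_number (rectpath ?p1 ?p3) t * (P t / lagrange_denom T t)))"
      using avoid by (intro contour_integral_unique has_contour_integral_reduced_kernel S T P) auto
    also have "(\<Sum>a\<in>S. winding_number (rectpath ?p1 ?p3) a * pole_weight S T P a) = (\<Sum>a\<in>{a\<in>S. \<beta> < Re a}. pole_weight S T P a)"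
      using S by (subst sum.inter_filter) (auto intro!: sum.cong simp: w)
    also have "(\<Sum>t\<in>T. winding_number (rectpath ?p1 ?p3) t * (P t / lagrange_denom T t)) = (\<Sum>t\<in>{t\<in>T. \<beta> < Re t}. P t / lagrange_denom T t)"
      using T by (subst sum.inter_filter) (auto intro!: sum.cong simp: w)
    finally show ?case .
  qed
  have "vertical_line_integral \<beta> (reduced_kernel S T P) = - ?V"
  proof (rule vertical_line_integral_eq_rectangle[OF _ _ hol decay _ V])
    show "finite (S \<union> T)" using S T by simp
    show "Re a \<noteq> \<beta>" if "a \<in> S \<union> T" for a using \<beta>[OF that] .
    show "0 < 2 * \<bar>L\<bar> + 1" by linarith
  qed
  then show ?thesis by (simp only: mult_minus_left)
qed

section \<open>The far zeros of the boundary polynomial\<close>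

text \<open>
  The normalised product over the zeros \<open>h, \<dots>, 2 h - 1\<close> and \<open>- 2 h, \<dots>, - h - 1\<close> of the boundary
  polynomial, in the coordinate \<open>u = sqrt h * w\<close>.
\<close>

definition far_factor :: "nat \<Rightarrow> complex \<Rightarrow> complex" where
  "far_factor h w = (\<Prod>j\<in>{h..<2*h}. 1 - of_real (sqrt h) * w / of_nat j) *
                    (\<Prod>j\<in>{h<..2*h}. 1 + of_real (sqrt h) * w / of_nat j)"

text \<open>
  Zeros of opposite sign are paired. The two unpaired ones, \<open>h\<close> and \<open>- 2 h\<close>, give the first two
  factors, which tend to 1.
\<close>

lemma far_factor_eq:
  assumes "h > 0"
  shows "far_factor h w = (1 - w / of_real (sqrt h)) * (1 + w / of_real (2 * sqrt h)) *
           (\<Prod>j\<in>{h<..<2*h}. 1 - of_nat h * w\<^sup>2 / (of_nat j)\<^sup>2)"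
proof -
  have s2: "complex_of_real (sqrt h) * complex_of_real (sqrt h) = of_nat h"
    by (metis of_nat_0_le_iff of_real_mult of_real_of_nat_eq real_sqrt_mult_self abs_of_nonneg)
  have s0: "complex_of_real (sqrt h) \<noteq> 0" using assms by simp
  have e1: "{h..<2*h} = insert h {h<..<2*h}" and e2: "{h<..2*h} = insert (2*h) {h<..<2*h}"
    using assms by auto
  have f1: "of_real (sqrt h) * w / of_nat h = w / of_real (sqrt h)"
    using s0 by (simp add: s2[symmetric] field_simps)
  have f2: "of_real (sqrt h) * w / of_nat (2 * h) = w / of_real (2 * sqrt h)"
    using s0 by (simp add: s2[symmetric] field_simps)
  have "(1 - of_real (sqrt h) * w / of_nat j) * (1 + of_real (sqrt h) * w / of_nat j)
     = 1 - of_nat h * w\<^sup>2 / (of_nat j)\<^sup>2" for j :: nat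
    by (simp add: s2[symmetric] power2_eq_square algebra_simps)
  then have "(\<Prod>j\<in>{h<..<2*h}. 1 - of_real (sqrt h) * w / of_nat j) * (\<Prod>j\<in>{h<..<2*h}. 1 + of_real (sqrt h) * w / of_nat j)
     = (\<Prod>j\<in>{h<..<2*h}. 1 - of_nat h * w\<^sup>2 / (of_nat j)\<^sup>2)"
    by (simp only: prod.distrib[symmetric])
  moreover have "far_factor h w = (1 - w / of_real (sqrt h)) * (1 + w / of_real (2 * sqrt h)) *
     ((\<Prod>j\<in>{h<..<2*h}. 1 - of_real (sqrt h) * w / of_nat j) * (\<Prod>j\<in>{h<..<2*h}. 1 + of_real (sqrt h) * w / of_nat j))"
    unfolding far_factor_def e1 e2 by (simp only: f1 f2 prod.insert finite_greaterThanLessThan greaterThanLessThan_iff less_irrefl simp_thms not_False_eq_True)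
       (simp only: mult_ac)
  ultimately show ?thesis by simp
qed

lemma norm_far_factor_le:
  assumes "h > 0"
  shows "norm (far_factor h w) \<le> (1 + norm w)\<^sup>2 * exp ((norm w)\<^sup>2)"
proof -
  have s1: "sqrt h \<ge> 1" using assms by simp
  have "norm (\<Prod>j\<in>{h<..<2*h}. 1 - of_nat h * w\<^sup>2 / (of_nat j)\<^sup>2) \<le> (\<Prod>j\<in>{h<..<2*h}. exp ((norm w)\<^sup>2 / h))"
    unfolding prod_norm[symmetric]
  proof (intro prod_mono conjI norm_ge_zero)
    fix j assume j: "j \<in> {h<..<2*h}"
    have "norm (1 - of_nat h * w\<^sup>2 / (of_nat j)\<^sup>2) \<le> 1 + h * (norm w)\<^sup>2 / (real j)\<^sup>2"
      by (rule order.trans[OF norm_triangle_ineq4]) (simp add: norm_mult norm_divide norm_power)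
    also have "h * (norm w)\<^sup>2 / (real j)\<^sup>2 \<le> h * (norm w)\<^sup>2 / (real h)\<^sup>2"
      using j assms by (intro divide_left_mono power_mono) auto
    also have "h * (norm w)\<^sup>2 / (real h)\<^sup>2 = (norm w)\<^sup>2 / h" using assms by (simp add: power2_eq_square)
    also have "1 + (norm w)\<^sup>2 / h \<le> exp ((norm w)\<^sup>2 / h)" by (rule exp_ge_add_one_self)
    finally show "norm (1 - of_nat h * w\<^sup>2 / (of_nat j)\<^sup>2) \<le> exp ((norm w)\<^sup>2 / h)" by simp
  qed
  also have "\<dots> = exp (real (h - 1) * ((norm w)\<^sup>2 / h))"
    by (subst prod_constant) (simp add: exp_of_nat_mult[symmetric])
  also have "\<dots> \<le> exp ((norm w)\<^sup>2)"
  proof -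
    have "real (h - 1) * (norm w)\<^sup>2 \<le> real h * (norm w)\<^sup>2" by (intro mult_right_mono) auto
    then show ?thesis using assms by (simp add: field_simps)
  qed
  finally have p: "norm (\<Prod>j\<in>{h<..<2*h}. 1 - of_nat h * w\<^sup>2 / (of_nat j)\<^sup>2) \<le> exp ((norm w)\<^sup>2)" .
  have le: "norm w / c \<le> norm w" if "1 \<le> c" for c
    using frac_le[of "norm w" "norm w" 1 c] that by simp
  have a: "norm (1 - w / of_real (sqrt h)) \<le> 1 + norm w"
    using norm_triangle_ineq4[of 1 "w / of_real (sqrt h)"] le[of "sqrt h"] s1 by (auto simp: norm_divide)
  have b: "norm (1 + w / of_real (2 * sqrt h)) \<le> 1 + norm w"
    using norm_triangle_ineq[of 1 "w / of_real (2 * sqrt h)"] le[of "2 * sqrt h"] s1 by (auto simp: norm_divide norm_mult)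
  show ?thesis
    unfolding far_factor_eq[OF assms] norm_mult power2_eq_square
    by (intro mult_mono a b p[unfolded power2_eq_square]) auto
qed

lemma exp_le_one_minus: "exp (- 2 * x) \<le> 1 - x" if "0 \<le> x" "x \<le> 1 / 2" for x :: real
proof -
  have "2 * x\<^sup>2 \<le> x" using mult_right_mono[OF that(2) that(1)] by (simp add: power2_eq_square)
  then have "- 2 * x \<le> - x - 2 * x\<^sup>2" by linarith
  also have "\<dots> \<le> ln (1 - x)" using that by (rule ln_one_minus_pos_lower_bound)
  finally have "exp (- 2 * x) \<le> exp (ln (1 - x))" by simp
  then show ?thesis using that by simp
qed

text \<open>
  This supplies the integrable majorant on vertical lines. Each paired factor has real part at least
  \<open>(1 - R\<^sup>2 / h) * (1 + (Im w)\<^sup>2 / (4 h))\<close>. Over the \<open>h - 1\<close> factors the first part stays bounded below,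
  and the second part, grouped into \<open>M + 1\<close> blocks to which Bernoulli's inequality applies, grows like
  the power \<open>M + 1\<close> of \<open>1 + (Im w)\<^sup>2\<close>.
\<close>

lemma far_factor_lower_bound:
  fixes R :: real and M :: nat
  shows "\<exists>c>0. \<forall>\<^sub>F h in sequentially. \<forall>w. \<bar>Re w\<bar> \<le> R \<longrightarrow> c * (1 + (Im w)\<^sup>2) ^ M \<le> norm (far_factor h w)"
proof (intro exI conjI)
  define M' where "M' = M + 1"
  define c where "c = 1 / 2 * (1 / 2) * (exp (- 2 * R\<^sup>2) * (1 / (8 * real M')) ^ M')"
  show c: "c > 0" by (simp add: c_def M'_def)
  have ev: "\<forall>\<^sub>F h in sequentially. h \<ge> 2 * M' + 2 \<and> real h \<ge> 4 * R\<^sup>2"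
    by (intro eventually_conj eventually_ge_at_top) real_asymp
  then show "\<forall>\<^sub>F h in sequentially. \<forall>w. \<bar>Re w\<bar> \<le> R \<longrightarrow> c * (1 + (Im w)\<^sup>2) ^ M \<le> norm (far_factor h w)"
  proof (eventually_elim, intro allI impI)
    fix h :: nat and w :: complex
    assume h: "h \<ge> 2 * M' + 2 \<and> real h \<ge> 4 * R\<^sup>2" and w: "\<bar>Re w\<bar> \<le> R"
    define t where "t = Im w"
    have h0: "h > 0" using h by auto
    have R0: "R \<ge> 0" using w by auto
    have s: "sqrt h \<ge> 2 * R"
      using h R0 by (intro real_le_rsqrt) (auto simp: power2_eq_square)
    have s0: "sqrt h > 0" using h0 by simp
    have near: "1 / 2 \<le> norm (1 + v)" if "\<bar>Re v\<bar> \<le> 1 / 2" for v :: complex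
      using that abs_Re_le_cmod[of "1 + v"] by auto
    have a: "1 / 2 \<le> norm (1 - w / of_real (sqrt h))"
      using near[of "- w / of_real (sqrt h)"] w s s0 by (auto simp: abs_le_iff divide_simps simp del: of_real_sqrt)
    have b: "1 / 2 \<le> norm (1 + w / of_real (2 * sqrt h))"
      using w s s0 by (intro near, unfold Re_divide_of_real) (auto simp: abs_le_iff divide_simps)
    have x: "0 \<le> R\<^sup>2 / h" "R\<^sup>2 / h \<le> 1 / 2" using h h0 by (auto simp: divide_simps)
    have x1: "R\<^sup>2 / h \<le> 1" using x(2) by linarith
    have "((1 - R\<^sup>2 / h) * (1 + t\<^sup>2 / (4 * h))) ^ (h - 1) = (\<Prod>j\<in>{h<..<2*h}. (1 - R\<^sup>2 / h) * (1 + t\<^sup>2 / (4 * h)))"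
      by (subst prod_constant) simp
    also have "\<dots> \<le> (\<Prod>j\<in>{h<..<2*h}. norm (1 - of_nat h * w\<^sup>2 / (of_nat j)\<^sup>2))"
    proof (intro prod_mono conjI)
      fix j assume j: "j \<in> {h<..<2*h}"
      show "0 \<le> (1 - R\<^sup>2 / h) * (1 + t\<^sup>2 / (4 * h))" using x(2) h0 by (intro mult_nonneg_nonneg) (linarith, auto)
      have jh: "real h / (real j)\<^sup>2 \<le> 1 / h" "1 / (4 * real h) \<le> real h / (real j)\<^sup>2"
      proof -
        have "(real h)\<^sup>2 \<le> (real j)\<^sup>2" "(real j)\<^sup>2 \<le> (2 * real h)\<^sup>2" using j by (intro power_mono; auto)+
        moreover have "real j > 0" using j by auto
        ultimately show "real h / (real j)\<^sup>2 \<le> 1 / h" "1 / (4 * real h) \<le> real h / (real j)\<^sup>2"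
          using h0 by (auto simp: divide_simps power2_eq_square)
      qed
      have "Re w * Re w \<le> R\<^sup>2" using w abs_le_square_iff[of "Re w" R] R0 by (simp add: power2_eq_square)
      then have "real h / (real j)\<^sup>2 * (Re w)\<^sup>2 \<le> 1 / h * R\<^sup>2" using jh by (intro mult_mono) (auto simp: power2_eq_square)
      moreover have "1 / (4 * real h) * t\<^sup>2 \<le> real h / (real j)\<^sup>2 * t\<^sup>2" using jh by (intro mult_right_mono) auto
      moreover have "Re (1 - of_nat h * w\<^sup>2 / (of_nat j)\<^sup>2) = 1 - real h / (real j)\<^sup>2 * (Re w)\<^sup>2 + real h / (real j)\<^sup>2 * t\<^sup>2"
      proof -
        have "of_nat h * w\<^sup>2 / (of_nat j)\<^sup>2 = of_real (real h / (real j)\<^sup>2) * w\<^sup>2" by simp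
        then show ?thesis by (simp only: minus_complex.simps Re_complex_of_real one_complex.simps times_complex.simps
             complex_Re_of_nat power2_eq_square t_def) (simp add: algebra_simps)
      qed
      moreover have "(1 - R\<^sup>2 / h) * (1 + t\<^sup>2 / (4 * h)) \<le> 1 - 1 / h * R\<^sup>2 + 1 / (4 * real h) * t\<^sup>2"
      proof -
        have "(1 - a) * (1 + b) \<le> 1 - a + b" if "a \<ge> 0" "b \<ge> 0" for a b :: real
          using mult_nonneg_nonneg[OF that] by (simp add: algebra_simps)
        from this[of "R\<^sup>2 / h" "t\<^sup>2 / (4 * h)"] x show ?thesis by simp
      qed
      ultimately show "(1 - R\<^sup>2 / h) * (1 + t\<^sup>2 / (4 * h)) \<le> norm (1 - of_nat h * w\<^sup>2 / (of_nat j)\<^sup>2)"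
        using complex_Re_le_cmod[of "1 - of_nat h * w\<^sup>2 / (of_nat j)\<^sup>2"] by linarith
    qed
    finally have p: "((1 - R\<^sup>2 / h) * (1 + t\<^sup>2 / (4 * h))) ^ (h - 1) \<le> norm (\<Prod>j\<in>{h<..<2*h}. 1 - of_nat h * w\<^sup>2 / (of_nat j)\<^sup>2)"
      by (simp add: prod_norm)
    have e: "exp (- 2 * R\<^sup>2) \<le> (1 - R\<^sup>2 / h) ^ (h - 1)"
    proof -
      have "real (h - 1) * R\<^sup>2 \<le> real h * R\<^sup>2" by (intro mult_right_mono) auto
      then have "exp (- 2 * R\<^sup>2) \<le> exp (real (h - 1) * (- 2 * (R\<^sup>2 / h)))" using h0 by (simp add: field_simps)
      also have "\<dots> = exp (- 2 * (R\<^sup>2 / h)) ^ (h - 1)" by (rule exp_of_nat_mult)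
      also have "\<dots> \<le> (1 - R\<^sup>2 / h) ^ (h - 1)" using exp_le_one_minus[OF x] by (intro power_mono) auto
      finally show ?thesis .
    qed
    \<comment> \<open>The exponent \<open>h - 1\<close> contains \<open>M'\<close> blocks of length \<open>q\<close>, of order \<open>h / M'\<close>.\<close>
    have q: "(1 / (8 * real M')) ^ M' * (1 + t\<^sup>2) ^ M \<le> (1 + t\<^sup>2 / (4 * h)) ^ (h - 1)"
    proof -
      define q where "q = (h - 1) div M'"
      have "h - 1 < (q + 1) * M'" unfolding q_def M'_def using dividend_less_div_times[of "M + 1" "h - 1"] by simp
      then have "real h \<le> real ((q + 1) * M')" unfolding of_nat_le_iff using h0 by linarith
      then have "real h \<le> (real q + 1) * real M'" by (simp add: algebra_simps)
      then have "real q * real M' \<ge> real h / 2" using h by (simp add: algebra_simps)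
      then have qh: "real q / (4 * h) \<ge> 1 / (8 * real M')" using h0 by (simp add: M'_def field_simps)
      have "(1 / (8 * real M')) ^ M' * (1 + t\<^sup>2) ^ M \<le> (1 / (8 * real M')) ^ M' * (1 + t\<^sup>2) ^ M'"
        unfolding M'_def by (intro mult_left_mono power_increasing) auto
      also have "\<dots> = (1 / (8 * real M') * (1 + t\<^sup>2)) ^ M'" by (simp add: power_mult_distrib power_divide)
      also have "\<dots> \<le> (1 + real q * (t\<^sup>2 / (4 * h))) ^ M'"
      proof (intro power_mono)
        have "1 / (8 * real M') * t\<^sup>2 \<le> real q / (4 * h) * t\<^sup>2" using qh by (intro mult_right_mono) auto
        moreover have "1 / (8 * real M') \<le> 1" by (simp add: M'_def)
        ultimately show "1 / (8 * real M') * (1 + t\<^sup>2) \<le> 1 + real q * (t\<^sup>2 / (4 * h))" by (simp add: add_divide_distrib)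
      qed auto
      also have "\<dots> \<le> ((1 + t\<^sup>2 / (4 * h)) ^ q) ^ M'"
      proof (intro power_mono Bernoulli_inequality)
        have "0 \<le> t\<^sup>2 / (4 * h)" by simp
        then show "- 1 \<le> t\<^sup>2 / (4 * h)" by linarith
      qed auto
      also have "\<dots> = (1 + t\<^sup>2 / (4 * h)) ^ (q * M')" by (simp add: power_mult)
      also have "\<dots> \<le> (1 + t\<^sup>2 / (4 * h)) ^ (h - 1)" by (intro power_increasing) (auto simp: q_def)
      finally show ?thesis .
    qed
    have "c * (1 + t\<^sup>2) ^ M = 1 / 2 * (1 / 2) * (exp (- 2 * R\<^sup>2) * ((1 / (8 * real M')) ^ M' * (1 + t\<^sup>2) ^ M))"
      by (simp add: c_def)
    also have "\<dots> \<le> norm (1 - w / of_real (sqrt h)) * norm (1 + w / of_real (2 * sqrt h)) *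
       ((1 - R\<^sup>2 / h) ^ (h - 1) * (1 + t\<^sup>2 / (4 * h)) ^ (h - 1))"
      using x1 by (intro mult_mono a b e q mult_nonneg_nonneg zero_le_power) auto
    also have "\<dots> \<le> norm (1 - w / of_real (sqrt h)) * norm (1 + w / of_real (2 * sqrt h)) *
       norm (\<Prod>j\<in>{h<..<2*h}. 1 - of_nat h * w\<^sup>2 / (of_nat j)\<^sup>2)"
      using p by (intro mult_left_mono) (auto simp: power_mult_distrib)
    also have "\<dots> = norm (far_factor h w)" by (simp only: far_factor_eq[OF h0] norm_mult)
    finally show "c * (1 + (Im w)\<^sup>2) ^ M \<le> norm (far_factor h w)" by (simp add: t_def)
  qed
qed

text \<open>
  Comparison with the telescoping sums of \<open>1 / (j - 1) - 1 / j\<close> and \<open>1 / j - 1 / (j + 1)\<close>.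
\<close>

lemma sum_inverse_squares_bounds:
  assumes "h > 0"
  shows "(\<Sum>j\<in>{h<..<h + Suc d}. 1 / (real j)\<^sup>2) \<le> 1 / h - 1 / (h + d) \<and>
         1 / (h + 1) - 1 / (h + Suc d) \<le> (\<Sum>j\<in>{h<..<h + Suc d}. 1 / (real j)\<^sup>2)"
proof (induction d)
  case 0
  have "{h<..<Suc h} = {}" by auto
  then show ?case by (auto simp: add.commute)
next
  case (Suc d)
  have e: "{h<..<h + Suc (Suc d)} = insert (h + Suc d) {h<..<h + Suc d}" by auto
  have a: "1 / (real (h + Suc d))\<^sup>2 \<le> 1 / real (h + d) - 1 / real (h + Suc d)"
    using assms by (simp add: divide_simps power2_eq_square)
  have b: "1 / real (h + Suc d) - 1 / real (h + Suc (Suc d)) \<le> 1 / (real (h + Suc d))\<^sup>2"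
    using assms by (simp add: divide_simps power2_eq_square)
  show ?case
    unfolding e using Suc a b by (auto simp: algebra_simps)
qed

corollary sum_inverse_squares_bounds':
  assumes "h > 1"
  shows "(\<Sum>j\<in>{h<..<2 * h}. 1 / (real j)\<^sup>2) \<le> 1 / real h - 1 / (2 * real h - 1) \<and>
         1 / (real h + 1) - 1 / (2 * real h) \<le> (\<Sum>j\<in>{h<..<2 * h}. 1 / (real j)\<^sup>2)"
proof -
  obtain d where d: "h = Suc d" using assms by (cases h) auto
  have e: "h + Suc d = 2 * h" "real h + real d = 2 * real h - 1" using d by auto
  show ?thesis
    using sum_inverse_squares_bounds[of h d, unfolded e] assms by (auto simp: e add.commute)
qed

text \<open>
  The sum of the logarithms of the paired factors is, up to an error of order \<open>1 / h\<close>, the sum of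
  \<open>- h * w\<^sup>2 / j\<^sup>2\<close>.
\<close>

lemma far_factor_tendsto: "(\<lambda>h. far_factor h w) \<longlonglongrightarrow> exp (- w\<^sup>2 / 2)"
proof -
  define z where "z h j = - (of_nat h * w\<^sup>2 / (of_nat j)\<^sup>2)" for h j :: nat
  have sq: "(\<lambda>h. real h * (\<Sum>j\<in>{h<..<2*h}. 1 / (real j)\<^sup>2)) \<longlonglongrightarrow> 1 / 2"
  proof (rule real_tendsto_sandwich)
    have "\<forall>\<^sub>F h in sequentially. h > 1" by (rule eventually_gt_at_top)
    then show "\<forall>\<^sub>F h in sequentially. real h * (1 / (h + 1) - 1 / (2 * h)) \<le> real h * (\<Sum>j\<in>{h<..<2*h}. 1 / (real j)\<^sup>2)"
    proof eventually_elim
      case (elim h)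
      then show ?case using sum_inverse_squares_bounds'[of h] by (intro mult_left_mono) (auto simp: add.commute)
    qed
    have "\<forall>\<^sub>F h in sequentially. h > 1" by (rule eventually_gt_at_top)
    then show "\<forall>\<^sub>F h in sequentially. real h * (\<Sum>j\<in>{h<..<2*h}. 1 / (real j)\<^sup>2) \<le> real h * (1 / h - 1 / (2 * real h - 1))"
    proof eventually_elim
      case (elim h)
      then show ?case using sum_inverse_squares_bounds'[of h] by (intro mult_left_mono) simp_all
    qed
  qed real_asymp+
  have sumz: "(\<lambda>h. \<Sum>j\<in>{h<..<2*h}. z h j) \<longlonglongrightarrow> - w\<^sup>2 / 2"
  proof -
    have "(\<lambda>h. - w\<^sup>2 * of_real (real h * (\<Sum>j\<in>{h<..<2*h}. 1 / (real j)\<^sup>2))) \<longlonglongrightarrow> - w\<^sup>2 * of_real (1 / 2)"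
      by (intro tendsto_intros sq)
    then show ?thesis by (simp add: z_def sum_distrib_left sum_negf mult_ac)
  qed
  have zb: "norm (z h j) \<le> (norm w)\<^sup>2 / h" if "j \<in> {h<..<2*h}" for h j
  proof -
    have "norm (z h j) = h * (norm w)\<^sup>2 / (real j)\<^sup>2" by (simp add: z_def norm_mult norm_divide norm_power)
    also have "\<dots> \<le> h * (norm w)\<^sup>2 / (real h)\<^sup>2"
      using that by (intro divide_left_mono power_mono) auto
    finally show ?thesis using that by (simp add: power2_eq_square)
  qed
  have ev: "\<forall>\<^sub>F h in sequentially. h > 0 \<and> (norm w)\<^sup>2 / real h < 1 / 2"
    by (intro eventually_conj eventually_gt_at_top) real_asymp
  have small: "norm (z h j) < 1 / 2" if "h > 0 \<and> (norm w)\<^sup>2 / real h < 1 / 2" "j \<in> {h<..<2*h}" for h j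
    using zb[OF that(2)] that by linarith
  have "(\<lambda>h. (\<Sum>j\<in>{h<..<2*h}. Ln (1 + z h j)) - (\<Sum>j\<in>{h<..<2*h}. z h j)) \<longlonglongrightarrow> 0"
  proof (rule Lim_null_comparison)
    show "\<forall>\<^sub>F h in sequentially. norm ((\<Sum>j\<in>{h<..<2*h}. Ln (1 + z h j)) - (\<Sum>j\<in>{h<..<2*h}. z h j)) \<le> 2 * (norm w) ^ 4 / h"
      using ev
    proof eventually_elim
      case (elim h)
      have "norm ((\<Sum>j\<in>{h<..<2*h}. Ln (1 + z h j)) - (\<Sum>j\<in>{h<..<2*h}. z h j)) \<le> (\<Sum>j\<in>{h<..<2*h}. 2 * ((norm w)\<^sup>2 / h)\<^sup>2)"
        unfolding sum_subtractf[symmetric]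
      proof (rule sum_norm_le)
        fix j assume j: "j \<in> {h<..<2*h}"
        have "norm (Ln (1 + z h j) - z h j) \<le> (norm (z h j))\<^sup>2 / (1 - norm (z h j))"
          using small[OF elim j] by (intro Ln_approx_linear) auto
        also have "\<dots> \<le> (norm (z h j))\<^sup>2 / (1 / 2)" using small[OF elim j] by (intro divide_left_mono) auto
        also have "\<dots> = 2 * (norm (z h j))\<^sup>2" by simp
        also have "\<dots> \<le> 2 * ((norm w)\<^sup>2 / h)\<^sup>2" using zb[OF j] by (intro mult_left_mono power_mono) auto
        finally show "norm (Ln (1 + z h j) - z h j) \<le> 2 * ((norm w)\<^sup>2 / h)\<^sup>2" .
      qed
      also have "\<dots> = real (h - 1) * (2 * (norm w) ^ 4 / h\<^sup>2)" by (simp add: power_divide)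
      also have "\<dots> \<le> real h * (2 * (norm w) ^ 4 / h\<^sup>2)" by (intro mult_right_mono) auto
      also have "\<dots> = 2 * (norm w) ^ 4 / h" using elim by (simp add: power2_eq_square)
      finally show ?case .
    qed
    show "(\<lambda>h. 2 * (norm w) ^ 4 / real h) \<longlonglongrightarrow> 0" by real_asymp
  qed
  from tendsto_add[OF this sumz] have "(\<lambda>h. \<Sum>j\<in>{h<..<2*h}. Ln (1 + z h j)) \<longlonglongrightarrow> - w\<^sup>2 / 2" by simp
  then have l: "(\<lambda>h. exp (\<Sum>j\<in>{h<..<2*h}. Ln (1 + z h j))) \<longlonglongrightarrow> exp (- w\<^sup>2 / 2)" by (rule tendsto_exp)
  have r: "(\<lambda>h. 1 / sqrt (real h)) \<longlonglongrightarrow> 0" "(\<lambda>h. 1 / (2 * sqrt (real h))) \<longlonglongrightarrow> 0" by real_asymp+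
  have "(\<lambda>h. (1 - w * of_real (1 / sqrt h)) * (1 + w * of_real (1 / (2 * sqrt h))) * exp (\<Sum>j\<in>{h<..<2*h}. Ln (1 + z h j)))
      \<longlonglongrightarrow> (1 - w * of_real 0) * (1 + w * of_real 0) * exp (- w\<^sup>2 / 2)"
    by (intro tendsto_intros l r)
  moreover have "\<forall>\<^sub>F h in sequentially. (1 - w * of_real (1 / sqrt h)) * (1 + w * of_real (1 / (2 * sqrt h))) * exp (\<Sum>j\<in>{h<..<2*h}. Ln (1 + z h j)) = far_factor h w"
    using ev
  proof eventually_elim
    case (elim h)
    have "exp (\<Sum>j\<in>{h<..<2*h}. Ln (1 + z h j)) = (\<Prod>j\<in>{h<..<2*h}. 1 + z h j)"
      unfolding exp_sum[OF finite_greaterThanLessThan]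
    proof (intro prod.cong refl exp_Ln)
      fix j assume "j \<in> {h<..<2*h}"
      from small[OF elim this] have "z h j \<noteq> - 1" by auto
      then show "1 + z h j \<noteq> 0" by (metis add_eq_0_iff)
    qed
    then show ?case using elim by (subst far_factor_eq) (auto simp: z_def)
  qed
  ultimately show ?thesis by (auto intro: Lim_transform_eventually)
qed

text \<open>
  Dominated convergence on a circle, which spares a proof that the convergence is uniform.
\<close>

lemma contour_integral_circlepath_dominated:
  fixes f :: "nat \<Rightarrow> complex \<Rightarrow> complex"
  assumes cont: "\<forall>\<^sub>F h in sequentially. continuous_on (sphere x r) (f h)"
    and bound: "\<forall>\<^sub>F h in sequentially. \<forall>w\<in>sphere x r. norm (f h w) \<le> K"
    and lim: "\<And>w. w \<in> sphere x r \<Longrightarrow> (\<lambda>h. f h w) \<longlonglongrightarrow> g w" and r: "r > 0"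
  shows "(\<lambda>h. contour_integral (circlepath x r) (f h)) \<longlonglongrightarrow> contour_integral (circlepath x r) g"
proof -
  from eventually_conj[OF cont bound] obtain h0 where
    h0: "\<And>h. h \<ge> h0 \<Longrightarrow> continuous_on (sphere x r) (f h) \<and> (\<forall>w\<in>sphere x r. norm (f h w) \<le> K)"
    unfolding eventually_sequentially by blast
  define d where "d t = vector_derivative (circlepath x r) (at t)" for t
  have d: "d t = 2 * pi * \<i> * r * exp (2 * pi * \<i> * t)" for t
    unfolding d_def vector_derivative_circlepath by simp
  have nd: "norm (d t) = 2 * pi * r" for t
    unfolding d using r by (simp add: norm_mult)
  have cp: "circlepath x r t \<in> sphere x r" if "t \<in> {0..1}" for t
    using path_image_circlepath[of x r] r that unfolding path_image_def by auto
  have "(\<lambda>h. integral {0..1} (\<lambda>t. f (h + h0) (circlepath x r t) * d t)) \<longlonglongrightarrow> integral {0..1} (\<lambda>t. g (circlepath x r t) * d t)"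
  proof (rule dominated_convergence(2)[where h="\<lambda>t. K * (2 * pi * r)"])
    show "(\<lambda>t. f (h + h0) (circlepath x r t) * d t) integrable_on {0..1}" for h
    proof (rule integrable_continuous_interval)
      have "continuous_on {0..1} (\<lambda>t. f (h + h0) (circlepath x r t))"
        by (rule continuous_on_compose2[of "sphere x r" "f (h + h0)"])
           (use h0[of "h + h0"] cp in \<open>auto simp: path_def[symmetric]\<close>)
      then show "continuous_on {0..1} (\<lambda>t. f (h + h0) (circlepath x r t) * d t)"
        unfolding d by (intro continuous_intros)
    qed
    show "norm (f (h + h0) (circlepath x r t) * d t) \<le> K * (2 * pi * r)" if "t \<in> {0..1}" for h t
      unfolding norm_mult nd using h0[of "h + h0"] cp[OF that] r by (intro mult_right_mono) auto
    show "(\<lambda>h. f (h + h0) (circlepath x r t) * d t) \<longlonglongrightarrow> g (circlepath x r t) * d t" if "t \<in> {0..1}" for t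
      using lim[OF cp[OF that]] by (intro tendsto_intros LIMSEQ_ignore_initial_segment[of "\<lambda>h. f h (circlepath x r t)"])
  qed auto
  then have "(\<lambda>h. contour_integral (circlepath x r) (f (h + h0))) \<longlonglongrightarrow> contour_integral (circlepath x r) g"
    by (simp add: contour_integral_integral d_def)
  then show ?thesis by (rule LIMSEQ_offset)
qed

section \<open>The lozenge kernel as a sum of residues\<close>

lemma inside_path_image_circlepath: "r > 0 \<Longrightarrow> inside (path_image (circlepath z r)) = ball z r"
  using inside_frontier_eq_interior[of "cball z r"] by simp

lemma outside_path_image_circlepath: "r > 0 \<Longrightarrow> outside (path_image (circlepath z r)) = - cball z r"
  using outside_frontier_eq_complement_closure[of "cball z r"] by simp

lemma positive_contour_circlepath: "r > 0 \<Longrightarrow> positive_contour (circlepath z r)"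
  unfolding positive_contour_def inside_path_image_circlepath
  by (auto simp: simple_path_circlepath dist_norm norm_minus_commute intro!: winding_number_circlepath)

lemma positive_contour_winding_number:
  assumes "positive_contour \<gamma>"
  shows "p \<in> inside (path_image \<gamma>) \<Longrightarrow> winding_number \<gamma> p = 1"
    and "p \<in> outside (path_image \<gamma>) \<Longrightarrow> winding_number \<gamma> p = 0"
  using assms unfolding positive_contour_def
  by (auto intro!: winding_number_zero_in_outside valid_path_imp_path)

text \<open>
  The index set \<open>I\<close> is arbitrary because removing the zero that belongs to one index must give a set
  of the same kind.
\<close>

definition boundary_zeros :: "nat set \<Rightarrow> (nat \<Rightarrow> real) \<Rightarrow> nat \<Rightarrow> complex set" where
  "boundary_zeros I x h = of_int ` ((\<lambda>r. micro_pos (2 * h) (x r)) ` I \<union> {- 2 * int h..<- int h} \<union> {int h..<2 * int h})"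

definition level_nodes :: "int \<Rightarrow> nat \<Rightarrow> complex set" where
  "level_nodes X n = (\<lambda>l. of_int X - of_nat l) ` {0..n}"

definition level_poly :: "int \<Rightarrow> nat \<Rightarrow> complex \<Rightarrow> complex" where
  "level_poly X k z = (\<Prod>l\<in>{1..k}. z - of_int X + of_nat l)"

lemma finite_boundary_zeros: "finite I \<Longrightarrow> finite (boundary_zeros I x h)"
  by (simp add: boundary_zeros_def)

lemma finite_level_nodes [simp]: "finite (level_nodes X n)"
  by (simp add: level_nodes_def)

lemma boundary_zeros_Ints: "boundary_zeros I x h \<subseteq> \<int>"
  by (auto simp: boundary_zeros_def)

lemma level_nodes_Ints: "level_nodes X n \<subseteq> \<int>"
  by (auto simp: level_nodes_def)

lemma inj_level_nodes: "inj_on (\<lambda>l. of_int X - of_nat l :: complex) A"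
  by (auto simp: inj_on_def)

lemma node_prod_level_nodes: "node_prod (level_nodes X n) w = (\<Prod>l\<in>{0..n}. w - of_int X + of_nat l)"
  unfolding node_prod_def level_nodes_def
  by (subst prod.reindex) (auto simp: inj_on_def algebra_simps)

lemma holomorphic_level_poly: "level_poly X k holomorphic_on A"
  unfolding level_poly_def by (intro holomorphic_intros)

text \<open>
  The condition, satisfied for large \<open>h\<close>, under which the boundary factor has simple zeros only.
\<close>

definition separated :: "nat set \<Rightarrow> (nat \<Rightarrow> real) \<Rightarrow> nat \<Rightarrow> bool" where
  "separated I x h \<longleftrightarrow> inj_on (\<lambda>r. micro_pos (2 * h) (x r)) I \<and>
     (\<forall>r\<in>I. - int h \<le> micro_pos (2 * h) (x r) \<and> micro_pos (2 * h) (x r) < int h)"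

lemma far_zeros_prod:
  fixes f :: "int \<Rightarrow> complex"
  shows "(\<Prod>a\<in>{- 2 * int h..<- int h}. f a) = (\<Prod>i\<in>{0..<h}. f (int i - 2 * int h))"
    and "(\<Prod>a\<in>{int h..<2 * int h}. f a) = (\<Prod>i\<in>{0..<h}. f (int i + int h))"
  by (rule prod.reindex_bij_witness[where i="\<lambda>i. int i - 2 * int h" and j="\<lambda>a. nat (a + 2 * int h)"]; force)
     (rule prod.reindex_bij_witness[where i="\<lambda>i. int i + int h" and j="\<lambda>a. nat (a - int h)"]; force)

lemma node_prod_boundary_zeros:
  assumes I: "finite I" and sep: "separated I x h"
  shows "node_prod (boundary_zeros I x h) u = (\<Prod>r\<in>I. u - of_int (micro_pos (2 * h) (x r))) *
     ((\<Prod>a\<in>{- 2 * int h..<- int h}. u - of_int a) * (\<Prod>a\<in>{int h..<2 * int h}. u - of_int a))"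
proof -
  let ?X = "\<lambda>r. micro_pos (2 * h) (x r)"
  have "node_prod (boundary_zeros I x h) u = (\<Prod>a\<in>?X ` I \<union> ({- 2 * int h..<- int h} \<union> {int h..<2 * int h}). u - of_int a)"
    unfolding node_prod_def boundary_zeros_def by (subst prod.reindex) (auto simp: inj_on_def Un_assoc)
  also have "\<dots> = (\<Prod>a\<in>?X ` I. u - of_int a) * (\<Prod>a\<in>{- 2 * int h..<- int h} \<union> {int h..<2 * int h}. u - of_int a)"
    using I sep by (intro prod.union_disjoint) (auto simp: separated_def)
  also have "(\<Prod>a\<in>?X ` I. u - of_int a) = (\<Prod>r\<in>I. u - of_int (?X r))"
    using I sep by (subst prod.reindex) (auto simp: separated_def)
  also have "(\<Prod>a\<in>{- 2 * int h..<- int h} \<union> {int h..<2 * int h}. u - of_int a) =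
      (\<Prod>a\<in>{- 2 * int h..<- int h}. u - of_int a) * (\<Prod>a\<in>{int h..<2 * int h}. (u - of_int a :: complex))"
    by (intro prod.union_disjoint) auto
  finally show ?thesis .
qed

lemma boundary_factor_eq_node_prod:
  assumes "separated {1..m} x h"
  shows "boundary_factor m x (2 * h) u = (- 1) ^ m * node_prod (boundary_zeros {1..m} x h) u"
proof -
  have neg: "(\<Prod>i\<in>A. - f i) = (- 1) ^ card A * (\<Prod>i\<in>A. f i)" for A :: "nat set" and f :: "nat \<Rightarrow> complex"
    by (rule prod_uminus)
  have p: "pochhammer (- of_nat (2 * h) - u) h = (\<Prod>i\<in>{0..<h}. - (u - of_int (int i - 2 * int h)))"
    "pochhammer (of_nat h - u) h = (\<Prod>i\<in>{0..<h}. - (u - of_int (int i + int h)))"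
    unfolding pochhammer_prod by (auto intro!: prod.cong)
  have q: "(\<Prod>r\<in>{1..m}. of_int (micro_pos (2 * h) (x r)) - u) = (\<Prod>r\<in>{1..m}. - (u - of_int (micro_pos (2 * h) (x r))))"
    by simp
  have "(- 1 :: complex) ^ h * (- 1) ^ h = 1" by (simp flip: power_mult_distrib)
  then have "boundary_factor m x (2 * h) u = (- 1) ^ m * ((\<Prod>r\<in>{1..m}. u - of_int (micro_pos (2 * h) (x r))) *
     ((\<Prod>i\<in>{0..<h}. u - of_int (int i - 2 * int h)) * (\<Prod>i\<in>{0..<h}. u - of_int (int i + int h))))"
    unfolding boundary_factor_def nonzero_mult_div_cancel_left[OF zero_neq_numeral[symmetric]] p q neg
    by (simp add: mult_ac)
  then show ?thesis unfolding node_prod_boundary_zeros[OF finite_atLeastAtMost assms] far_zeros_prod .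
qed

text \<open>
  All the zeros and nodes are integers, and admissible contours avoid the integers; so the
  winding numbers are those prescribed in the definition of the contours.
\<close>

lemma lozenge_double_integral:
  fixes N n1 n2 m h x X1 X2
  defines "N \<equiv> 2 * h"
  assumes sep: "separated {1..m} x h" and c: "lozenge_contours m x N X2 \<gamma> \<gamma>'"
    and X1: "- int N \<le> X1 - int (N - n1)" "X1 \<le> int N"
  shows "contour_integral \<gamma> (\<lambda>z. contour_integral \<gamma>' (\<lambda>w. lozenge_integrand m x N n1 X1 n2 X2 z w))
     = (2 * of_real pi * \<i>)\<^sup>2 * (\<Sum>a\<in>{a\<in>boundary_zeros {1..m} x h. of_int X2 \<le> Re a}.
         pole_weight (boundary_zeros {1..m} x h) (level_nodes X1 (N - n1)) (level_poly X2 (N - n2 - 1)) a)"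
proof -
  let ?S = "boundary_zeros {1..m} x h" and ?T = "level_nodes X1 (N - n1)" and ?P = "level_poly X2 (N - n2 - 1)"
  note c = c[unfolded lozenge_contours_def]
  have pos: "positive_contour \<gamma>" "positive_contour \<gamma>'" using c by auto
  note pc = pos[unfolded positive_contour_def]
  have zero: "boundary_factor m x N p = 0 \<longleftrightarrow> p \<in> ?S" for p
    unfolding N_def boundary_factor_eq_node_prod[OF sep] by (simp add: node_prod_eq_0 finite_boundary_zeros)
  have w: "winding_number \<gamma> a = (if of_int X2 \<le> Re a then 1 else 0)" if "a \<in> ?S" for a
    using c zero[of a] that positive_contour_winding_number[OF pos(1), of a] by (auto split: if_splits)
  have TN: "?T \<subseteq> complex_of_real ` {- real N..real N}"
  proof
    fix t assume "t \<in> ?T"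
    then obtain l where l: "l \<le> N - n1" "t = of_int X1 - of_nat l" by (auto simp: level_nodes_def)
    have "t = complex_of_real (of_int (X1 - int l))" using l by simp
    moreover have "- int N \<le> X1 - int l" "X1 - int l \<le> int N" using X1 l by auto
    then have "of_int (X1 - int l) \<in> {- real N..real N}" by (auto simp flip: of_int_le_iff[where 'a=real])
    ultimately show "t \<in> complex_of_real ` {- real N..real N}" by blast
  qed
  have ins: "path_image \<gamma> \<union> ?T \<subseteq> inside (path_image \<gamma>')" using c TN by blast
  have "lozenge_integrand m x N n1 X1 n2 X2 z w =
     ?P z / node_prod ?T w * (1 / (w - z)) * (node_prod ?S w / node_prod ?S z)" for z w
    unfolding lozenge_integrand_def N_def boundary_factor_eq_node_prod[OF sep]
    by (simp add: node_prod_level_nodes level_poly_def)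
  then have "contour_integral \<gamma> (\<lambda>z. contour_integral \<gamma>' (\<lambda>w. lozenge_integrand m x N n1 X1 n2 X2 z w)) =
     contour_integral \<gamma> (\<lambda>z. contour_integral \<gamma>' (\<lambda>w.
        ?P z / node_prod ?T w * (1 / (w - z)) * (node_prod ?S w / node_prod ?S z)))"
    by (simp only:)
  also have "\<dots> = (2 * of_real pi * \<i>)\<^sup>2 * (\<Sum>a\<in>?S. winding_number \<gamma> a * pole_weight ?S ?T ?P a)"
  proof (rule contour_integral_double_kernel[OF finite_boundary_zeros[OF finite_atLeastAtMost] finite_level_nodes holomorphic_level_poly])
    show "path_image \<gamma> \<inter> (?S \<union> ?T) = {}"
      using c boundary_zeros_Ints[of "{1..m}" x h] level_nodes_Ints[of X1 "N - n1"] by blast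
    show "path_image \<gamma>' \<inter> (path_image \<gamma> \<union> ?T) = {}"
      using ins inside_no_overlap[of "path_image \<gamma>'"] by blast
    show "winding_number \<gamma>' p = 1" if "p \<in> path_image \<gamma> \<union> ?T" for p
      using ins that by (intro positive_contour_winding_number(1)[OF pos(2)]) blast
  qed (use pc in auto)
  also have "(\<Sum>a\<in>?S. winding_number \<gamma> a * pole_weight ?S ?T ?P a) = (\<Sum>a\<in>{a\<in>?S. of_int X2 \<le> Re a}. pole_weight ?S ?T ?P a)"
    by (subst sum.inter_filter) (auto intro!: sum.cong simp: w finite_boundary_zeros)
  finally show ?thesis .
qed

lemma circlepath_avoids_Ints:
  fixes c r :: real
  assumes r: "r > 0" and ends: "c - r + 1 / 2 \<in> \<int>" "c + r - 1 / 2 \<in> \<int>"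
  shows "path_image (circlepath (of_real c) r) \<inter> \<int> = {}"
proof -
  have False if a: "(of_int a :: complex) \<in> path_image (circlepath (of_real c) r)" for a
  proof -
    have "of_int a - of_real c = complex_of_real (of_int a - c)" by simp
    then have "norm (of_int a - of_real c :: complex) = \<bar>of_int a - c\<bar>" by (metis norm_of_real)
    with a r have "\<bar>of_int a - c\<bar> = r" by (simp add: dist_norm norm_minus_commute)
    then consider "of_int a = c - r" | "of_int a = c + r" by linarith
    then have "(1 / 2 :: real) \<in> \<int>"
    proof cases
      case 1
      then have "1 / 2 = (c - r + 1 / 2) - of_int a" by simp
      then show ?thesis using ends by (metis Ints_diff Ints_of_int)
    next
      case 2
      then have "1 / 2 = of_int a - (c + r - 1 / 2)" by simp
      then show ?thesis using ends by (metis Ints_diff Ints_of_int)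
    qed
    then show False by (auto elim!: Ints_cases)
  qed
  then show ?thesis by (auto elim!: Ints_cases)
qed

text \<open>
  Two circles suffice. The real points of the inner one are the half-integers \<open>X2 - 1/2\<close> and \<open>N + 1/2\<close>.
\<close>

lemma lozenge_contours_exist:
  fixes h :: nat
  defines "N \<equiv> 2 * h"
  assumes sep: "separated {1..m} x h" and X2: "X2 \<le> int N"
  shows "\<exists>\<gamma> \<gamma>'. lozenge_contours m x N X2 \<gamma> \<gamma>'"
proof -
  define c r where "c = (of_int X2 + real N) / 2" and "r = (real N - of_int X2 + 1) / 2"
  \<comment> \<open>A half-integer, so that the outer circle does not meet the integers.\<close>
  define R where "R = of_int (\<lceil>\<bar>c\<bar> + r\<rceil> + int N) + (1 / 2 :: real)"
  have r: "r > 0" using X2 by (simp add: r_def)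
  have R: "R > \<bar>c\<bar> + r" "R > real N" using r unfolding R_def by linarith+
  let ?g = "circlepath (complex_of_real c) r" and ?g' = "circlepath (complex_of_real 0) R"
  have R0: "R > 0" using R by linarith
  have zero: "boundary_factor m x N p = 0 \<longleftrightarrow> p \<in> boundary_zeros {1..m} x h" for p
    unfolding N_def boundary_factor_eq_node_prod[OF sep] by (simp add: node_prod_eq_0 finite_boundary_zeros)
  have "lozenge_contours m x N X2 ?g ?g'"
    unfolding lozenge_contours_def
  proof (intro conjI allI impI)
    show "positive_contour ?g" "positive_contour ?g'" using r R0 by (auto intro: positive_contour_circlepath)
    show "path_image ?g \<inter> \<int> = {}"
    proof (rule circlepath_avoids_Ints[OF r])
      have "c - r + 1 / 2 = of_int X2" "c + r - 1 / 2 = of_int (int N)" by (simp_all add: c_def r_def field_simps)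
      then show "c - r + 1 / 2 \<in> \<int>" "c + r - 1 / 2 \<in> \<int>" by (metis Ints_of_int)+
    qed
    show "path_image ?g' \<inter> \<int> = {}"
    proof (rule circlepath_avoids_Ints[OF R0])
      have "0 - R + 1 / 2 = of_int (- (\<lceil>\<bar>c\<bar> + r\<rceil> + int N))" "0 + R - 1 / 2 = of_int (\<lceil>\<bar>c\<bar> + r\<rceil> + int N)"
        by (simp_all add: R_def)
      then show "0 - R + 1 / 2 \<in> \<int>" "0 + R - 1 / 2 \<in> \<int>" by (metis Ints_of_int)+
    qed
    show "path_image ?g \<subseteq> inside (path_image ?g')"
    proof
      fix z assume "z \<in> path_image ?g"
      then have "norm (z - of_real c) = r" using r by (simp add: dist_norm norm_minus_commute)
      then have "norm z < R" using R norm_triangle_ineq[of "z - of_real c" "of_real c"] by simp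
      then show "z \<in> inside (path_image ?g')" unfolding inside_path_image_circlepath[OF R0] by simp
    qed
    show "complex_of_real ` {- real N..real N} \<subseteq> inside (path_image ?g')"
      unfolding inside_path_image_circlepath[OF R0] using R by auto
    fix p assume "boundary_factor m x N p = 0"
    then have "p \<in> boundary_zeros {1..m} x h" by (simp add: zero)
    then obtain a where a: "p = of_int a" "a < int N"
      using sep unfolding boundary_zeros_def separated_def N_def by auto
    have "of_real c - of_int a = complex_of_real (c - of_int a)" by simp
    then have d: "dist (of_real c) p = \<bar>c - of_int a\<bar>" unfolding dist_norm a by (metis norm_of_real)
    have aN: "of_int a < real N" using a by (metis of_int_less_iff of_int_of_nat_eq)
    show "if of_int X2 \<le> Re p then p \<in> inside (path_image ?g) else p \<in> outside (path_image ?g)"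
      unfolding inside_path_image_circlepath[OF r] outside_path_image_circlepath[OF r]
    proof (split if_split, intro conjI impI)
      assume "of_int X2 \<le> Re p"
      then have "of_int X2 \<le> (of_int a :: real)" by (simp add: a)
      with aN show "p \<in> ball (of_real c) r" unfolding mem_ball d by (simp add: c_def r_def abs_less_iff field_simps)
    next
      assume "\<not> of_int X2 \<le> Re p"
      then have "a + 1 \<le> X2" by (simp add: a)
      then have "of_int a + 1 \<le> (of_int X2 :: real)" by (metis of_int_1 of_int_add of_int_le_iff)
      with aN show "p \<in> - cball (of_real c) r" unfolding Compl_iff mem_cball d by (auto simp: c_def r_def abs_le_iff field_simps)
    qed
  qed
  then show ?thesis by blast
qed

lemma K_lozenge_eq_pole_sum:
  fixes N n1 n2 m h x X1 X2
  defines "N \<equiv> 2 * h"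
  assumes sep: "separated {1..m} x h" and X2: "X2 \<le> int N"
    and X1: "- int N \<le> X1 - int (N - n1)" "X1 \<le> int N"
  shows "K_lozenge m x N n1 X1 n2 X2 =
     - (if n2 < n1 \<and> X2 \<le> X1
        then (\<Prod>l\<in>{1..n1 - n2 - 1}. of_int (X1 - X2 + int l)) / fact (n1 - n2 - 1)
        else 0) +
     fact (N - n1) / fact (N - n2 - 1) * (\<Sum>a\<in>{a\<in>boundary_zeros {1..m} x h. of_int X2 \<le> Re a}.
         pole_weight (boundary_zeros {1..m} x h) (level_nodes X1 (N - n1)) (level_poly X2 (N - n2 - 1)) a)"
proof -
  have v': "A / B * (1 / d) * (d * s) = A / B * s" if "d \<noteq> 0" for A B d s :: complex
    using that by simp
  have v: "fact (N - n1) / fact (N - n2 - 1) * (1 / (2 * of_real pi * \<i>)\<^sup>2) * ((2 * of_real pi * \<i>)\<^sup>2 * s)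
     = fact (N - n1) / fact (N - n2 - 1) * s" for s :: complex
    by (rule v') simp
  obtain \<gamma> \<gamma>' where g: "lozenge_contours m x N X2 \<gamma> \<gamma>'"
    using lozenge_contours_exist[OF sep X2[unfolded N_def]] unfolding N_def by blast
  note val = lozenge_double_integral[OF sep _ X1[unfolded N_def], folded N_def]
  show ?thesis
    unfolding K_lozenge_def
  proof (intro arg_cong2[where f="(+)"] refl the_equality)
    show "\<exists>\<gamma>z \<gamma>w. lozenge_contours m x N X2 \<gamma>z \<gamma>w \<and>
       fact (N - n1) / fact (N - n2 - 1) * (\<Sum>a\<in>{a\<in>boundary_zeros {1..m} x h. of_int X2 \<le> Re a}.
         pole_weight (boundary_zeros {1..m} x h) (level_nodes X1 (N - n1)) (level_poly X2 (N - n2 - 1)) a) =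
       fact (N - n1) / fact (N - n2 - 1) * (1 / (2 * of_real pi * \<i>)\<^sup>2) *
            contour_integral \<gamma>z
              (\<lambda>z. contour_integral \<gamma>w (\<lambda>w. lozenge_integrand m x N n1 X1 n2 X2 z w))"
      using g val[OF g] v by (intro exI[of _ \<gamma>] exI[of _ \<gamma>']) (simp only: simp_thms)
  next
    fix y assume "\<exists>\<gamma>z \<gamma>w. lozenge_contours m x N X2 \<gamma>z \<gamma>w \<and>
       y = fact (N - n1) / fact (N - n2 - 1) * (1 / (2 * of_real pi * \<i>)\<^sup>2) *
            contour_integral \<gamma>z
              (\<lambda>z. contour_integral \<gamma>w (\<lambda>w. lozenge_integrand m x N n1 X1 n2 X2 z w))"
    then show "y = fact (N - n1) / fact (N - n2 - 1) * (\<Sum>a\<in>{a\<in>boundary_zeros {1..m} x h. of_int X2 \<le> Re a}.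
         pole_weight (boundary_zeros {1..m} x h) (level_nodes X1 (N - n1)) (level_poly X2 (N - n2 - 1)) a)"
      using val v by (elim exE conjE) (simp only:)
  qed
qed

section \<open>The indicator term as a divided difference\<close>

lemma pochhammer_diff_shift:
  "pochhammer y (Suc j) - pochhammer (y - 1) (Suc j) = of_nat (Suc j) * pochhammer (y :: complex) j"
proof -
  have "pochhammer y (Suc j) = pochhammer y j * (y + of_nat j)" by (rule pochhammer_Suc)
  moreover have "pochhammer (y - 1) (Suc j) = (y - 1) * pochhammer y j" by (simp add: pochhammer_rec)
  ultimately show ?thesis by (simp add: algebra_simps)
qed

lemma alternating_binomial_sum_Suc:
  fixes f :: "nat \<Rightarrow> complex"
  shows "(\<Sum>l\<le>Suc n. (- 1) ^ l * of_nat (Suc n choose l) * f l) =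
         (\<Sum>l\<le>n. (- 1) ^ l * of_nat (n choose l) * f l) - (\<Sum>l\<le>n. (- 1) ^ l * of_nat (n choose l) * f (Suc l))"
proof -
  have "(\<Sum>l\<le>Suc n. (- 1) ^ l * of_nat (Suc n choose l) * f l) =
      f 0 + (\<Sum>l\<le>n. (- 1) ^ Suc l * of_nat (Suc n choose Suc l) * f (Suc l))"
    by (subst sum.atMost_Suc_shift) simp
  also have "(\<Sum>l\<le>n. (- 1) ^ Suc l * of_nat (Suc n choose Suc l) * f (Suc l)) =
     (\<Sum>l\<le>n. (- 1) ^ Suc l * of_nat (n choose Suc l) * f (Suc l)) - (\<Sum>l\<le>n. (- 1) ^ l * of_nat (n choose l) * f (Suc l))"
    unfolding sum_subtractf[symmetric] by (intro sum.cong refl) (simp add: algebra_simps)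
  also have "f 0 + ((\<Sum>l\<le>n. (- 1) ^ Suc l * of_nat (n choose Suc l) * f (Suc l)) - (\<Sum>l\<le>n. (- 1) ^ l * of_nat (n choose l) * f (Suc l)))
     = (\<Sum>l\<le>Suc n. (- 1) ^ l * of_nat (n choose l) * f l) - (\<Sum>l\<le>n. (- 1) ^ l * of_nat (n choose l) * f (Suc l))"
    by (subst sum.atMost_Suc_shift) simp
  also have "(\<Sum>l\<le>Suc n. (- 1) ^ l * of_nat (n choose l) * f l) = (\<Sum>l\<le>n. (- 1) ^ l * of_nat (n choose l) * f l)"
    by simp
  finally show ?thesis .
qed

text \<open>
  Each application of the backward difference operator lowers the length of the rising factorial
  by one and multiplies by that length.
\<close>

lemma backward_difference_pochhammer:
  fixes y :: complex
  shows "(\<Sum>l\<le>n. (- 1) ^ l * of_nat (n choose l) * pochhammer (y - of_nat l) k) =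
     (if n \<le> k then fact k / fact (k - n) * pochhammer y (k - n) else 0)"
proof (induction n arbitrary: y)
  case 0
  then show ?case by simp
next
  case (Suc n)
  have sh: "y - of_nat (Suc l) = (y - 1) - of_nat l" for l by simp
  have rec: "(\<Sum>l\<le>Suc n. (- 1) ^ l * of_nat (Suc n choose l) * pochhammer (y - of_nat l) k) =
     (if n \<le> k then fact k / fact (k - n) * pochhammer y (k - n) else 0) -
     (if n \<le> k then fact k / fact (k - n) * pochhammer (y - 1) (k - n) else 0)"
    unfolding alternating_binomial_sum_Suc sh Suc.IH ..
  show ?case
  proof (cases "Suc n \<le> k")
    case True
    define j where "j = k - Suc n"
    have j: "k - n = Suc j" using True by (simp add: j_def)
    have "fact k / fact (Suc j) * pochhammer y (Suc j) - fact k / fact (Suc j) * pochhammer (y - 1) (Suc j)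
       = fact k / fact (Suc j) * (of_nat (Suc j) * pochhammer y j)"
      unfolding pochhammer_diff_shift[symmetric] by (simp only: right_diff_distrib)
    also have "\<dots> = fact k / fact j * pochhammer y j"
      using of_nat_neq_0[of j, where 'a=complex] by (simp add: divide_simps del: of_nat_Suc)
    finally show ?thesis unfolding rec using True by (simp add: j j_def)
  next
    case False
    then consider "n = k" | "n > k" by linarith
    then show ?thesis unfolding rec using False by cases auto
  qed
qed

lemma lagrange_denom_level_nodes:
  assumes l: "l \<le> n"
  shows "lagrange_denom (level_nodes X n) (of_int X - of_nat l) = (- 1) ^ l * fact l * fact (n - l)"
proof -
  have "level_nodes X n - {of_int X - of_nat l} = (\<lambda>l. of_int X - of_nat l) ` ({0..n} - {l})"
    unfolding level_nodes_def by auto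
  then have "lagrange_denom (level_nodes X n) (of_int X - of_nat l) = (\<Prod>i\<in>{0..n} - {l}. of_nat i - of_nat l)"
    unfolding lagrange_denom_def by (simp add: prod.reindex[OF inj_level_nodes])
  also have "{0..n} - {l} = {0..<l} \<union> {l<..n}" using l by auto
  also have "(\<Prod>i\<in>{0..<l} \<union> {l<..n}. of_nat i - of_nat l :: complex) =
     (\<Prod>i\<in>{0..<l}. of_nat i - of_nat l) * (\<Prod>i\<in>{l<..n}. of_nat i - of_nat l)"
    by (intro prod.union_disjoint) auto
  also have "(\<Prod>i\<in>{0..<l}. of_nat i - of_nat l :: complex) = (\<Prod>i\<in>{1..l}. - of_nat i)"
    by (rule prod.reindex_bij_witness[where i="\<lambda>i. l - i" and j="\<lambda>i. l - i"]) (auto simp: of_nat_diff)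
  also have "\<dots> = (- 1) ^ l * fact l" by (simp add: prod_uminus fact_prod)
  also have "(\<Prod>i\<in>{l<..n}. of_nat i - of_nat l :: complex) = (\<Prod>i\<in>{1..n - l}. of_nat i)"
    using l by (intro prod.reindex_bij_witness[where i="\<lambda>i. i + l" and j="\<lambda>i. i - l"]) (auto simp: of_nat_diff)
  also have "\<dots> = fact (n - l)" by (simp add: fact_prod)
  finally show ?thesis .
qed

lemma level_poly_eq_pochhammer: "level_poly X k z = pochhammer (z - of_int X + 1) k"
  unfolding level_poly_def pochhammer_prod
  by (rule prod.reindex_bij_witness[where i="\<lambda>i. i + 1" and j="\<lambda>i. i - 1"]) (auto simp: of_nat_diff)

text \<open>
  The sum is the divided difference of a rising factorial at consecutive integers. The right-hand side
  is the indicator term of the lozenge kernel, with \<open>k - n = n2 - n1 - 1\<close>.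
\<close>

lemma level_poly_divided_difference:
  "fact n / fact k * (\<Sum>t\<in>level_nodes X n. level_poly Y k t / lagrange_denom (level_nodes X n) t) =
     (if n \<le> k then (\<Prod>l\<in>{1..k - n}. of_int (X - Y + int l)) / fact (k - n) else 0 :: complex)"
proof -
  have "(\<Sum>t\<in>level_nodes X n. level_poly Y k t / lagrange_denom (level_nodes X n) t) =
    (\<Sum>l\<le>n. level_poly Y k (of_int X - of_nat l) / lagrange_denom (level_nodes X n) (of_int X - of_nat l))"
    by (subst (1) level_nodes_def) (simp add: sum.reindex[OF inj_level_nodes] atMost_atLeast0)
  also have "\<dots> = (\<Sum>l\<le>n. (- 1) ^ l * of_nat (n choose l) * pochhammer (of_int X - of_int Y + 1 - of_nat l) k) / fact n"
    unfolding sum_divide_distrib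
  proof (intro sum.cong refl)
    fix l assume "l \<in> {..n}"
    then have l: "l \<le> n" by simp
    have sgn: "(- 1 :: complex) ^ l * (- 1) ^ l = 1" by (simp flip: power_mult_distrib)
    have arg: "of_int X - of_nat l - of_int Y + 1 = (of_int X - of_int Y + 1 - of_nat l :: complex)" by simp
    have "P / ((- 1) ^ l * fact l * fact (n - l)) = (- 1) ^ l * (fact n / (fact l * fact (n - l))) * P / fact n" for P :: complex
      using sgn by (simp add: divide_simps)
    then show "level_poly Y k (of_int X - of_nat l) / lagrange_denom (level_nodes X n) (of_int X - of_nat l) =
       (- 1) ^ l * of_nat (n choose l) * pochhammer (of_int X - of_int Y + 1 - of_nat l) k / fact n"
      unfolding lagrange_denom_level_nodes[OF l] binomial_fact[OF l] level_poly_eq_pochhammer arg .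
  qed
  finally have "fact n / fact k * (\<Sum>t\<in>level_nodes X n. level_poly Y k t / lagrange_denom (level_nodes X n) t) =
     (if n \<le> k then pochhammer (of_int X - of_int Y + 1) (k - n) / fact (k - n) else 0)"
    by (simp add: backward_difference_pochhammer)
  also have "pochhammer (of_int X - of_int Y + 1) (k - n) = (\<Prod>l\<in>{1..k - n}. of_int (X - Y + int l) :: complex)"
    using level_poly_eq_pochhammer[of Y "k - n" "of_int X"] by (simp add: level_poly_def)
  finally show ?thesis .
qed

section \<open>Rescaling\<close>

text \<open>
  Scaling each of the \<open>card A - 1\<close> differences in \<open>lagrange_denom A a\<close> produces the power of \<open>s\<close>.
\<close>

lemma has_contour_integral_scaled_circle:
  fixes s \<rho> :: real
  assumes A: "finite A" "A \<noteq> {}" and F: "F holomorphic_on UNIV" and s: "s > 0" and \<rho>: "\<rho> > 0"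
    and off: "\<And>a. a \<in> A \<Longrightarrow> norm (a / of_real s - x) \<noteq> \<rho>"
  shows "((\<lambda>w. F (of_real s * w) / (\<Prod>a\<in>A. w - a / of_real s)) has_contour_integral
     2 * of_real pi * \<i> * (of_real s ^ (card A - 1) *
        (\<Sum>a\<in>{a\<in>A. norm (a / of_real s - x) < \<rho>}. F a / lagrange_denom A a))) (circlepath x \<rho>)"
proof -
  let ?d = "\<lambda>a. a / complex_of_real s"
  let ?W = "winding_number (circlepath x \<rho>)"
  have inj: "inj_on ?d B" for B using s by (auto simp: inj_on_def)
  have W: "?W (?d a) = (if norm (?d a - x) < \<rho> then 1 else 0)" if "a \<in> A" for a
  proof (cases "norm (?d a - x) < \<rho>")
    case True
    then show ?thesis by (simp add: winding_number_circlepath)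
  next
    case False
    then have "?d a \<notin> cball x \<rho>" using off[OF that] by (simp add: dist_norm norm_minus_commute)
    then have "?W (?d a) = 0"
      using \<rho> by (intro winding_number_zero_outside[of _ "cball x \<rho>"]) (auto simp: dist_norm)
    then show ?thesis using False by simp
  qed
  have "((\<lambda>w. F (of_real s * w) / (\<Prod>a\<in>?d ` A. w - a)) has_contour_integral
     2 * of_real pi * \<i> * (\<Sum>a\<in>?d ` A. ?W a * (F (of_real s * a) / (\<Prod>b\<in>?d ` A - {a}. a - b)))) (circlepath x \<rho>)"
    using A off \<rho>
    by (intro has_contour_integral_simple_poles holomorphic_on_compose_gen[OF _ F, unfolded o_def] holomorphic_intros)
       (auto simp: dist_norm norm_minus_commute)
  also have "(\<Sum>a\<in>?d ` A. ?W a * (F (of_real s * a) / (\<Prod>b\<in>?d ` A - {a}. a - b))) =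
     (\<Sum>a\<in>A. (if norm (?d a - x) < \<rho> then of_real s ^ (card A - 1) * (F a / lagrange_denom A a) else 0))"
  proof (subst sum.reindex[OF inj], intro sum.cong refl, unfold o_def)
    fix a assume a: "a \<in> A"
    have "?d ` A - {?d a} = ?d ` (A - {a})" using s a by auto
    then have "(\<Prod>b\<in>?d ` A - {?d a}. ?d a - b) = (\<Prod>b\<in>A - {a}. (a - b) / of_real s)"
      by (simp add: prod.reindex[OF inj] diff_divide_distrib)
    also have "\<dots> = lagrange_denom A a / of_real s ^ (card A - 1)"
      using a A by (simp add: prod_dividef lagrange_denom_def)
    finally show "?W (?d a) * (F (of_real s * ?d a) / (\<Prod>b\<in>?d ` A - {?d a}. ?d a - b)) =
       (if norm (?d a - x) < \<rho> then of_real s ^ (card A - 1) * (F a / lagrange_denom A a) else 0)"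
      using s by (simp add: W[OF a])
  qed
  also have "\<dots> = of_real s ^ (card A - 1) * (\<Sum>a\<in>{a\<in>A. norm (?d a - x) < \<rho>}. F a / lagrange_denom A a)"
    using A by (simp add: sum.inter_filter[symmetric] sum_distrib_left)
  also have "(\<lambda>w. F (of_real s * w) / (\<Prod>a\<in>?d ` A. w - a)) = (\<lambda>w. F (of_real s * w) / (\<Prod>a\<in>A. w - ?d a))"
    by (simp add: prod.reindex[OF inj])
  finally show ?thesis .
qed

text \<open>
  Macroscopic coordinate of the lattice point that approximates \<open>a\<close>, where \<open>h\<close> is half of the size of
  the polygon.
\<close>

definition scaled_pos :: "nat \<Rightarrow> real \<Rightarrow> real" where
  "scaled_pos h a = of_int (micro_pos (2 * h) a) / sqrt (real h)"

lemma micro_pos_double: "micro_pos (2 * h) a = \<lfloor>sqrt (real h) * a\<rfloor>"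
  by (simp add: micro_pos_def)

lemma scaled_pos_bounds:
  assumes "h > 0"
  shows "scaled_pos h a \<le> a" and "a - 1 / sqrt (real h) < scaled_pos h a"
proof -
  have s: "sqrt (real h) > 0" using assms by simp
  have a: "a = sqrt (real h) * a / sqrt (real h)" using s by simp
  have "of_int \<lfloor>sqrt (real h) * a\<rfloor> / sqrt (real h) \<le> sqrt (real h) * a / sqrt (real h)"
    using s by (intro divide_right_mono) auto
  then show "scaled_pos h a \<le> a" unfolding scaled_pos_def micro_pos_double using a by simp
  have "(sqrt (real h) * a - 1) / sqrt (real h) < of_int \<lfloor>sqrt (real h) * a\<rfloor> / sqrt (real h)"
    using s by (intro divide_strict_right_mono) linarith+
  then show "a - 1 / sqrt (real h) < scaled_pos h a"
    unfolding scaled_pos_def micro_pos_double diff_divide_distrib using a by simp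
qed

lemma scaled_pos_tendsto: "(\<lambda>h. scaled_pos h a) \<longlonglongrightarrow> a"
proof (rule real_tendsto_sandwich)
  show "\<forall>\<^sub>F h in sequentially. a - 1 / sqrt (real h) \<le> scaled_pos h a"
    using eventually_gt_at_top[of 0] by eventually_elim (use scaled_pos_bounds in \<open>auto intro: less_imp_le\<close>)
  show "\<forall>\<^sub>F h in sequentially. scaled_pos h a \<le> a"
    using eventually_gt_at_top[of 0] by eventually_elim (use scaled_pos_bounds in auto)
  show "(\<lambda>h. a - 1 / sqrt (real h)) \<longlonglongrightarrow> a" by real_asymp
qed simp

lemma scaled_pos_mult: "h > 0 \<Longrightarrow> complex_of_real (sqrt (real h)) * of_real (scaled_pos h a) = of_int (micro_pos (2 * h) a)"
  by (simp add: scaled_pos_def)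

text \<open>
  The value at 0 of the product over the far zeros; it cancels in all the ratios that occur.
\<close>

definition far_const :: "nat \<Rightarrow> complex" where
  "far_const h = (\<Prod>j\<in>{h..<2*h}. - of_nat j) * (\<Prod>j\<in>{h<..2*h}. of_nat j)"

lemma far_const_nonzero: "h > 0 \<Longrightarrow> far_const h \<noteq> 0"
  by (auto simp: far_const_def)

definition scaled_factor :: "nat set \<Rightarrow> (nat \<Rightarrow> real) \<Rightarrow> nat \<Rightarrow> complex \<Rightarrow> complex" where
  "scaled_factor I x h w = (\<Prod>r\<in>I. w - of_real (scaled_pos h (x r))) * far_factor h w"

lemma node_prod_boundary_zeros_scaled:
  assumes I: "finite I" and sep: "separated I x h" and h: "h > 0"
  shows "node_prod (boundary_zeros I x h) (of_real (sqrt (real h)) * w) =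
           far_const h * of_real (sqrt (real h)) ^ card I * scaled_factor I x h w"
proof -
  let ?s = "complex_of_real (sqrt (real h))"
  have a: "(\<Prod>r\<in>I. ?s * w - of_int (micro_pos (2 * h) (x r))) = ?s ^ card I * (\<Prod>r\<in>I. w - of_real (scaled_pos h (x r)))"
    unfolding scaled_pos_mult[OF h, symmetric] right_diff_distrib[symmetric] prod.distrib by simp
  have b: "(\<Prod>a\<in>{int h..<2 * int h}. ?s * w - of_int a) = (\<Prod>j\<in>{h..<2*h}. - of_nat j) * (\<Prod>j\<in>{h..<2*h}. 1 - ?s * w / of_nat j)"
    unfolding prod.distrib[symmetric]
    by (rule prod.reindex_bij_witness[where i=int and j=nat]) (use h in \<open>auto simp: field_simps\<close>)
  have c: "(\<Prod>a\<in>{- 2 * int h..<- int h}. ?s * w - of_int a) = (\<Prod>j\<in>{h<..2*h}. of_nat j) * (\<Prod>j\<in>{h<..2*h}. 1 + ?s * w / of_nat j)"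
    unfolding prod.distrib[symmetric]
    by (rule prod.reindex_bij_witness[where i="\<lambda>j. - int j" and j="\<lambda>a. nat (- a)"]) (use h in \<open>auto simp: field_simps\<close>)
  show ?thesis
    unfolding node_prod_boundary_zeros[OF I sep] a b c scaled_factor_def far_factor_def far_const_def
    by (simp only: mult_ac)
qed

definition scaled_poly :: "real \<Rightarrow> nat \<Rightarrow> nat \<Rightarrow> complex \<Rightarrow> complex" where
  "scaled_poly a k h z = (\<Prod>l\<in>{1..k}. z - of_real (scaled_pos h a - real l / sqrt (real h)))"

lemma level_poly_scaled:
  assumes h: "h > 0"
  shows "level_poly (micro_pos (2 * h) a) k (of_real (sqrt (real h)) * z) = of_real (sqrt (real h)) ^ k * scaled_poly a k h z"
proof -
  let ?s = "complex_of_real (sqrt (real h))"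
  have "level_poly (micro_pos (2 * h) a) k (?s * z) = (\<Prod>l\<in>{1..k}. ?s * (z - of_real (scaled_pos h a - real l / sqrt (real h))))"
    unfolding level_poly_def scaled_pos_mult[OF h, symmetric] using h
    by (intro prod.cong refl) (simp add: field_simps)
  then show ?thesis by (simp add: prod.distrib scaled_poly_def)
qed

definition scaled_nodes :: "real \<Rightarrow> nat \<Rightarrow> nat \<Rightarrow> complex \<Rightarrow> complex" where
  "scaled_nodes a n h w = (\<Prod>l\<in>{0..n}. w - of_real (scaled_pos h a - real l / sqrt (real h)))"

lemma card_level_nodes: "card (level_nodes X n) = Suc n"
  unfolding level_nodes_def by (simp add: card_image[OF inj_level_nodes])

lemma prod_level_nodes_scaled:
  assumes h: "h > 0"
  shows "(\<Prod>t\<in>level_nodes (micro_pos (2 * h) a) n. w - t / of_real (sqrt (real h))) = scaled_nodes a n h w"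
  unfolding level_nodes_def scaled_nodes_def prod.reindex[OF inj_level_nodes] o_def
  by (intro prod.cong refl) (simp add: scaled_pos_def diff_divide_distrib)

lemma level_nodes_near:
  assumes h: "h > 0" and near: "(real n + 1) / sqrt (real h) < \<rho>" and t: "t \<in> level_nodes (micro_pos (2 * h) a) n"
  shows "norm (t / of_real (sqrt (real h)) - of_real a) < \<rho>"
proof -
  obtain l where l: "l \<le> n" "t = of_int (micro_pos (2 * h) a) - of_nat l" using t by (auto simp: level_nodes_def)
  have s: "sqrt (real h) > 0" using h by simp
  have "t / of_real (sqrt (real h)) - of_real a = complex_of_real (scaled_pos h a - real l / sqrt (real h) - a)"
    by (simp add: l scaled_pos_def diff_divide_distrib)
  then have "norm (t / of_real (sqrt (real h)) - of_real a) = \<bar>scaled_pos h a - real l / sqrt (real h) - a\<bar>"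
    by (metis norm_of_real)
  also have "\<dots> \<le> (real n + 1) / sqrt (real h)"
  proof -
    have "real l / sqrt (real h) \<le> real n / sqrt (real h)" "0 \<le> real l / sqrt (real h)" using l s by (auto simp: divide_right_mono)
    then show ?thesis using scaled_pos_bounds[OF h, of a] unfolding add_divide_distrib abs_le_iff by linarith
  qed
  finally show ?thesis using near by linarith
qed

definition circle_term :: "nat set \<Rightarrow> (nat \<Rightarrow> real) \<Rightarrow> real \<Rightarrow> nat \<Rightarrow> real \<Rightarrow> nat \<Rightarrow> complex \<Rightarrow> complex" where
  "circle_term I x a n \<rho> h z = contour_integral (circlepath (of_real a) \<rho>)
     (\<lambda>w. scaled_factor I x h w / (scaled_nodes a n h w * (w - z)))"

text \<open>
  Off the disc around \<open>a\<close>, the sum over the nodes is the Cauchy integral over the bounding circle: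
  the additional pole at \<open>z\<close> lies outside. In this form the confluence of the nodes as \<open>h\<close> grows is harmless.
\<close>

lemma reduced_kernel_scaled:
  assumes I: "finite I" and sep: "separated I x h" and h: "h > 0" and \<rho>: "\<rho> > 0"
    and near: "(real n + 1) / sqrt (real h) < \<rho>" and z: "norm (z - of_real a) > \<rho>"
    and nz: "scaled_factor I x h z \<noteq> 0"
  shows "reduced_kernel (boundary_zeros I x h) (level_nodes (micro_pos (2 * h) a) n) (level_poly (micro_pos (2 * h) b) k) (of_real (sqrt (real h)) * z) =
     of_real (sqrt (real h)) ^ k / of_real (sqrt (real h)) ^ (n + 1) *
       (scaled_poly b k h z / scaled_factor I x h z * circle_term I x a n \<rho> h z / (2 * of_real pi * \<i>))"
proof -
  let ?s = "complex_of_real (sqrt (real h))" and ?S = "boundary_zeros I x h" and ?T = "level_nodes (micro_pos (2 * h) a) n"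
  let ?C = "far_const h * ?s ^ card I"
  have cancel: "inverse c * (c * v) = v" if "c \<noteq> 0" for c v :: complex using that by simp
  have s: "sqrt (real h) > 0" "?s \<noteq> 0" using h by auto
  have C: "?C \<noteq> 0" using far_const_nonzero[OF h] s by simp
  have zT: "?s * z \<notin> ?T" using level_nodes_near[OF h near, of "?s * z" a] z s by auto
  have T: "norm (t / ?s - of_real a) < \<rho>" if "t \<in> ?T" for t using level_nodes_near[OF h near that] .
  let ?A = "insert (?s * z) ?T"
  have "node_prod ?S holomorphic_on UNIV" unfolding node_prod_def by (intro holomorphic_intros)
  then have "((\<lambda>w. node_prod ?S (?s * w) / (\<Prod>t\<in>?A. w - t / ?s)) has_contour_integral
     2 * of_real pi * \<i> * (?s ^ (card ?A - 1) *
        (\<Sum>t\<in>{t\<in>?A. norm (t / ?s - of_real a) < \<rho>}. node_prod ?S t / lagrange_denom ?A t))) (circlepath (of_real a) \<rho>)"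
  proof (intro has_contour_integral_scaled_circle[OF _ _ _ s(1) \<rho>])
    fix t assume "t \<in> ?A"
    then show "norm (t / ?s - of_real a) \<noteq> \<rho>" using T[of t] z s by auto
  qed auto
  also have "{t\<in>?A. norm (t / ?s - of_real a) < \<rho>} = ?T" using T z s by auto
  also have "(\<Sum>t\<in>?T. node_prod ?S t / lagrange_denom ?A t) = (\<Sum>t\<in>?T. node_prod ?S t / (lagrange_denom ?T t * (t - ?s * z)))"
  proof (intro sum.cong refl)
    fix t assume t: "t \<in> ?T"
    then have "?A - {t} = insert (?s * z) (?T - {t})" using zT by auto
    then show "node_prod ?S t / lagrange_denom ?A t = node_prod ?S t / (lagrange_denom ?T t * (t - ?s * z))"
      using zT by (simp add: lagrange_denom_def mult.commute)
  qed
  also have "card ?A - 1 = n + 1" using zT by (simp add: card_level_nodes)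
  also have "(\<lambda>w. node_prod ?S (?s * w) / (\<Prod>t\<in>?A. w - t / ?s)) =
     (\<lambda>w. ?C * (scaled_factor I x h w / (scaled_nodes a n h w * (w - z))))"
  proof
    fix w
    have "(\<Prod>t\<in>?A. w - t / ?s) = scaled_nodes a n h w * (w - z)"
      using zT s(2) by (simp add: prod_level_nodes_scaled[OF h])
    then show "node_prod ?S (?s * w) / (\<Prod>t\<in>?A. w - t / ?s) =
       ?C * (scaled_factor I x h w / (scaled_nodes a n h w * (w - z)))"
      by (simp only: node_prod_boundary_zeros_scaled[OF I sep h] times_divide_eq_right)
  qed
  finally have "((\<lambda>w. inverse ?C * (?C * (scaled_factor I x h w / (scaled_nodes a n h w * (w - z))))) has_contour_integral
     inverse ?C * (2 * of_real pi * \<i> * (?s ^ (n + 1) * (\<Sum>t\<in>?T. node_prod ?S t / (lagrange_denom ?T t * (t - ?s * z)))))) (circlepath (of_real a) \<rho>)"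
    by (rule has_contour_integral_lmul)
  also have "(\<lambda>w. inverse ?C * (?C * (scaled_factor I x h w / (scaled_nodes a n h w * (w - z))))) =
     (\<lambda>w. scaled_factor I x h w / (scaled_nodes a n h w * (w - z)))"
    by (simp only: cancel[OF C])
  finally have "circle_term I x a n \<rho> h z = inverse ?C * (2 * of_real pi * \<i> * (?s ^ (n + 1) * (\<Sum>t\<in>?T. node_prod ?S t / (lagrange_denom ?T t * (t - ?s * z)))))"
    unfolding circle_term_def by (rule contour_integral_unique)
  then have sum: "(\<Sum>t\<in>?T. node_prod ?S t / (lagrange_denom ?T t * (t - ?s * z))) = ?C * circle_term I x a n \<rho> h z / (2 * of_real pi * \<i> * ?s ^ (n + 1))"
    using C s by (simp add: field_simps)
  show ?thesis
    unfolding reduced_kernel_def sum node_prod_boundary_zeros_scaled[OF I sep h] level_poly_scaled[OF h]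
    using C s nz by (simp add: field_simps)
qed

definition circle_weight :: "nat set \<Rightarrow> (nat \<Rightarrow> real) \<Rightarrow> real \<Rightarrow> nat \<Rightarrow> real \<Rightarrow> nat \<Rightarrow> complex" where
  "circle_weight I x a n \<rho> h = contour_integral (circlepath (of_real a) \<rho>)
     (\<lambda>w. scaled_factor I x h w / scaled_nodes a n h w)"

text \<open>
  The companion of the preceding lemma without the factor \<open>1 / (w - z)\<close>; needed for the weight of
  a single pole, which may itself lie inside the disc.
\<close>

lemma divided_difference_scaled:
  assumes I: "finite I" and sep: "separated I x h" and h: "h > 0" and \<rho>: "\<rho> > 0"
    and near: "(real n + 1) / sqrt (real h) < \<rho>"
  shows "(\<Sum>t\<in>level_nodes (micro_pos (2 * h) a) n. node_prod (boundary_zeros I x h) t / lagrange_denom (level_nodes (micro_pos (2 * h) a) n) t) =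
     far_const h * of_real (sqrt (real h)) ^ card I / of_real (sqrt (real h)) ^ n * (circle_weight I x a n \<rho> h / (2 * of_real pi * \<i>))"
proof -
  let ?s = "complex_of_real (sqrt (real h))" and ?S = "boundary_zeros I x h" and ?T = "level_nodes (micro_pos (2 * h) a) n"
  let ?C = "far_const h * ?s ^ card I"
  have cancel: "inverse c * (c * v) = v" if "c \<noteq> 0" for c v :: complex using that by simp
  have s: "sqrt (real h) > 0" "?s \<noteq> 0" using h by auto
  have C: "?C \<noteq> 0" using far_const_nonzero[OF h] s by simp
  have T: "norm (t / ?s - of_real a) < \<rho>" if "t \<in> ?T" for t using level_nodes_near[OF h near that] .
  have ne: "?T \<noteq> {}" by (auto simp: level_nodes_def)
  have "node_prod ?S holomorphic_on UNIV" unfolding node_prod_def by (intro holomorphic_intros)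
  then have "((\<lambda>w. node_prod ?S (?s * w) / (\<Prod>t\<in>?T. w - t / ?s)) has_contour_integral
     2 * of_real pi * \<i> * (?s ^ (card ?T - 1) *
        (\<Sum>t\<in>{t\<in>?T. norm (t / ?s - of_real a) < \<rho>}. node_prod ?S t / lagrange_denom ?T t))) (circlepath (of_real a) \<rho>)"
    using T ne by (intro has_contour_integral_scaled_circle[OF _ _ _ s(1) \<rho>]) fastforce+
  also have "{t\<in>?T. norm (t / ?s - of_real a) < \<rho>} = ?T" using T by auto
  also have "card ?T - 1 = n" by (simp add: card_level_nodes)
  also have "(\<lambda>w. node_prod ?S (?s * w) / (\<Prod>t\<in>?T. w - t / ?s)) =
     (\<lambda>w. ?C * (scaled_factor I x h w / scaled_nodes a n h w))"
    using prod_level_nodes_scaled[OF h, of _ a n]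
    by (simp add: node_prod_boundary_zeros_scaled[OF I sep h])
  finally have "((\<lambda>w. inverse ?C * (?C * (scaled_factor I x h w / scaled_nodes a n h w))) has_contour_integral
     inverse ?C * (2 * of_real pi * \<i> * (?s ^ n * (\<Sum>t\<in>?T. node_prod ?S t / lagrange_denom ?T t)))) (circlepath (of_real a) \<rho>)"
    by (rule has_contour_integral_lmul)
  also have "(\<lambda>w. inverse ?C * (?C * (scaled_factor I x h w / scaled_nodes a n h w))) =
     (\<lambda>w. scaled_factor I x h w / scaled_nodes a n h w)"
    by (simp only: cancel[OF C])
  finally have "circle_weight I x a n \<rho> h = inverse ?C * (2 * of_real pi * \<i> * (?s ^ n * (\<Sum>t\<in>?T. node_prod ?S t / lagrange_denom ?T t)))"
    unfolding circle_weight_def by (rule contour_integral_unique)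
  then show ?thesis using C s by (simp add: field_simps)
qed

section \<open>Bounds and limits of the rescaled factors\<close>

lemma eventually_inverse_sqrt_less:
  fixes c d :: real
  assumes "d > 0"
  shows "\<forall>\<^sub>F h in sequentially. h > 0 \<and> c / sqrt (real h) < d"
proof -
  have "(\<lambda>h. c / sqrt (real h)) \<longlonglongrightarrow> 0" by real_asymp
  from order_tendstoD(2)[OF this assms] show ?thesis
    using eventually_gt_at_top[of 0] by eventually_elim auto
qed

lemma scaled_pos_near: "h > 0 \<Longrightarrow> \<bar>scaled_pos h a - a\<bar> \<le> 1 / sqrt (real h)"
  using scaled_pos_bounds[of h a] by (auto simp: abs_le_iff)

lemma scaled_factor_tendsto:
  assumes "finite I"
  shows "(\<lambda>h. scaled_factor I x h w) \<longlonglongrightarrow> (\<Prod>r\<in>I. w - of_real (x r)) * exp (- w\<^sup>2 / 2)"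
  unfolding scaled_factor_def
  by (intro tendsto_intros far_factor_tendsto scaled_pos_tendsto)

lemma scaled_factor_upper_bound:
  assumes I: "finite I"
  shows "\<exists>K. \<forall>\<^sub>F h in sequentially. \<forall>w. norm w \<le> W \<longrightarrow> norm (scaled_factor I x h w) \<le> K"
proof (intro exI)
  have "\<forall>\<^sub>F h in sequentially. h > 0 \<and> 1 / sqrt (real h) < 1" by (rule eventually_inverse_sqrt_less) simp
  then show "\<forall>\<^sub>F h in sequentially. \<forall>w. norm w \<le> W \<longrightarrow> norm (scaled_factor I x h w) \<le>
     (\<Prod>r\<in>I. W + (\<bar>x r\<bar> + 1)) * ((1 + W)\<^sup>2 * exp (W\<^sup>2))"
  proof (eventually_elim, intro allI impI)
    fix h :: nat and w :: complex
    assume h: "h > 0 \<and> 1 / sqrt (real h) < 1" and w: "norm w \<le> W"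
    have W: "W \<ge> 0" using w norm_ge_zero[of w] by linarith
    have "norm (\<Prod>r\<in>I. w - of_real (scaled_pos h (x r))) \<le> (\<Prod>r\<in>I. W + (\<bar>x r\<bar> + 1))"
      unfolding prod_norm[symmetric]
    proof (intro prod_mono conjI norm_ge_zero)
      fix r assume "r \<in> I"
      have "\<bar>scaled_pos h (x r)\<bar> \<le> \<bar>x r\<bar> + 1" using h scaled_pos_near[of h "x r"] by linarith
      then show "norm (w - of_real (scaled_pos h (x r))) \<le> W + (\<bar>x r\<bar> + 1)"
        using norm_triangle_ineq4[of w "of_real (scaled_pos h (x r))"] w by simp
    qed
    moreover have "norm (far_factor h w) \<le> (1 + W)\<^sup>2 * exp (W\<^sup>2)"
    proof -
      have "norm (far_factor h w) \<le> (1 + norm w)\<^sup>2 * exp ((norm w)\<^sup>2)" using h by (intro norm_far_factor_le) simp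
      also have "\<dots> \<le> (1 + W)\<^sup>2 * exp (W\<^sup>2)" using w by (intro mult_mono power_mono) (auto intro: power_mono)
      finally show ?thesis .
    qed
    ultimately show "norm (scaled_factor I x h w) \<le> (\<Prod>r\<in>I. W + (\<bar>x r\<bar> + 1)) * ((1 + W)\<^sup>2 * exp (W\<^sup>2))"
      unfolding scaled_factor_def norm_mult using W by (intro mult_mono prod_nonneg) auto
  qed
qed

text \<open>
  The neighbourhood \<open>\<delta>\<close> of the abscissa \<open>b\<close> allows evaluation at lattice points that converge to \<open>b\<close>,
  not just on the line.
\<close>

lemma scaled_factor_lower_bound:
  assumes I: "finite I" and b: "\<forall>r\<in>I. x r \<noteq> b"
  shows "\<exists>c>0. \<exists>\<delta>>0. \<forall>\<^sub>F h in sequentially. \<forall>w. \<bar>Re w - b\<bar> \<le> \<delta> \<longrightarrow> c * (1 + (Im w)\<^sup>2) ^ M \<le> norm (scaled_factor I x h w)"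
proof -
  obtain \<delta> where \<delta>: "\<delta> > 0" "\<And>r. r \<in> I \<Longrightarrow> 3 * \<delta> \<le> \<bar>x r - b\<bar>"
  proof
    let ?d = "Min (insert 1 ((\<lambda>r. \<bar>x r - b\<bar>) ` I)) / 3"
    show "?d > 0" using I b by simp
    show "3 * ?d \<le> \<bar>x r - b\<bar>" if "r \<in> I" for r using I that by (auto intro: Min_le)
  qed
  obtain c where c: "c > 0" "\<forall>\<^sub>F h in sequentially. \<forall>w. \<bar>Re w\<bar> \<le> \<bar>b\<bar> + \<delta> \<longrightarrow> c * (1 + (Im w)\<^sup>2) ^ M \<le> norm (far_factor h w)"
    using far_factor_lower_bound[of "\<bar>b\<bar> + \<delta>" M] by blast
  have "\<forall>\<^sub>F h in sequentially. \<forall>w. \<bar>Re w - b\<bar> \<le> \<delta> \<longrightarrow> \<delta> ^ card I * c * (1 + (Im w)\<^sup>2) ^ M \<le> norm (scaled_factor I x h w)"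
    using c(2) eventually_inverse_sqrt_less[OF \<delta>(1), of 1]
  proof (eventually_elim, intro allI impI)
    fix h :: nat and w :: complex
    assume lb: "\<forall>w. \<bar>Re w\<bar> \<le> \<bar>b\<bar> + \<delta> \<longrightarrow> c * (1 + (Im w)\<^sup>2) ^ M \<le> norm (far_factor h w)"
      and h: "h > 0 \<and> 1 / sqrt (real h) < \<delta>" and w: "\<bar>Re w - b\<bar> \<le> \<delta>"
    have "\<delta> ^ card I = (\<Prod>r\<in>I. \<delta>)" by simp
    also have "\<dots> \<le> (\<Prod>r\<in>I. norm (w - of_real (scaled_pos h (x r))))"
    proof (intro prod_mono conjI)
      fix r assume r: "r \<in> I"
      have "\<bar>Re w - scaled_pos h (x r)\<bar> \<ge> \<delta>" using \<delta>(2)[OF r] scaled_pos_near[of h "x r"] h w by linarith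
      then show "\<delta> \<le> norm (w - of_real (scaled_pos h (x r)))"
        using abs_Re_le_cmod[of "w - of_real (scaled_pos h (x r))"] by simp
    qed (use \<delta> in auto)
    finally have p: "\<delta> ^ card I \<le> norm (\<Prod>r\<in>I. w - of_real (scaled_pos h (x r)))" by (simp add: prod_norm)
    have "\<bar>Re w\<bar> \<le> \<bar>b\<bar> + \<delta>" using w by linarith
    then have "c * (1 + (Im w)\<^sup>2) ^ M \<le> norm (far_factor h w)" using lb by blast
    then show "\<delta> ^ card I * c * (1 + (Im w)\<^sup>2) ^ M \<le> norm (scaled_factor I x h w)"
      unfolding scaled_factor_def norm_mult mult.assoc using p c \<delta> by (intro mult_mono mult_nonneg_nonneg) auto
  qed
  moreover have "\<delta> ^ card I * c > 0" using \<delta> c by simp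
  ultimately show ?thesis using \<delta>(1) by blast
qed

lemma scaled_nodes_tendsto: "(\<lambda>h. scaled_nodes a n h w) \<longlonglongrightarrow> (w - of_real a) ^ (n + 1)"
proof -
  have "(\<lambda>h. real l / sqrt (real h)) \<longlonglongrightarrow> 0" for l by real_asymp
  then have "(\<lambda>h. scaled_nodes a n h w) \<longlonglongrightarrow> (\<Prod>l\<in>{0..n}. w - of_real (a - 0))"
    unfolding scaled_nodes_def by (intro tendsto_intros scaled_pos_tendsto)
  then show ?thesis by simp
qed

lemma scaled_nodes_lower_bound:
  assumes h: "h > 0" and near: "(real n + 1) / sqrt (real h) < \<rho> / 2" and w: "w \<in> sphere (of_real a) \<rho>"
  shows "(\<rho> / 2) ^ (n + 1) \<le> norm (scaled_nodes a n h w)"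
proof -
  have "0 \<le> (real n + 1) / sqrt (real h)" by simp
  then have \<rho>: "\<rho> \<ge> 0" using near by linarith
  have "(\<rho> / 2) ^ (n + 1) = (\<Prod>l\<in>{0..n}. \<rho> / 2)" by simp
  also have "\<dots> \<le> (\<Prod>l\<in>{0..n}. norm (w - of_real (scaled_pos h a - real l / sqrt (real h))))"
  proof (intro prod_mono conjI)
    fix l assume l: "l \<in> {0..n}"
    have "of_int (micro_pos (2 * h) a) - of_nat l \<in> level_nodes (micro_pos (2 * h) a) n"
      using l unfolding level_nodes_def by blast
    define v where "v = complex_of_real (scaled_pos h a - real l / sqrt (real h))"
    from level_nodes_near[OF h near \<open>_ \<in> level_nodes _ _\<close>]
    have "norm (v - of_real a) < \<rho> / 2"
      by (simp add: v_def scaled_pos_def diff_divide_distrib)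
    moreover have "norm (w - of_real a) = \<rho>" using w by (simp add: dist_norm norm_minus_commute)
    moreover have "norm (w - of_real a) - norm (v - of_real a) \<le> norm (w - v)"
      using norm_triangle_ineq2[of "w - of_real a" "v - of_real a"] by (simp only: diff_diff_eq2 diff_add_cancel)
    ultimately have "\<rho> / 2 \<le> norm (w - v)" by linarith
    then show "\<rho> / 2 \<le> norm (w - of_real (scaled_pos h a - real l / sqrt (real h)))" by (simp only: v_def)
  qed (use \<rho> in auto)
  finally show ?thesis by (simp add: scaled_nodes_def prod_norm)
qed

lemma continuous_on_scaled_factor: "continuous_on A (scaled_factor I x h)"
  unfolding scaled_factor_def far_factor_def by (intro continuous_intros) auto

lemma continuous_on_scaled_nodes: "continuous_on A (scaled_nodes a n h)"
  unfolding scaled_nodes_def by (intro continuous_intros)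

lemma circle_integrand_bounded:
  assumes I: "finite I" and \<rho>: "\<rho> > 0"
  shows "\<exists>K\<ge>0. \<forall>\<^sub>F h in sequentially. continuous_on (sphere (of_real a) \<rho>) (\<lambda>w. scaled_factor I x h w / scaled_nodes a n h w) \<and>
     (\<forall>w\<in>sphere (of_real a) \<rho>. norm (scaled_factor I x h w / scaled_nodes a n h w) \<le> K)"
proof -
  obtain K where K: "\<forall>\<^sub>F h in sequentially. \<forall>w. norm w \<le> \<bar>a\<bar> + \<rho> \<longrightarrow> norm (scaled_factor I x h w) \<le> K"
    using scaled_factor_upper_bound[OF I, of "\<bar>a\<bar> + \<rho>" x] by blast
  have \<rho>2: "\<rho> / 2 > 0" using \<rho> by simp
  have "\<forall>\<^sub>F h in sequentially. continuous_on (sphere (of_real a) \<rho>) (\<lambda>w. scaled_factor I x h w / scaled_nodes a n h w) \<and>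
     (\<forall>w\<in>sphere (of_real a) \<rho>. norm (scaled_factor I x h w / scaled_nodes a n h w) \<le> \<bar>K\<bar> / (\<rho> / 2) ^ (n + 1))"
    using K eventually_inverse_sqrt_less[OF \<rho>2, of "real n + 1"]
  proof eventually_elim
    case (elim h)
    have lb: "(\<rho> / 2) ^ (n + 1) \<le> norm (scaled_nodes a n h w)" if "w \<in> sphere (of_real a) \<rho>" for w
      using elim(2) by (intro scaled_nodes_lower_bound that) auto
    have nz: "scaled_nodes a n h w \<noteq> 0" if "w \<in> sphere (of_real a) \<rho>" for w
      using lb[OF that] zero_less_power[OF \<rho>2, of "n + 1"] by auto
    have "norm (scaled_factor I x h w / scaled_nodes a n h w) \<le> \<bar>K\<bar> / (\<rho> / 2) ^ (n + 1)" if w: "w \<in> sphere (of_real a) \<rho>" for w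
    proof -
      have "norm (w - of_real a) = \<rho>" using w by (simp add: dist_norm norm_minus_commute)
      then have "norm w \<le> \<bar>a\<bar> + \<rho>" using norm_triangle_ineq[of "w - of_real a" "of_real a"] by simp
      then have "norm (scaled_factor I x h w) \<le> \<bar>K\<bar>" using elim(1) abs_ge_self[of K] by (meson order_trans)
      then show ?thesis unfolding norm_divide using lb[OF w] zero_less_power[OF \<rho>2, of "n + 1"] by (intro frac_le) auto
    qed
    then show ?case using nz by (intro conjI continuous_intros continuous_on_scaled_factor continuous_on_scaled_nodes) auto
  qed
  then show ?thesis using \<rho> by (intro exI[of _ "\<bar>K\<bar> / (\<rho> / 2) ^ (n + 1)"]) auto
qed

lemma circle_weight_bounded:
  assumes I: "finite I" and \<rho>: "\<rho> > 0"
  shows "\<exists>K. \<forall>\<^sub>F h in sequentially. norm (circle_weight I x a n \<rho> h) \<le> K"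
proof -
  obtain K where K: "K \<ge> 0" "\<forall>\<^sub>F h in sequentially. continuous_on (sphere (of_real a) \<rho>) (\<lambda>w. scaled_factor I x h w / scaled_nodes a n h w) \<and>
     (\<forall>w\<in>sphere (of_real a) \<rho>. norm (scaled_factor I x h w / scaled_nodes a n h w) \<le> K)"
    using circle_integrand_bounded[OF assms, of a x n] by blast
  from K(2) have "\<forall>\<^sub>F h in sequentially. norm (circle_weight I x a n \<rho> h) \<le> K * (2 * pi * \<rho>)"
  proof eventually_elim
    case (elim h)
    have "(\<lambda>w. scaled_factor I x h w / scaled_nodes a n h w) contour_integrable_on circlepath (of_real a) \<rho>"
      using elim \<rho> by (intro contour_integrable_continuous_circlepath) auto
    then show ?case unfolding circle_weight_def
      using elim \<rho> K(1) by (intro has_contour_integral_bound_circlepath[OF has_contour_integral_integral])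
        (auto simp: dist_norm norm_minus_commute)
  qed
  then show ?thesis by blast
qed

text \<open>
  The bound is uniform in \<open>z\<close> on the line, which keeps a positive distance from the disc.
\<close>

lemma circle_term_bounded_tendsto:
  assumes I: "finite I" and \<rho>: "\<rho> > 0" "\<rho> < \<bar>b - a\<bar>"
  shows "\<exists>K\<ge>0. \<forall>\<^sub>F h in sequentially. \<forall>z. Re z = b \<longrightarrow> norm (circle_term I x a n \<rho> h z) \<le> K" (is ?bound)
    and "Re z = b \<Longrightarrow> (\<lambda>h. circle_term I x a n \<rho> h z) \<longlonglongrightarrow> contour_integral (circlepath (of_real a) \<rho>)
       (\<lambda>w. (\<Prod>r\<in>I. w - of_real (x r)) * exp (- w\<^sup>2 / 2) / ((w - of_real a) ^ (n + 1) * (w - z)))" (is "_ \<Longrightarrow> ?lim")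
proof -
  define \<delta> where "\<delta> = \<bar>b - a\<bar> - \<rho>"
  have \<delta>: "\<delta> > 0" using \<rho> by (simp add: \<delta>_def)
  have dist: "\<delta> \<le> norm (w - z)" if "w \<in> sphere (of_real a) \<rho>" "Re z = b" for w z
  proof -
    have "norm (w - of_real a) = \<rho>" using that by (simp add: dist_norm norm_minus_commute)
    then have "\<bar>Re w - a\<bar> \<le> \<rho>" using abs_Re_le_cmod[of "w - of_real a"] by simp
    then have "\<delta> \<le> \<bar>Re w - Re z\<bar>" using that unfolding \<delta>_def by linarith
    then show ?thesis using abs_Re_le_cmod[of "w - z"] by simp
  qed
  obtain K where K: "K \<ge> 0" "\<forall>\<^sub>F h in sequentially. continuous_on (sphere (of_real a) \<rho>) (\<lambda>w. scaled_factor I x h w / scaled_nodes a n h w) \<and>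
     (\<forall>w\<in>sphere (of_real a) \<rho>. norm (scaled_factor I x h w / scaled_nodes a n h w) \<le> K)"
    using circle_integrand_bounded[OF I \<rho>(1), of a x n] by blast
  have ev: "\<forall>\<^sub>F h in sequentially. \<forall>z. Re z = b \<longrightarrow>
     continuous_on (sphere (of_real a) \<rho>) (\<lambda>w. scaled_factor I x h w / (scaled_nodes a n h w * (w - z))) \<and>
     (\<forall>w\<in>sphere (of_real a) \<rho>. norm (scaled_factor I x h w / (scaled_nodes a n h w * (w - z))) \<le> K / \<delta>)"
    using K(2)
  proof (eventually_elim, intro allI impI conjI ballI)
    fix h z assume e: "continuous_on (sphere (of_real a) \<rho>) (\<lambda>w. scaled_factor I x h w / scaled_nodes a n h w) \<and>
       (\<forall>w\<in>sphere (of_real a) \<rho>. norm (scaled_factor I x h w / scaled_nodes a n h w) \<le> K)" and z: "Re z = b"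
    have eq: "scaled_factor I x h w / (scaled_nodes a n h w * (w - z)) = scaled_factor I x h w / scaled_nodes a n h w / (w - z)" for w
      by simp
    show "continuous_on (sphere (of_real a) \<rho>) (\<lambda>w. scaled_factor I x h w / (scaled_nodes a n h w * (w - z)))"
      unfolding eq using dist[OF _ z] \<delta>
      by (intro continuous_on_divide[of _ "\<lambda>w. scaled_factor I x h w / scaled_nodes a n h w"] conjunct1[OF e] continuous_on_diff
           continuous_on_id continuous_on_const) force
    fix w :: complex assume w: "w \<in> sphere (of_real a) \<rho>"
    show "norm (scaled_factor I x h w / (scaled_nodes a n h w * (w - z))) \<le> K / \<delta>"
      unfolding eq norm_divide[of _ "w - z"] using e w dist[OF w z] \<delta> K(1) by (intro frac_le) auto
  qed
  from ev have "\<forall>\<^sub>F h in sequentially. \<forall>z. Re z = b \<longrightarrow> norm (circle_term I x a n \<rho> h z) \<le> K / \<delta> * (2 * pi * \<rho>)"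
  proof (eventually_elim, intro allI impI)
    fix h z assume e: "\<forall>z. Re z = b \<longrightarrow>
       continuous_on (sphere (of_real a) \<rho>) (\<lambda>w. scaled_factor I x h w / (scaled_nodes a n h w * (w - z))) \<and>
       (\<forall>w\<in>sphere (of_real a) \<rho>. norm (scaled_factor I x h w / (scaled_nodes a n h w * (w - z))) \<le> K / \<delta>)" and z: "Re z = b"
    have "(\<lambda>w. scaled_factor I x h w / (scaled_nodes a n h w * (w - z))) contour_integrable_on circlepath (of_real a) \<rho>"
      using e z \<rho> by (intro contour_integrable_continuous_circlepath) auto
    then show "norm (circle_term I x a n \<rho> h z) \<le> K / \<delta> * (2 * pi * \<rho>)" unfolding circle_term_def
      using e z \<rho> K(1) \<delta> by (intro has_contour_integral_bound_circlepath[OF has_contour_integral_integral])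
        (auto simp: dist_norm norm_minus_commute)
  qed
  moreover have "K / \<delta> * (2 * pi * \<rho>) \<ge> 0" using K(1) \<delta> \<rho> by simp
  ultimately show ?bound by blast
  assume z: "Re z = b"
  show ?lim
    unfolding circle_term_def
  proof (rule contour_integral_circlepath_dominated[where K="K / \<delta>"])
    show "\<forall>\<^sub>F h in sequentially. continuous_on (sphere (of_real a) \<rho>) (\<lambda>w. scaled_factor I x h w / (scaled_nodes a n h w * (w - z)))"
      using ev by eventually_elim (use z in auto)
    show "\<forall>\<^sub>F h in sequentially. \<forall>w\<in>sphere (of_real a) \<rho>. norm (scaled_factor I x h w / (scaled_nodes a n h w * (w - z))) \<le> K / \<delta>"
      using ev by eventually_elim (use z in auto)
    fix w :: complex assume w: "w \<in> sphere (of_real a) \<rho>"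
    then have "w \<noteq> of_real a" using \<rho> by auto
    moreover have "w \<noteq> z" using dist[OF w z] \<delta> by auto
    ultimately show "(\<lambda>h. scaled_factor I x h w / (scaled_nodes a n h w * (w - z))) \<longlonglongrightarrow>
       (\<Prod>r\<in>I. w - of_real (x r)) * exp (- w\<^sup>2 / 2) / ((w - of_real a) ^ (n + 1) * (w - z))"
      by (intro tendsto_intros scaled_factor_tendsto[OF I] scaled_nodes_tendsto) auto
  qed (use \<rho> in auto)
qed

lemma scaled_poly_tendsto: "(\<lambda>h. scaled_poly a k h w) \<longlonglongrightarrow> (w - of_real a) ^ k"
proof -
  have "(\<lambda>h. real l / sqrt (real h)) \<longlonglongrightarrow> 0" for l by real_asymp
  then have "(\<lambda>h. scaled_poly a k h w) \<longlonglongrightarrow> (\<Prod>l\<in>{1..k}. w - of_real (a - 0))"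
    unfolding scaled_poly_def by (intro tendsto_intros scaled_pos_tendsto)
  then show ?thesis by simp
qed

lemma scaled_poly_bound:
  assumes h: "h > 0"
  shows "norm (scaled_poly a k h w) \<le> (norm w + \<bar>a\<bar> + 1 + real k) ^ k"
proof -
  have s: "sqrt (real h) \<ge> 1" using h by simp
  have "norm (scaled_poly a k h w) \<le> (\<Prod>l\<in>{1..k}. norm w + \<bar>a\<bar> + 1 + real k)"
    unfolding scaled_poly_def prod_norm[symmetric]
  proof (intro prod_mono conjI norm_ge_zero)
    fix l assume l: "l \<in> {1..k}"
    have "1 / sqrt (real h) \<le> 1" using s by simp
    moreover have "real l / sqrt (real h) \<le> real k / 1" using s l by (intro frac_le) auto
    moreover have "0 \<le> real l / sqrt (real h)" by simp
    ultimately have "\<bar>scaled_pos h a - real l / sqrt (real h)\<bar> \<le> \<bar>a\<bar> + 1 + real k"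
      using scaled_pos_near[OF h, of a] unfolding abs_le_iff by linarith
    then show "norm (w - of_real (scaled_pos h a - real l / sqrt (real h))) \<le> norm w + \<bar>a\<bar> + 1 + real k"
      using norm_triangle_ineq4[of w "of_real (scaled_pos h a - real l / sqrt (real h))"] unfolding norm_of_real by linarith
  qed
  then show ?thesis by simp
qed

section \<open>Convergence of the line integral\<close>

lemma vertical_line_integral_cong:
  "(\<And>z. Re z = b \<Longrightarrow> f z = g z) \<Longrightarrow> vertical_line_integral b f = vertical_line_integral b g"
  unfolding vertical_line_integral_def by (intro arg_cong2[where f="(*)"] Bochner_Integration.integral_cong) auto

lemma vertical_line_integral_cmult:
  "vertical_line_integral b (\<lambda>z. c * f z) = c * vertical_line_integral b f"
  unfolding vertical_line_integral_def by simp

lemma vertical_line_integral_scale: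
  assumes s: "s > 0"
  shows "vertical_line_integral (s * b) f = of_real s * vertical_line_integral b (\<lambda>z. f (of_real s * z))"
proof -
  have "(\<integral>t. f (Complex (s * b) t) \<partial>lborel) = \<bar>s\<bar> *\<^sub>R (\<integral>t. f (Complex (s * b) (0 + s * t)) \<partial>lborel)"
    using s by (intro lborel_integral_real_affine) auto
  moreover have "Complex (s * b) (0 + s * t) = of_real s * Complex b t" for t
    by (simp add: complex_eq_iff)
  ultimately show ?thesis using s unfolding vertical_line_integral_def
    by (simp add: scaleR_conv_of_real)
qed

text \<open>
  The gauged and rescaled reduced kernel.
\<close>

definition line_term :: "nat set \<Rightarrow> (nat \<Rightarrow> real) \<Rightarrow> real \<Rightarrow> nat \<Rightarrow> real \<Rightarrow> real \<Rightarrow> nat \<Rightarrow> nat \<Rightarrow> complex \<Rightarrow> complex" where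
  "line_term I x a n \<rho> y k h z =
     scaled_poly y k h z / scaled_factor I x h z * circle_term I x a n \<rho> h z / (2 * of_real pi * \<i>)"

lemma borel_measurable_reduced_kernel_line:
  "(\<lambda>t. reduced_kernel S T (level_poly X k) (c * Complex b t)) \<in> borel_measurable borel"
proof -
  have [measurable]: "(\<lambda>t. c * Complex b t) \<in> borel_measurable borel"
    by (intro borel_measurable_continuous_onI) (auto simp: Complex_eq intro!: continuous_intros)
  show ?thesis
    unfolding reduced_kernel_def level_poly_def node_prod_def by measurable
qed

lemma eventually_scaled_nonzero:
  assumes I: "finite I" and b: "\<forall>r\<in>I. x r \<noteq> b"
  shows "\<forall>\<^sub>F h in sequentially. \<forall>z. Re z = b \<longrightarrow> scaled_factor I x h z \<noteq> 0"
proof -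
  obtain c \<delta> where c: "c > 0" "\<delta> > 0" and
    ev: "\<forall>\<^sub>F h in sequentially. \<forall>w. \<bar>Re w - b\<bar> \<le> \<delta> \<longrightarrow> c * (1 + (Im w)\<^sup>2) ^ 0 \<le> norm (scaled_factor I x h w)"
    using scaled_factor_lower_bound[OF I b, where M=0] by blast
  from ev show ?thesis
  proof (eventually_elim, intro allI impI)
    fix h z assume lb: "\<forall>w. \<bar>Re w - b\<bar> \<le> \<delta> \<longrightarrow> c * (1 + (Im w)\<^sup>2) ^ 0 \<le> norm (scaled_factor I x h w)" and "Re z = b"
    then have "c * (1 + (Im z)\<^sup>2) ^ 0 \<le> norm (scaled_factor I x h z)" using c by auto
    then show "scaled_factor I x h z \<noteq> 0" using c by auto
  qed
qed

lemma reduced_kernel_eq_line_term: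
  assumes I: "finite I" and sep: "\<forall>\<^sub>F h in sequentially. separated I x h"
    and b: "\<forall>r\<in>I. x r \<noteq> b" and \<rho>: "\<rho> > 0" "\<rho> < \<bar>b - a\<bar>"
  shows "\<forall>\<^sub>F h in sequentially. \<forall>z. Re z = b \<longrightarrow> line_term I x a n \<rho> y k h z =
     of_real (sqrt (real h)) ^ (n + 1) / of_real (sqrt (real h)) ^ k *
     reduced_kernel (boundary_zeros I x h) (level_nodes (micro_pos (2 * h) a) n) (level_poly (micro_pos (2 * h) y) k) (of_real (sqrt (real h)) * z)"
  using sep eventually_inverse_sqrt_less[OF \<rho>(1), of "real n + 1"] eventually_scaled_nonzero[OF I b]
proof (eventually_elim, intro allI impI)
  fix h z assume h: "separated I x h" "h > 0 \<and> (real n + 1) / sqrt (real h) < \<rho>"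
     "\<forall>z. Re z = b \<longrightarrow> scaled_factor I x h z \<noteq> 0" and z: "Re z = b"
  have "norm (z - of_real a) > \<rho>" using abs_Re_le_cmod[of "z - of_real a"] z \<rho> by simp
  then show "line_term I x a n \<rho> y k h z =
     of_real (sqrt (real h)) ^ (n + 1) / of_real (sqrt (real h)) ^ k *
     reduced_kernel (boundary_zeros I x h) (level_nodes (micro_pos (2 * h) a) n) (level_poly (micro_pos (2 * h) y) k) (of_real (sqrt (real h)) * z)"
    using h z \<rho> by (subst reduced_kernel_scaled[OF I h(1) _ \<rho>(1)]) (auto simp: line_term_def)
qed

text \<open>
  The numerator grows at most like \<open>(1 + t\<^sup>2) ^ k\<close>; the lower bound for the denominator is used with exponent
  \<open>k + 1\<close>, which leaves the majorant \<open>1 / (1 + t\<^sup>2)\<close>.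
\<close>

lemma line_term_integral_tendsto:
  assumes I: "finite I" and sep: "\<forall>\<^sub>F h in sequentially. separated I x h"
    and b: "\<forall>r\<in>I. x r \<noteq> b" and \<rho>: "\<rho> > 0" "\<rho> < \<bar>b - a\<bar>"
  shows "(\<lambda>h. vertical_line_integral b (line_term I x a n \<rho> y k h)) \<longlonglongrightarrow> vertical_line_integral b (\<lambda>z.
     (z - of_real y) ^ k / ((\<Prod>r\<in>I. z - of_real (x r)) * exp (- z\<^sup>2 / 2)) *
     contour_integral (circlepath (of_real a) \<rho>)
       (\<lambda>w. (\<Prod>r\<in>I. w - of_real (x r)) * exp (- w\<^sup>2 / 2) / ((w - of_real a) ^ (n + 1) * (w - z))) / (2 * of_real pi * \<i>))"
    (is "_ \<longlonglongrightarrow> vertical_line_integral b ?L")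
proof -
  let ?f = "\<lambda>h t. line_term I x a n \<rho> y k h (Complex b t)"
  obtain K where K: "K \<ge> 0" "\<forall>\<^sub>F h in sequentially. \<forall>z. Re z = b \<longrightarrow> norm (circle_term I x a n \<rho> h z) \<le> K"
    using circle_term_bounded_tendsto(1)[OF I \<rho>, of x n] by blast
  obtain c \<delta> where c: "c > 0" "\<delta> > 0" "\<forall>\<^sub>F h in sequentially. \<forall>w. \<bar>Re w - b\<bar> \<le> \<delta> \<longrightarrow> c * (1 + (Im w)\<^sup>2) ^ (k + 1) \<le> norm (scaled_factor I x h w)"
    using scaled_factor_lower_bound[OF I b, where M="k + 1"] by blast
  define D where "D = \<bar>b\<bar> + \<bar>y\<bar> + 1 + real k"
  define Q where "Q = (2 * D) ^ k / c * K / (2 * pi)"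
  have lim: "(\<lambda>h. ?f h t) \<longlonglongrightarrow> ?L (Complex b t)" for t
  proof -
    have "(\<Prod>r\<in>I. Complex b t - of_real (x r)) * exp (- (Complex b t)\<^sup>2 / 2) \<noteq> 0"
    proof -
      have "Complex b t - of_real (x r) \<noteq> 0" if "r \<in> I" for r using b that by (auto simp: complex_eq_iff)
      then show ?thesis using I by simp
    qed
    then show ?thesis
      unfolding line_term_def
      by (intro tendsto_intros scaled_poly_tendsto scaled_factor_tendsto I circle_term_bounded_tendsto(2)[OF I \<rho>]) auto
  qed
  have bound: "\<forall>\<^sub>F h in sequentially. \<forall>t. norm (?f h t) \<le> Q * (1 / (1 + t\<^sup>2))"
    using K(2) c(3) eventually_gt_at_top[of 0]
  proof (eventually_elim, intro allI)
    fix h :: nat and t :: real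
    assume h: "\<forall>z. Re z = b \<longrightarrow> norm (circle_term I x a n \<rho> h z) \<le> K"
      "\<forall>w. \<bar>Re w - b\<bar> \<le> \<delta> \<longrightarrow> c * (1 + (Im w)\<^sup>2) ^ (k + 1) \<le> norm (scaled_factor I x h w)" "0 < h"
    let ?z = "Complex b t"
    have D1: "D \<ge> 1" by (simp add: D_def)
    have t1: "1 + t\<^sup>2 > 0" by (simp add: add_pos_nonneg)
    have "norm ?z + \<bar>y\<bar> + 1 + real k \<le> 2 * D * (1 + t\<^sup>2)"
    proof -
      have "norm ?z \<le> \<bar>b\<bar> + \<bar>t\<bar>" using cmod_le[of ?z] by simp
      moreover have "\<bar>t\<bar> \<le> 1 + t\<^sup>2"
      proof -
        have "0 \<le> (1 - \<bar>t\<bar>)\<^sup>2" by simp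
        then have "2 * \<bar>t\<bar> \<le> 1 + t\<^sup>2" by (simp add: power2_diff)
        then show ?thesis by linarith
      qed
      moreover have "1 + t\<^sup>2 \<le> D * (1 + t\<^sup>2)" using D1 t1 by (simp add: mult_le_cancel_right1)
      moreover have "D * 1 \<le> D * (1 + t\<^sup>2)" using D1 by (intro mult_left_mono) auto
      moreover have "norm ?z + \<bar>y\<bar> + 1 + real k \<le> D + (norm ?z - \<bar>b\<bar>)" by (simp add: D_def)
      ultimately have "norm ?z + \<bar>y\<bar> + 1 + real k \<le> 2 * (D * (1 + t\<^sup>2))" by linarith
      then show ?thesis by (simp only: mult.assoc)
    qed
    then have p: "norm (scaled_poly y k h ?z) \<le> (2 * D * (1 + t\<^sup>2)) ^ k"
      using scaled_poly_bound[OF h(3), of y k ?z] by (meson add_nonneg_nonneg abs_ge_zero norm_ge_zero of_nat_0_le_iff order_trans power_mono zero_le_one)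
    have f: "c * (1 + t\<^sup>2) ^ (k + 1) \<le> norm (scaled_factor I x h ?z)" using spec[OF h(2), of ?z] c(2) by simp
    have g: "norm (circle_term I x a n \<rho> h ?z) \<le> K" using h(1) by simp
    have "norm (?f h t) = norm (scaled_poly y k h ?z) / norm (scaled_factor I x h ?z) * norm (circle_term I x a n \<rho> h ?z) / (2 * pi)"
      unfolding line_term_def by (simp add: norm_mult norm_divide)
    also have "\<dots> \<le> (2 * D * (1 + t\<^sup>2)) ^ k / (c * (1 + t\<^sup>2) ^ (k + 1)) * K / (2 * pi)"
      using p f g c(1) D1 t1 by (intro divide_right_mono mult_mono frac_le mult_pos_pos zero_less_power zero_le_power) auto
    also have "\<dots> = Q * (1 / (1 + t\<^sup>2))"
    proof -
      have "(2 * D * u) ^ k / (c * u ^ (k + 1)) * K / (2 * pi) = (2 * D) ^ k / c * K / (2 * pi) * (1 / u)" if "u > 0" for u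
        using that c(1) by (simp add: power_mult_distrib field_simps)
      from this[OF t1] show ?thesis unfolding Q_def .
    qed
    finally show "norm (?f h t) \<le> Q * (1 / (1 + t\<^sup>2))" .
  qed
  have meas: "\<forall>\<^sub>F h in sequentially. ?f h \<in> borel_measurable lborel"
    using reduced_kernel_eq_line_term[OF I sep b \<rho>, of n y k]
  proof eventually_elim
    case (elim h)
    then have "?f h = (\<lambda>t. of_real (sqrt (real h)) ^ (n + 1) / of_real (sqrt (real h)) ^ k *
       reduced_kernel (boundary_zeros I x h) (level_nodes (micro_pos (2 * h) a) n) (level_poly (micro_pos (2 * h) y) k) (of_real (sqrt (real h)) * Complex b t))"
      by auto
    moreover have "\<dots> \<in> borel_measurable borel"
      by (intro borel_measurable_times borel_measurable_const borel_measurable_reduced_kernel_line)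
    ultimately show ?case by simp
  qed
  from eventually_conj[OF meas bound] obtain h0 where
    h0: "\<And>h. h \<ge> h0 \<Longrightarrow> ?f h \<in> borel_measurable lborel \<and> (\<forall>t. norm (?f h t) \<le> Q * (1 / (1 + t\<^sup>2)))"
    unfolding eventually_sequentially by blast
  have lim': "(\<lambda>h. ?f (h + h0) t) \<longlonglongrightarrow> ?L (Complex b t)" for t
    by (rule LIMSEQ_ignore_initial_segment[OF lim])
  have "(\<lambda>h. \<integral>t. ?f (h + h0) t \<partial>lborel) \<longlonglongrightarrow> (\<integral>t. ?L (Complex b t) \<partial>lborel)"
  proof (rule integral_dominated_convergence[where w="\<lambda>t. Q * (1 / (1 + t\<^sup>2))"])
    show "(\<lambda>t. ?L (Complex b t)) \<in> borel_measurable lborel"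
      by (rule borel_measurable_LIMSEQ_metric[of "\<lambda>h. ?f (h + h0)"]) (use h0 lim' in auto)
    show "?f (h + h0) \<in> borel_measurable lborel" for h using h0[of "h + h0"] by simp
    show "integrable lborel (\<lambda>t. Q * (1 / (1 + t\<^sup>2)))"
      by (intro integrable_mult_right integrable_inverse_one_plus_square)
    show "AE t in lborel. (\<lambda>h. ?f (h + h0) t) \<longlonglongrightarrow> ?L (Complex b t)" by (intro AE_I2 lim')
    show "AE t in lborel. norm (?f (h + h0) t) \<le> Q * (1 / (1 + t\<^sup>2))" for h
      using h0[of "h + h0"] by (intro AE_I2) auto
  qed
  then have "(\<lambda>h. \<integral>t. ?f h t \<partial>lborel) \<longlonglongrightarrow> (\<integral>t. ?L (Complex b t) \<partial>lborel)" by (rule LIMSEQ_offset)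
  then show ?thesis unfolding vertical_line_integral_def by (intro tendsto_intros)
qed

lemma card_boundary_zeros_ge:
  assumes "finite I"
  shows "h \<le> card (boundary_zeros I x h)"
proof -
  have "h = card {int h..<2 * int h}" by simp
  also have "\<dots> = card (of_int ` {int h..<2 * int h} :: complex set)"
    by (subst card_image) (auto simp: inj_on_def)
  also have "\<dots> \<le> card (boundary_zeros I x h)"
    by (intro card_mono finite_boundary_zeros assms) (auto simp: boundary_zeros_def)
  finally show ?thesis .
qed

lemma level_poly_growth:
  assumes "1 \<le> norm z"
  shows "norm (level_poly X k z) \<le> (1 + \<bar>of_int X\<bar> + real k) ^ k * norm z ^ k"
proof -
  have "norm (level_poly X k z) \<le> (\<Prod>l\<in>{1..k}. (1 + \<bar>of_int X\<bar> + real k) * norm z)"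
    unfolding level_poly_def prod_norm[symmetric]
  proof (intro prod_mono conjI norm_ge_zero)
    fix l assume l: "l \<in> {1..k}"
    have "norm (z - of_int X + of_nat l) \<le> norm z + \<bar>of_int X\<bar> + real l"
      using norm_triangle_ineq[of "z - of_int X" "of_nat l"] norm_triangle_ineq4[of z "of_int X"] by simp
    also have "\<dots> \<le> norm z + (\<bar>of_int X\<bar> + real k) * 1" using l by simp
    also have "\<dots> \<le> norm z + (\<bar>of_int X\<bar> + real k) * norm z" using assms by (intro add_mono mult_left_mono) auto
    finally show "norm (z - of_int X + of_nat l) \<le> (1 + \<bar>of_int X\<bar> + real k) * norm z" by (simp add: algebra_simps)
  qed
  then show ?thesis by (simp add: power_mult_distrib)
qed

section \<open>Contours of the limit kernel\<close>

lemma line_connected_unbounded: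
  shows "connected {z. Re z = b}" and "\<not> bounded {z. Re z = b}"
proof -
  have e: "{z. Re z = b} = (\<lambda>t. Complex b t) ` UNIV" by (auto simp: image_iff complex_eq_iff)
  show "connected {z. Re z = b}" unfolding e
    by (intro connected_continuous_image) (auto simp: Complex_eq intro!: continuous_intros)
  show "\<not> bounded {z. Re z = b}"
  proof
    assume "bounded {z. Re z = b}"
    then obtain B where B: "\<And>z. Re z = b \<Longrightarrow> norm z \<le> B" unfolding bounded_iff by blast
    have "\<bar>B\<bar> + 1 \<le> norm (Complex b (\<bar>B\<bar> + 1))" using abs_Im_le_cmod[of "Complex b (\<bar>B\<bar> + 1)"] by simp
    also have "\<dots> \<le> B" by (rule B) simp
    finally show False by linarith
  qed
qed

lemma line_subset_outside:
  assumes "S \<inter> {z. Re z = b} = {}"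
  shows "{z. Re z = b} \<subseteq> outside S"
proof
  fix z assume z: "z \<in> {z. Re z = b}"
  have "{z. Re z = b} \<subseteq> connected_component_set (- S) z"
    using assms z by (intro connected_component_maximal line_connected_unbounded) auto
  then have "\<not> bounded (connected_component_set (- S) z)"
    using line_connected_unbounded(2) bounded_subset by blast
  then show "z \<in> outside S" using z assms by (auto simp: outside_def)
qed

text \<open>
  The line is connected, unbounded and disjoint from \<open>c\<close>, hence lies outside of \<open>c\<close>. Therefore \<open>c\<close> and
  a small circle around \<open>x1\<close> pick up the same residue. Other singularities do not occur in \<open>w\<close>.
\<close>

lemma contour_integral_gue_integrand:
  assumes c: "gue_contours m x x1 x2 b c" and z: "Re z = b"
    and \<rho>: "0 < \<rho>" "\<rho> < \<bar>b - x1\<bar>"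
  shows "contour_integral c (gue_integrand m x n1 x1 n2 x2 z) =
     (z - of_real x2) ^ (n2 - m - 1) / ((\<Prod>r\<in>{1..m}. z - of_real (x r)) * exp (- z\<^sup>2 / 2)) *
     contour_integral (circlepath (of_real x1) \<rho>)
       (\<lambda>w. (\<Prod>r\<in>{1..m}. w - of_real (x r)) * exp (- w\<^sup>2 / 2) / ((w - of_real x1) ^ (n1 - m + 1) * (w - z)))"
proof -
  let ?F = "\<lambda>w. (\<Prod>r\<in>{1..m}. w - of_real (x r)) * exp (- w\<^sup>2 / 2) / ((w - of_real x1) ^ (n1 - m + 1) * (w - z))"
  let ?A = "{of_real x1, z}" and ?g = "circlepath (complex_of_real x1) \<rho>"
  note c = c[unfolded gue_contours_def]
  have pc: "positive_contour c" using c by blast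
  note pc' = pc[unfolded positive_contour_def]
  have far: "\<rho> < norm (z - of_real x1)" using abs_Re_le_cmod[of "z - of_real x1"] z \<rho> by simp
  then have ne: "z \<noteq> of_real x1" using \<rho> by auto
  have out: "z \<in> outside (path_image c)" using line_subset_outside[of "path_image c" b] c z by blast
  have ins: "of_real x1 \<in> inside (path_image c)" using c by blast
  have wc: "winding_number c (of_real x1) = 1" "winding_number c z = 0"
    using positive_contour_winding_number[OF pc] out ins by auto
  have zo: "z \<in> outside (path_image ?g)" using outside_path_image_circlepath[OF \<rho>(1)] far by (simp add: dist_norm norm_minus_commute)
  have x1i: "of_real x1 \<in> inside (path_image ?g)" using inside_path_image_circlepath[OF \<rho>(1)] \<rho> by simp
  have wg: "winding_number ?g (of_real x1) = 1" "winding_number ?g z = 0"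
    using positive_contour_winding_number[OF positive_contour_circlepath[OF \<rho>(1)]] zo x1i by auto
  have hol: "?F holomorphic_on UNIV - ?A" by (intro holomorphic_intros) auto
  have avc: "path_image c \<subseteq> UNIV - ?A" using out ins inside_no_overlap[of "path_image c"] outside_no_overlap[of "path_image c"] by blast
  have avg: "path_image ?g \<subseteq> UNIV - ?A" using far \<rho> by (auto simp: dist_norm norm_minus_commute)
  have "contour_integral c ?F = 2 * pi * \<i> * (\<Sum>p\<in>?A. winding_number c p * residue ?F p)"
    using pc' avc by (intro Residue_theorem[OF open_UNIV connected_UNIV _ hol]) auto
  moreover have "contour_integral ?g ?F = 2 * pi * \<i> * (\<Sum>p\<in>?A. winding_number ?g p * residue ?F p)"
    using avg by (intro Residue_theorem[OF open_UNIV connected_UNIV _ hol]) auto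
  ultimately have eq: "contour_integral c ?F = contour_integral ?g ?F" using ne wc wg by simp
  have int: "?F contour_integrable_on c"
    using pc' avc by (intro contour_integrable_holomorphic_simple[OF hol]) (auto intro!: open_Diff finite_imp_closed)
  have "gue_integrand m x n1 x1 n2 x2 z w =
     (z - of_real x2) ^ (n2 - m - 1) / ((\<Prod>r\<in>{1..m}. z - of_real (x r)) * exp (- z\<^sup>2 / 2)) * ?F w" for w
  proof -
    have "exp (z\<^sup>2 / 2 - w\<^sup>2 / 2) = exp (- w\<^sup>2 / 2) / exp (- z\<^sup>2 / 2)"
      unfolding exp_diff[symmetric] by simp
    then show ?thesis unfolding gue_integrand_def prod_dividef by (simp only: times_divide_eq_left times_divide_eq_right divide_divide_eq_left mult_ac)
  qed
  then show ?thesis unfolding eq[symmetric] using contour_integral_lmul[OF int] by presburger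
qed

lemma exists_gap_above:
  fixes A :: "real set"
  assumes "finite A"
  shows "\<exists>b>y. \<forall>a\<in>A. y < a \<longrightarrow> b < a"
  using assms
proof (induction A rule: finite_induct)
  case empty
  then show ?case by (auto intro: gt_ex)
next
  case (insert a A)
  then obtain b where b: "b > y" "\<forall>a\<in>A. y < a \<longrightarrow> b < a" by blast
  show ?case
  proof (cases "y < a")
    case True
    then obtain b' where "y < b'" "b' < min a b" using b dense[of y "min a b"] by auto
    then show ?thesis using b by (intro exI[of _ b']) auto
  next
    case False
    then show ?thesis using b by (intro exI[of _ b]) auto
  qed
qed

lemma gue_contours_exist: "\<exists>b c. gue_contours m x x1 x2 b c"
proof -
  obtain b where b: "b > x2" "\<forall>a\<in>insert x1 (x ` {1..m}). x2 < a \<longrightarrow> b < a"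
    using exists_gap_above[of "insert x1 (x ` {1..m})" x2] by auto
  have bx1: "b \<noteq> x1" using b by (cases "x2 < x1") auto
  obtain r where r: "r > 0" "\<forall>a\<in>insert \<bar>b - x1\<bar> ((\<lambda>j. \<bar>x j - x1\<bar>) ` {1..m}). 0 < a \<longrightarrow> r < a"
    using exists_gap_above[of "insert \<bar>b - x1\<bar> ((\<lambda>j. \<bar>x j - x1\<bar>) ` {1..m})" 0] by auto
  have rb: "r < \<bar>b - x1\<bar>" using r bx1 by auto
  have "gue_contours m x x1 x2 b (circlepath (of_real x1) r)"
    unfolding gue_contours_def inside_path_image_circlepath[OF r(1)] outside_path_image_circlepath[OF r(1)]
  proof (intro conjI ballI impI)
    show "path_image (circlepath (of_real x1) r) \<inter> {z. Re z = b} = {}"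
    proof -
      have "Re z \<noteq> b" if "norm (z - of_real x1) = r" for z
        using abs_Re_le_cmod[of "z - of_real x1"] rb that by auto
      moreover have "norm (z - of_real x1) = r" if "z \<in> path_image (circlepath (of_real x1) r)" for z
        using that r by (simp add: dist_norm norm_minus_commute)
      ultimately show ?thesis by blast
    qed
    fix j assume j: "j \<in> {1..m}" "x j \<noteq> x1"
    then have "r < \<bar>x j - x1\<bar>" using r by auto
    moreover have "dist (complex_of_real x1) (of_real (x j)) = \<bar>x j - x1\<bar>" by (simp add: dist_norm norm_minus_commute flip: of_real_diff)
    ultimately show "of_real (x j) \<in> - cball (complex_of_real x1) r" by simp
  qed (use b r in \<open>auto intro: positive_contour_circlepath\<close>)
  then show ?thesis by blast
qed

section \<open>Zeros and nodes for large size\<close>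

lemma eventually_micro_pos_bound: "\<forall>\<^sub>F h in sequentially. \<bar>micro_pos (2 * h) a\<bar> + int n < int h"
proof -
  have "\<forall>\<^sub>F h in sequentially. sqrt (real h) * (\<bar>a\<bar> + 1) + real n < real h" by real_asymp
  moreover have "\<forall>\<^sub>F h in sequentially. h > 0 \<and> 1 / sqrt (real h) < 1" by (rule eventually_inverse_sqrt_less) simp
  ultimately show ?thesis
  proof eventually_elim
    case (elim h)
    have s: "sqrt (real h) > 0" using elim by simp
    have "\<bar>scaled_pos h a\<bar> \<le> \<bar>a\<bar> + 1" using scaled_pos_near[of h a] elim by linarith
    then have "sqrt (real h) * \<bar>scaled_pos h a\<bar> \<le> sqrt (real h) * (\<bar>a\<bar> + 1)" using s by (intro mult_left_mono) auto
    moreover have "sqrt (real h) * \<bar>scaled_pos h a\<bar> = \<bar>of_int (micro_pos (2 * h) a)\<bar>"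
      using s by (simp add: scaled_pos_def abs_divide)
    ultimately have "real_of_int (\<bar>micro_pos (2 * h) a\<bar> + int n) < real_of_int (int h)" using elim by simp
    then show ?case by (simp only: of_int_less_iff)
  qed
qed

lemma eventually_scaled_pos_less:
  assumes "a < a'"
  shows "\<forall>\<^sub>F h in sequentially. scaled_pos h a < scaled_pos h a'"
proof -
  obtain c where c: "a < c" "c < a'" using dense[OF assms] by blast
  show ?thesis
    using order_tendstoD(2)[OF scaled_pos_tendsto c(1)] order_tendstoD(1)[OF scaled_pos_tendsto c(2)]
    by eventually_elim (rule less_trans)
qed

lemma eventually_micro_pos_less:
  assumes "a < a'"
  shows "\<forall>\<^sub>F h in sequentially. micro_pos (2 * h) a < micro_pos (2 * h) a'"
  using eventually_scaled_pos_less[OF assms] eventually_gt_at_top[of 0]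
  by eventually_elim (simp add: scaled_pos_def divide_less_cancel)

lemma micro_pos_mono: "a \<le> a' \<Longrightarrow> micro_pos N a \<le> micro_pos N a'"
  unfolding micro_pos_def by (intro floor_mono mult_left_mono) auto

lemma Conf0_inj_on: "x \<in> Conf0 m \<Longrightarrow> inj_on x {1..m}"
proof (rule inj_onI)
  fix i j assume x: "x \<in> Conf0 m" and ij: "i \<in> {1..m}" "j \<in> {1..m}" "x i = x j"
  then have less: "i' < j' \<Longrightarrow> x j' < x i'" if "i' \<in> {1..m}" "j' \<in> {1..m}" for i' j' using that by (auto simp: Conf0_def)
  show "i = j" using less[of i j] less[of j i] ij by (cases i j rule: linorder_cases) auto
qed

lemma eventually_separated:
  assumes I: "finite I" and x: "inj_on x I"
  shows "\<forall>\<^sub>F h in sequentially. separated I x h"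
proof -
  have "\<forall>\<^sub>F h in sequentially. \<forall>i\<in>I. \<forall>j\<in>I. x i < x j \<longrightarrow> micro_pos (2 * h) (x i) < micro_pos (2 * h) (x j)"
    using eventually_micro_pos_less by (intro eventually_ball_finite I ballI) (auto simp: eventually_mono)
  moreover have "\<forall>\<^sub>F h in sequentially. \<forall>i\<in>I. \<bar>micro_pos (2 * h) (x i)\<bar> + int 0 < int h"
    by (intro eventually_ball_finite I ballI eventually_micro_pos_bound)
  ultimately show ?thesis
  proof eventually_elim
    case (elim h)
    have "i = j" if "i \<in> I" "j \<in> I" "micro_pos (2 * h) (x i) = micro_pos (2 * h) (x j)" for i j
    proof (rule ccontr)
      assume "i \<noteq> j"
      then have "x i \<noteq> x j" using x that by (auto dest: inj_onD)
      then consider "x i < x j" | "x j < x i" by linarith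
      then show False using elim(1) that by cases fastforce+
    qed
    then show ?case unfolding separated_def inj_on_def using elim(2) by (auto simp: abs_less_iff)
  qed
qed

lemma boundary_zeros_remove:
  assumes sep: "separated I x h" and r: "r \<in> I"
  shows "boundary_zeros I x h - {of_int (micro_pos (2 * h) (x r))} = boundary_zeros (I - {r}) x h"
proof -
  let ?X = "\<lambda>r. micro_pos (2 * h) (x r)"
  have "?X ` I - {?X r} = ?X ` (I - {r})" using sep r by (auto simp: separated_def inj_on_def)
  moreover have "?X r \<notin> {- 2 * int h..<- int h} \<union> {int h..<2 * int h}" using sep r by (auto simp: separated_def)
  ultimately have "?X ` I \<union> {- 2 * int h..<- int h} \<union> {int h..<2 * int h} - {?X r} = ?X ` (I - {r}) \<union> {- 2 * int h..<- int h} \<union> {int h..<2 * int h}"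
    by blast
  moreover have "of_int ` A - {of_int b :: complex} = of_int ` (A - {b})" for A and b :: int by auto
  ultimately show ?thesis unfolding boundary_zeros_def by simp
qed

text \<open>
  At its starting point \<open>y\<close> the rising factorial equals \<open>k!\<close> and so lacks the power \<open>s ^ k\<close> that it
  has at a macroscopic distance; everything else in the gauged weight stays bounded.
\<close>

lemma pole_weight_at_start_tendsto_0:
  assumes I: "finite I" and x: "inj_on x I" and r: "r \<in> I" "x r = y" and k: "k > 0"
  shows "(\<lambda>h. of_real (sqrt (real h)) ^ n / of_real (sqrt (real h)) ^ k *
     pole_weight (boundary_zeros I x h) (level_nodes (micro_pos (2 * h) a) n) (level_poly (micro_pos (2 * h) y) k)
       (of_int (micro_pos (2 * h) y))) \<longlonglongrightarrow> 0"
proof -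
  let ?J = "I - {r}"
  have J: "finite ?J" "inj_on x ?J" using I x by (auto intro: inj_on_subset)
  have y: "\<forall>j\<in>?J. x j \<noteq> y" using x r by (auto dest: inj_onD)
  obtain K where K: "\<forall>\<^sub>F h in sequentially. norm (circle_weight ?J x a n 1 h) \<le> K"
    using circle_weight_bounded[OF J(1), of 1 x a n] by auto
  obtain c \<delta> where c: "c > 0" "\<delta> > 0" "\<forall>\<^sub>F h in sequentially. \<forall>w. \<bar>Re w - y\<bar> \<le> \<delta> \<longrightarrow> c * (1 + (Im w)\<^sup>2) ^ 0 \<le> norm (scaled_factor ?J x h w)"
    using scaled_factor_lower_bound[OF J(1) y, where M=0] by blast
  show ?thesis
  proof (rule Lim_null_comparison)
    show "\<forall>\<^sub>F h in sequentially. norm (of_real (sqrt (real h)) ^ n / of_real (sqrt (real h)) ^ k *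
     pole_weight (boundary_zeros I x h) (level_nodes (micro_pos (2 * h) a) n) (level_poly (micro_pos (2 * h) y) k)
       (of_int (micro_pos (2 * h) y))) \<le> fact k * \<bar>K\<bar> / (c * (2 * pi)) * (1 / sqrt (real h) ^ k)"
      using K c(3) eventually_separated[OF I x] eventually_separated[OF J] eventually_inverse_sqrt_less[OF c(2), of 1]
         eventually_inverse_sqrt_less[of 1 "real n + 1", OF zero_less_one]
    proof eventually_elim
      case (elim h)
      let ?s = "complex_of_real (sqrt (real h))" and ?Y = "micro_pos (2 * h) y"
      let ?S = "boundary_zeros I x h" and ?T = "level_nodes (micro_pos (2 * h) a) n"
      let ?C = "far_const h * ?s ^ card ?J"
      have h: "h > 0" using elim(5) by simp
      have s: "?s \<noteq> 0" using h by simp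
      have C: "?C \<noteq> 0" using far_const_nonzero[OF h] s by simp
      have rem: "?S - {of_int ?Y} = boundary_zeros ?J x h" using boundary_zeros_remove[OF elim(3) r(1)] r(2) by simp
      have den: "lagrange_denom ?S (of_int ?Y) = ?C * scaled_factor ?J x h (of_real (scaled_pos h y))"
        using node_prod_boundary_zeros_scaled[OF J(1) elim(4) h, of "of_real (scaled_pos h y)"]
        unfolding lagrange_denom_def rem node_prod_def[symmetric] scaled_pos_mult[OF h] .
      have num: "level_poly ?Y k (of_int ?Y) = fact k" unfolding level_poly_def by (simp add: fact_prod)
      have dd: "(\<Sum>t\<in>?T. node_prod (boundary_zeros ?J x h) t / lagrange_denom ?T t) = ?C / ?s ^ n * (circle_weight ?J x a n 1 h / (2 * of_real pi * \<i>))"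
        using elim(6) by (intro divided_difference_scaled J elim(4) h) auto
      have "\<bar>Re (of_real (scaled_pos h y)) - y\<bar> \<le> \<delta>" using scaled_pos_near[OF h, of y] elim(5) by simp
      then have lb: "c \<le> norm (scaled_factor ?J x h (of_real (scaled_pos h y)))" using spec[OF elim(2), of "of_real (scaled_pos h y)"] by simp
      then have nz: "scaled_factor ?J x h (of_real (scaled_pos h y)) \<noteq> 0" using c by auto
      have "?s ^ n / ?s ^ k * pole_weight ?S ?T (level_poly ?Y k) (of_int ?Y) =
        fact k / scaled_factor ?J x h (of_real (scaled_pos h y)) * circle_weight ?J x a n 1 h / (2 * of_real pi * \<i>) * (1 / ?s ^ k)"
        unfolding pole_weight_def rem num den dd using C s nz by (simp add: field_simps)
      then have "norm (?s ^ n / ?s ^ k * pole_weight ?S ?T (level_poly ?Y k) (of_int ?Y)) =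
        fact k / norm (scaled_factor ?J x h (of_real (scaled_pos h y))) * norm (circle_weight ?J x a n 1 h) / (2 * pi) * (1 / sqrt (real h) ^ k)"
        by (simp add: norm_mult norm_divide norm_power)
      also have "\<dots> \<le> fact k / c * \<bar>K\<bar> / (2 * pi) * (1 / sqrt (real h) ^ k)"
        using lb c(1) elim(1) by (intro mult_right_mono divide_right_mono mult_mono frac_le) auto
      finally show ?case by simp
    qed
    have "(\<lambda>h. 1 / sqrt (real h) ^ k) \<longlonglongrightarrow> 0" using k by real_asymp
    then show "(\<lambda>h. fact k * \<bar>K\<bar> / (c * (2 * pi)) * (1 / sqrt (real h) ^ k)) \<longlonglongrightarrow> 0" by (rule tendsto_mult_right_zero)
  qed
qed

text \<open>
  For large \<open>h\<close> the condition of being at least \<open>x2\<close> and that of lying to the right of the line can differ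
  only at the zero approximating a particle that sits exactly at \<open>x2\<close>.
\<close>

lemma boundary_zeros_right_of:
  assumes I: "finite I" and b: "y < b" "\<forall>r\<in>I. y < x r \<longrightarrow> b < x r"
  shows "\<forall>\<^sub>F h in sequentially. (\<forall>a\<in>boundary_zeros I x h. Re a \<noteq> sqrt (real h) * b) \<and>
     {a\<in>boundary_zeros I x h. of_int (micro_pos (2 * h) y) \<le> Re a} =
     {a\<in>boundary_zeros I x h. sqrt (real h) * b < Re a} \<union> (if \<exists>r\<in>I. x r = y then {of_int (micro_pos (2 * h) y)} else {}) \<and>
     Re (of_int (micro_pos (2 * h) y)) < sqrt (real h) * b"
proof -
  have "\<forall>\<^sub>F h in sequentially. \<forall>r\<in>I. b < x r \<longrightarrow> b < scaled_pos h (x r)"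
    using order_tendstoD(1)[OF scaled_pos_tendsto] by (intro eventually_ball_finite I ballI) (auto simp: eventually_mono)
  moreover have "\<forall>\<^sub>F h in sequentially. \<forall>r\<in>I. x r < y \<longrightarrow> micro_pos (2 * h) (x r) < micro_pos (2 * h) y"
    using eventually_micro_pos_less by (intro eventually_ball_finite I ballI) (auto simp: eventually_mono)
  moreover have "\<forall>\<^sub>F h in sequentially. sqrt (real h) * \<bar>b\<bar> < real h" by real_asymp
  ultimately show ?thesis using eventually_micro_pos_bound[of y 0] eventually_gt_at_top[of 0]
  proof eventually_elim
    case (elim h)
    let ?Y = "micro_pos (2 * h) y" and ?s = "sqrt (real h)"
    have h: "h > 0" and s: "?s > 0" using elim by auto
    have sp: "real_of_int (micro_pos (2 * h) a) = ?s * scaled_pos h a" for a using s by (simp add: scaled_pos_def)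
    have below: "real_of_int (micro_pos (2 * h) a) < ?s * b" if "a < b" for a
      unfolding sp using scaled_pos_bounds(1)[OF h, of a] that s by (intro mult_strict_left_mono) auto
    have sb: "- real h < ?s * b" "?s * b < real h"
      using elim(3) abs_ge_self[of "?s * b"] abs_ge_minus_self[of "?s * b"] s by (auto simp: abs_mult)
    have "Re a \<noteq> ?s * b \<and> (of_int ?Y \<le> Re a \<longleftrightarrow> ?s * b < Re a \<or> (\<exists>r\<in>I. x r = y) \<and> a = of_int ?Y)"
      if a: "a \<in> boundary_zeros I x h" for a
    proof -
      have Yb: "real_of_int ?Y < ?s * b" using below[OF b(1)] .
      from a consider (near) r where "r \<in> I" "a = of_int (micro_pos (2 * h) (x r))"
        | (left) i where "a = of_int i" "i < - int h" | (right) i where "a = of_int i" "int h \<le> i"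
        unfolding boundary_zeros_def by auto
      then show ?thesis
      proof cases
        case near
        consider "x r < y" | "x r = y" | "x r > y" by linarith
        then show ?thesis
        proof cases
          case 1
          then have lt: "micro_pos (2 * h) (x r) < ?Y" using elim(2) near by blast
          then have "real_of_int (micro_pos (2 * h) (x r)) < real_of_int ?Y" by (simp only: of_int_less_iff)
          with lt show ?thesis using near Yb by auto
        next
          case 2
          then show ?thesis using near Yb by auto
        next
          case 3
          then have "b < scaled_pos h (x r)" using elim(1) b near by blast
          then have "?s * b < of_int (micro_pos (2 * h) (x r))" unfolding sp using s by (rule mult_strict_left_mono)
          moreover have "?Y \<le> micro_pos (2 * h) (x r)" using 3 by (intro micro_pos_mono) simp
          ultimately show ?thesis using near by auto
        qed
      next
        case left
        then have "real_of_int i < - real h" by (metis of_int_less_iff of_int_minus of_int_of_nat_eq)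
        moreover have "i < ?Y" using left elim(4) by linarith
        ultimately show ?thesis using left sb by auto
      next
        case right
        then have "real h \<le> real_of_int i" by (metis of_int_le_iff of_int_of_nat_eq)
        moreover have "?Y \<le> i" using right elim(4) by linarith
        ultimately show ?thesis using right sb by auto
      qed
    qed
    moreover have "of_int ?Y \<in> boundary_zeros I x h" if "\<exists>r\<in>I. x r = y"
      using that unfolding boundary_zeros_def by blast
    ultimately show ?case using below[OF b(1)] by auto
  qed
qed

text \<open>
  The nodes all converge to \<open>a\<close> after scaling, so they eventually lie on the same side of the line.
\<close>

lemma level_nodes_right_of:
  assumes b: "y < b" "y < a \<longrightarrow> b < a"
  shows "\<forall>\<^sub>F h in sequentially. (\<forall>t\<in>level_nodes (micro_pos (2 * h) a) n. Re t \<noteq> sqrt (real h) * b) \<and>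
     {t\<in>level_nodes (micro_pos (2 * h) a) n. sqrt (real h) * b < Re t} =
       (if y < a then level_nodes (micro_pos (2 * h) a) n else {})"
proof -
  have ab: "\<bar>a - b\<bar> > 0" using b by auto
  show ?thesis
    using eventually_inverse_sqrt_less[OF ab, of "real n + 1"]
  proof eventually_elim
    case (elim h)
    let ?s = "sqrt (real h)"
    have h: "h > 0" and s: "?s > 0" using elim by auto
    have "Re t \<noteq> ?s * b \<and> (?s * b < Re t \<longleftrightarrow> y < a)" if t: "t \<in> level_nodes (micro_pos (2 * h) a) n" for t
    proof -
      have "norm (t / of_real ?s - of_real a) < \<bar>a - b\<bar>"
        using elim by (intro level_nodes_near[OF h _ t]) auto
      then have d: "\<bar>Re t / ?s - a\<bar> < \<bar>a - b\<bar>" using abs_Re_le_cmod[of "t / of_real ?s - of_real a"] by simp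
      show ?thesis
      proof (cases "y < a")
        case True
        then have "b < Re t / ?s" using d b by (auto simp: abs_less_iff abs_if split: if_splits)
        then have "?s * b < Re t" using s by (simp add: pos_less_divide_eq mult.commute)
        then show ?thesis using True by simp
      next
        case False
        then have "Re t / ?s < b" using d b by (auto simp: abs_less_iff abs_if split: if_splits)
        then have "Re t < ?s * b" using s by (simp add: pos_divide_less_eq mult.commute)
        then show ?thesis using False by simp
      qed
    qed
    then show ?case by auto
  qed
qed

section \<open>Convergence of the kernel\<close>

text \<open>
  The value under the description operator in \<open>K_GUE\<close>, for one choice of the contours.
\<close>

definition gue_contour_value :: "nat \<Rightarrow> (nat \<Rightarrow> real) \<Rightarrow> nat \<Rightarrow> real \<Rightarrow> nat \<Rightarrow> real \<Rightarrow> real \<Rightarrow> (real \<Rightarrow> complex) \<Rightarrow> complex" where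
  "gue_contour_value m x n1 x1 n2 x2 b c =
     fact (n1 - m) / fact (n2 - m - 1) * (- 1 / (2 * of_real pi * \<i>)\<^sup>2) *
       vertical_line_integral b (\<lambda>z. contour_integral c (\<lambda>w. gue_integrand m x n1 x1 n2 x2 z w))"

text \<open>
  The residue theorem for the line through \<open>sqrt h * b\<close>, with the integral moved to the macroscopic
  line through \<open>b\<close>.
\<close>

lemma pole_sum_right_of_line:
  fixes I x h a y n k b
  defines "S \<equiv> boundary_zeros I x h" and "T \<equiv> level_nodes (micro_pos (2 * h) a) n" and "P \<equiv> level_poly (micro_pos (2 * h) y) k"
  assumes I: "finite I" and h: "k < h" and \<beta>: "\<forall>p\<in>S \<union> T. Re p \<noteq> sqrt (real h) * b"
  shows "(\<Sum>p\<in>{p\<in>S. sqrt (real h) * b < Re p}. pole_weight S T P p) =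
     (\<Sum>t\<in>{t\<in>T. sqrt (real h) * b < Re t}. P t / lagrange_denom T t) +
     - 1 / (2 * of_real pi * \<i>) * (of_real (sqrt (real h)) * vertical_line_integral b (\<lambda>z. reduced_kernel S T P (of_real (sqrt (real h)) * z)))"
proof -
  have c: "(2 * of_real pi * \<i>) \<noteq> 0" by simp
  have s: "sqrt (real h) > 0" using h by simp
  have "vertical_line_integral (sqrt (real h) * b) (reduced_kernel S T P) =
     - (2 * of_real pi * \<i>) * ((\<Sum>p\<in>{p\<in>S. sqrt (real h) * b < Re p}. pole_weight S T P p)
        - (\<Sum>t\<in>{t\<in>T. sqrt (real h) * b < Re t}. P t / lagrange_denom T t))"
  proof (rule vertical_line_integral_reduced_kernel)
    show "finite S" unfolding S_def by (rule finite_boundary_zeros[OF I])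
    show "finite T" unfolding T_def by simp
    show "P holomorphic_on UNIV" unfolding P_def by (rule holomorphic_level_poly)
    show "norm (P z) \<le> (1 + \<bar>of_int (micro_pos (2 * h) y)\<bar> + real k) ^ k * norm z ^ k" if "1 \<le> norm z" for z
      unfolding P_def by (rule level_poly_growth[OF that])
    show "k < card S" unfolding S_def using card_boundary_zeros_ge[OF I, of h x] h by linarith
  qed (use \<beta> in blast)
  then have "of_real (sqrt (real h)) * vertical_line_integral b (\<lambda>z. reduced_kernel S T P (of_real (sqrt (real h)) * z)) =
     - (2 * of_real pi * \<i>) * ((\<Sum>p\<in>{p\<in>S. sqrt (real h) * b < Re p}. pole_weight S T P p)
        - (\<Sum>t\<in>{t\<in>T. sqrt (real h) * b < Re t}. P t / lagrange_denom T t))"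
    by (simp only: vertical_line_integral_scale[OF s])
  moreover have "A = B + - 1 / d * (- d * (A - B))" if "d \<noteq> 0" for A B d :: complex using that by simp
  from this[OF c] have "A = B + - 1 / (2 * of_real pi * \<i>) * (- (2 * of_real pi * \<i>) * (A - B))" for A B .
  ultimately show ?thesis by (simp only:)
qed

text \<open>
  The kernel splits into three parts: the indicator together with the residues on the nodes, the weight
  of a particle at \<open>x2\<close>, and the line integral. Only the last one contributes to the limit.
\<close>

lemma scaled_lozenge_kernel_tendsto:
  assumes n: "m < n1" "m < n2" and x: "x \<in> Conf0 m"
    and coincide: "n2 = n1 + 1 \<longrightarrow> x1 \<noteq> x2" "n2 = m + 1 \<longrightarrow> (\<forall>j\<in>{1..m}. x2 \<noteq> x j)"
    and c: "gue_contours m x x1 x2 b c"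
  shows "(\<lambda>h. of_real (sqrt (real h)) ^ n1 / of_real (sqrt (real h)) ^ n2 * of_real (sqrt (real h)) *
            K_lozenge m x (2 * h) (2 * h + m - n1) (micro_pos (2 * h) x1) (2 * h + m - n2) (micro_pos (2 * h) x2))
         \<longlonglongrightarrow> gue_contour_value m x n1 x1 n2 x2 b c"
proof -
  define n k where "n = n1 - m" and "k = n2 - m - 1"
  define s where "s h = complex_of_real (sqrt (real h))" for h :: nat
  let ?I = "{1..m}"
  define S T P where "S h = boundary_zeros ?I x h" and "T h = level_nodes (micro_pos (2 * h) x1) n"
    and "P h = level_poly (micro_pos (2 * h) x2) k" for h
  define q where "q = (fact n / fact k :: complex)"
  note c' = c[unfolded gue_contours_def]
  have b: "x2 < b" "\<forall>j\<in>?I. x2 < x j \<longrightarrow> b < x j" "x2 < x1 \<longrightarrow> b < x1" using c' by auto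
  have bx: "\<forall>r\<in>?I. x r \<noteq> b"
  proof
    fix r assume "r \<in> ?I"
    then show "x r \<noteq> b" using b by (cases "x2 < x r") auto
  qed
  have "0 < \<bar>b - x1\<bar>" using b by auto
  then obtain \<rho> where \<rho>: "0 < \<rho>" "\<rho> < \<bar>b - x1\<bar>" using dense by blast
  have inj: "inj_on x ?I" using Conf0_inj_on[OF x] .
  have sep: "\<forall>\<^sub>F h in sequentially. separated ?I x h" by (rule eventually_separated[OF _ inj]) simp

  define \<epsilon> where "\<epsilon> = (if x1 = x2 \<and> n1 < n2 then - 1 else 0 :: complex)"
  define ex where "ex h = (if \<exists>r\<in>?I. x r = x2 then pole_weight (S h) (T h) (P h) (of_int (micro_pos (2 * h) x2)) else 0)" for h
  let ?L = "line_term ?I x x1 n \<rho> x2 k"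

  have order: "\<forall>\<^sub>F h in sequentially. x1 < x2 \<longrightarrow> micro_pos (2 * h) x1 < micro_pos (2 * h) x2"
    using eventually_micro_pos_less[of x1 x2] by (cases "x1 < x2") auto
  have eq: "\<forall>\<^sub>F h in sequentially. of_real (sqrt (real h)) ^ n1 / of_real (sqrt (real h)) ^ n2 * of_real (sqrt (real h)) *
            K_lozenge m x (2 * h) (2 * h + m - n1) (micro_pos (2 * h) x1) (2 * h + m - n2) (micro_pos (2 * h) x2) =
      s h ^ n / s h ^ k * \<epsilon> + q * (s h ^ n / s h ^ k * ex h) + q * (- 1 / (2 * of_real pi * \<i>)) * vertical_line_integral b (?L h)"
    using sep eventually_micro_pos_bound[of x1 n] eventually_micro_pos_bound[of x2 0] eventually_gt_at_top[of "n1 + n2"]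
      boundary_zeros_right_of[OF finite_atLeastAtMost b(1,2)] level_nodes_right_of[OF b(1,3), of n]
      reduced_kernel_eq_line_term[OF finite_atLeastAtMost sep bx \<rho>, of n x2 k]
      order
  proof eventually_elim
    case (elim h)
    let ?X1 = "micro_pos (2 * h) x1" and ?X2 = "micro_pos (2 * h) x2" and ?\<beta> = "sqrt (real h) * b"
    define ind where "ind = (if n1 < n2 \<and> ?X2 \<le> ?X1 then (\<Prod>l\<in>{1..n2 - n1 - 1}. of_int (?X1 - ?X2 + int l)) / fact (n2 - n1 - 1) else 0 :: complex)"
    define V where "V = vertical_line_integral b (\<lambda>z. reduced_kernel (S h) (T h) (P h) (s h * z))"
    have s0: "s h \<noteq> 0" using elim(4) by (simp add: s_def)
    have levels: "2 * h - (2 * h + m - n1) = n" "2 * h - (2 * h + m - n2) - 1 = k"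
      "2 * h + m - n2 < 2 * h + m - n1 \<longleftrightarrow> n1 < n2" "2 * h + m - n1 - (2 * h + m - n2) - 1 = n2 - n1 - 1"
      using elim(4) n by (auto simp: n_def k_def)
    have K: "K_lozenge m x (2 * h) (2 * h + m - n1) ?X1 (2 * h + m - n2) ?X2 =
        - ind + q * (\<Sum>a\<in>{a\<in>S h. of_int ?X2 \<le> Re a}. pole_weight (S h) (T h) (P h) a)"
    proof -
      have "?X2 \<le> int (2 * h)" "- int (2 * h) \<le> ?X1 - int (2 * h - (2 * h + m - n1))" "?X1 \<le> int (2 * h)"
        unfolding levels using elim(2,3) by (auto simp: abs_less_iff abs_if split: if_splits)
      from K_lozenge_eq_pole_sum[OF elim(1) this, where ?n2.0="2 * h + m - n2", unfolded levels]
      show ?thesis unfolding ind_def q_def S_def T_def P_def .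
    qed
    have split: "(\<Sum>a\<in>{a\<in>S h. of_int ?X2 \<le> Re a}. pole_weight (S h) (T h) (P h) a) =
        (\<Sum>a\<in>{a\<in>S h. ?\<beta> < Re a}. pole_weight (S h) (T h) (P h) a) + ex h"
    proof -
      note set = conjunct1[OF conjunct2[OF elim(5)], folded S_def] and lt = conjunct2[OF conjunct2[OF elim(5)]]
      have "of_int ?X2 \<notin> {a\<in>S h. ?\<beta> < Re a}" using lt by (simp add: not_less)
      then show ?thesis unfolding set ex_def
        by (cases "\<exists>r\<in>?I. x r = x2") (simp_all add: S_def finite_boundary_zeros add.commute)
    qed
    have right: "(\<Sum>a\<in>{a\<in>S h. ?\<beta> < Re a}. pole_weight (S h) (T h) (P h) a) =
        (\<Sum>t\<in>{t\<in>T h. ?\<beta> < Re t}. P h t / lagrange_denom (T h) t) + - 1 / (2 * of_real pi * \<i>) * (s h * V)"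
      unfolding V_def S_def T_def P_def s_def
    proof (rule pole_sum_right_of_line)
      show "k < h" using elim(4) by (simp add: k_def)
      show "\<forall>p\<in>boundary_zeros ?I x h \<union> level_nodes ?X1 n. Re p \<noteq> ?\<beta>"
        using conjunct1[OF elim(5)] conjunct1[OF elim(6)] by (simp only: ball_Un simp_thms)
    qed simp
    have \<epsilon>: "- ind + q * (\<Sum>t\<in>{t\<in>T h. ?\<beta> < Re t}. P h t / lagrange_denom (T h) t) = \<epsilon>"
    proof -
      have kn: "k - n = n2 - n1 - 1" "n \<le> k \<longleftrightarrow> n1 < n2" using n by (auto simp: n_def k_def)
      have dd: "q * (\<Sum>t\<in>T h. P h t / lagrange_denom (T h) t) =
          (if n1 < n2 then (\<Prod>l\<in>{1..n2 - n1 - 1}. of_int (?X1 - ?X2 + int l)) / fact (n2 - n1 - 1) else 0)"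
        unfolding q_def T_def P_def level_poly_divided_difference kn ..
      have nodes: "{t\<in>T h. ?\<beta> < Re t} = (if x2 < x1 then T h else {})"
        unfolding T_def by (rule conjunct2[OF elim(6)])
      consider "x2 < x1" | "x1 < x2" | "x1 = x2" by linarith
      then show ?thesis
      proof cases
        case 1
        then have "?X2 \<le> ?X1" by (intro micro_pos_mono) simp
        then show ?thesis unfolding nodes using 1 dd by (simp add: ind_def \<epsilon>_def)
      next
        case 2
        then show ?thesis unfolding nodes using elim(8) by (simp add: ind_def \<epsilon>_def)
      next
        case 3
        have "(\<Prod>l\<in>{1..n2 - n1 - 1}. of_int (int l) :: complex) = fact (n2 - n1 - 1)" by (simp add: fact_prod)
        then show ?thesis unfolding nodes using 3 by (simp add: ind_def \<epsilon>_def)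
      qed
    qed
    have VL: "s h ^ n / s h ^ k * (s h * V) = vertical_line_integral b (?L h)"
    proof -
      have "vertical_line_integral b (?L h) = vertical_line_integral b (\<lambda>z. s h ^ (n + 1) / s h ^ k * reduced_kernel (S h) (T h) (P h) (s h * z))"
        unfolding s_def S_def T_def P_def by (intro vertical_line_integral_cong elim(7)[rule_format])
      then show ?thesis unfolding vertical_line_integral_cmult V_def by simp
    qed
    have gauge: "s h ^ n1 / s h ^ n2 * s h = s h ^ n / s h ^ k"
    proof -
      have "n1 = n + m" "n2 = k + m + 1" using n by (auto simp: n_def k_def)
      then show ?thesis using s0 by (simp add: power_add)
    qed
    have "G * (- ind + q * (N + c0 * W + e)) = G * (- ind + q * N) + q * (G * e) + q * c0 * (G * W)" for G N c0 W e
      by (simp add: algebra_simps)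
    then show ?case unfolding K split right s_def[symmetric] gauge \<epsilon>[symmetric] VL[symmetric] .
  qed
  have lim: "(\<lambda>h. s h ^ n / s h ^ k * \<epsilon> + q * (s h ^ n / s h ^ k * ex h) + q * (- 1 / (2 * of_real pi * \<i>)) * vertical_line_integral b (?L h))
     \<longlonglongrightarrow> 0 + q * 0 + q * (- 1 / (2 * of_real pi * \<i>)) * vertical_line_integral b (\<lambda>z.
     (z - of_real x2) ^ k / ((\<Prod>r\<in>?I. z - of_real (x r)) * exp (- z\<^sup>2 / 2)) *
     contour_integral (circlepath (of_real x1) \<rho>)
       (\<lambda>w. (\<Prod>r\<in>?I. w - of_real (x r)) * exp (- w\<^sup>2 / 2) / ((w - of_real x1) ^ (n + 1) * (w - z))) / (2 * of_real pi * \<i>))"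
  proof (intro tendsto_add tendsto_mult tendsto_const line_term_integral_tendsto sep bx \<rho>)
    show "(\<lambda>h. s h ^ n / s h ^ k * \<epsilon>) \<longlonglongrightarrow> 0"
    proof (cases "x1 = x2 \<and> n1 < n2")
      case True
      then have kn: "k - n > 0" "k = n + (k - n)" using coincide(1) n by (auto simp: n_def k_def)
      have "\<forall>\<^sub>F h in sequentially. of_real (- 1 / sqrt (real h) ^ (k - n)) = s h ^ n / s h ^ k * \<epsilon>"
        using eventually_gt_at_top[of 0]
      proof eventually_elim
        case (elim h)
        have "s h ^ k = s h ^ n * s h ^ (k - n)" unfolding power_add[symmetric] kn(2)[symmetric] ..
        then show ?case using elim True by (simp add: s_def \<epsilon>_def)
      qed
      moreover have "(\<lambda>h. - 1 / sqrt (real h) ^ (k - n)) \<longlonglongrightarrow> 0" using kn(1) by real_asymp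
      from tendsto_of_real[OF this] have "(\<lambda>h. complex_of_real (- 1 / sqrt (real h) ^ (k - n))) \<longlonglongrightarrow> 0" by (simp only: of_real_0)
      ultimately show ?thesis by (rule Lim_transform_eventually[rotated])
    next
      case False
      then have "\<epsilon> = 0" by (auto simp: \<epsilon>_def)
      then show ?thesis by simp
    qed
    show "(\<lambda>h. s h ^ n / s h ^ k * ex h) \<longlonglongrightarrow> 0"
    proof (cases "\<exists>r\<in>?I. x r = x2")
      case True
      then obtain r where r: "r \<in> ?I" "x r = x2" by blast
      then have "n2 \<noteq> m + 1" using coincide(2) by auto
      then have "k > 0" using n by (auto simp: k_def)
      from pole_weight_at_start_tendsto_0[OF finite_atLeastAtMost inj r this, of n x1] True
      show ?thesis by (simp add: ex_def s_def S_def T_def P_def)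
    qed (simp add: ex_def)
  qed simp
  have val: "0 + q * 0 + q * (- 1 / (2 * of_real pi * \<i>)) * vertical_line_integral b (\<lambda>z.
     (z - of_real x2) ^ k / ((\<Prod>r\<in>?I. z - of_real (x r)) * exp (- z\<^sup>2 / 2)) *
     contour_integral (circlepath (of_real x1) \<rho>)
       (\<lambda>w. (\<Prod>r\<in>?I. w - of_real (x r)) * exp (- w\<^sup>2 / 2) / ((w - of_real x1) ^ (n + 1) * (w - z))) / (2 * of_real pi * \<i>))
     = gue_contour_value m x n1 x1 n2 x2 b c"
  proof -
    have "vertical_line_integral b (\<lambda>z. contour_integral c (\<lambda>w. gue_integrand m x n1 x1 n2 x2 z w)) / (2 * of_real pi * \<i>) =
       vertical_line_integral b (\<lambda>z. 1 / (2 * of_real pi * \<i>) * contour_integral c (gue_integrand m x n1 x1 n2 x2 z))"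
      unfolding vertical_line_integral_cmult by simp
    also have "\<dots> = vertical_line_integral b (\<lambda>z.
       (z - of_real x2) ^ k / ((\<Prod>r\<in>?I. z - of_real (x r)) * exp (- z\<^sup>2 / 2)) *
       contour_integral (circlepath (of_real x1) \<rho>)
         (\<lambda>w. (\<Prod>r\<in>?I. w - of_real (x r)) * exp (- w\<^sup>2 / 2) / ((w - of_real x1) ^ (n + 1) * (w - z))) / (2 * of_real pi * \<i>))"
      by (rule vertical_line_integral_cong) (simp add: contour_integral_gue_integrand[OF c _ \<rho>] n_def k_def)
    finally have fin: "vertical_line_integral b (\<lambda>z. contour_integral c (\<lambda>w. gue_integrand m x n1 x1 n2 x2 z w)) / (2 * of_real pi * \<i>) = \<dots>" .
    have "0 + q * 0 + q * (- 1 / d) * (W / d) = q * (- 1 / d\<^sup>2) * W" for d W :: complex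
      by (simp add: power2_eq_square)
    then show ?thesis
      unfolding gue_contour_value_def fin[symmetric] q_def n_def[symmetric] k_def[symmetric] .
  qed
  from eq have eq': "\<forall>\<^sub>F h in sequentially. s h ^ n / s h ^ k * \<epsilon> + q * (s h ^ n / s h ^ k * ex h) + q * (- 1 / (2 * of_real pi * \<i>)) * vertical_line_integral b (?L h) =
      of_real (sqrt (real h)) ^ n1 / of_real (sqrt (real h)) ^ n2 * of_real (sqrt (real h)) *
        K_lozenge m x (2 * h) (2 * h + m - n1) (micro_pos (2 * h) x1) (2 * h + m - n2) (micro_pos (2 * h) x2)"
    by eventually_elim (rule sym)
  show ?thesis by (rule Lim_transform_eventually[OF lim[unfolded val] eq'])
qed

theorem propositionB2:
  fixes m :: nat
  shows "\<exists>g :: nat \<Rightarrow> nat \<Rightarrow> real \<Rightarrow> complex. (\<forall>N n y. g N n y \<noteq> 0) \<and>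
    (\<forall>n1 > m. \<forall>n2 > m. \<forall>x1 x2 :: real. \<forall>x \<in> Conf0 m.
       (n2 = n1 + 1 \<longrightarrow> x1 \<noteq> x2) \<longrightarrow>
       (n2 = m + 1 \<longrightarrow> (\<forall>j\<in>{1..m}. x2 \<noteq> x j)) \<longrightarrow>
       ((\<lambda>N. g N n1 x1 / g N n2 x2 * of_real (sqrt (real N / 2)) *
             K_lozenge m x N (N + m - n1) \<lfloor>x1 * sqrt (real N / 2)\<rfloor>
                             (N + m - n2) \<lfloor>x2 * sqrt (real N / 2)\<rfloor>)
         \<longlongrightarrow> K_GUE m x n1 x1 n2 x2) (inf sequentially (principal {N. even N})))"
proof -
  \<comment> \<open>The case distinction keeps the gauge nonzero at \<open>N = 0\<close>.\<close>
  define g where "g N n y = (if N = 0 then 1 else complex_of_real (sqrt (real N / 2)) ^ n)" for N n and y :: real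
  have "((\<lambda>N. g N n1 x1 / g N n2 x2 * of_real (sqrt (real N / 2)) *
             K_lozenge m x N (N + m - n1) \<lfloor>x1 * sqrt (real N / 2)\<rfloor>
                             (N + m - n2) \<lfloor>x2 * sqrt (real N / 2)\<rfloor>)
         \<longlongrightarrow> K_GUE m x n1 x1 n2 x2) (inf sequentially (principal {N. even N}))" (is "(?f \<longlongrightarrow> _) _")
    if n: "m < n1" "m < n2" and x: "x \<in> Conf0 m"
      and co: "n2 = n1 + 1 \<longrightarrow> x1 \<noteq> x2" "n2 = m + 1 \<longrightarrow> (\<forall>j\<in>{1..m}. x2 \<noteq> x j)" for n1 n2 x1 x2 x
  proof -
    have floor: "micro_pos (2 * h) a = \<lfloor>a * sqrt (real h)\<rfloor>" for a h
      by (subst micro_pos_double) (simp add: mult.commute)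
    let ?h = "\<lambda>h. of_real (sqrt (real h)) ^ n1 / of_real (sqrt (real h)) ^ n2 * of_real (sqrt (real h)) *
            K_lozenge m x (2 * h) (2 * h + m - n1) (micro_pos (2 * h) x1) (2 * h + m - n2) (micro_pos (2 * h) x2)"
    have lim: "?h \<longlonglongrightarrow> gue_contour_value m x n1 x1 n2 x2 b c" if "gue_contours m x x1 x2 b c" for b c
      by (rule scaled_lozenge_kernel_tendsto[OF n x co that])
    obtain b c where bc: "gue_contours m x x1 x2 b c" using gue_contours_exist by blast
    have "K_GUE m x n1 x1 n2 x2 = gue_contour_value m x n1 x1 n2 x2 b c"
      unfolding K_GUE_def gue_contour_value_def[symmetric]
    proof (rule the_equality)
      show "\<exists>b' c'. gue_contours m x x1 x2 b' c' \<and> gue_contour_value m x n1 x1 n2 x2 b c = gue_contour_value m x n1 x1 n2 x2 b' c'"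
        using bc by blast
      fix v assume "\<exists>b' c'. gue_contours m x x1 x2 b' c' \<and> v = gue_contour_value m x n1 x1 n2 x2 b' c'"
      then obtain b' c' where bc': "gue_contours m x x1 x2 b' c'" and v: "v = gue_contour_value m x n1 x1 n2 x2 b' c'" by blast
      show "v = gue_contour_value m x n1 x1 n2 x2 b c"
        unfolding v by (rule LIMSEQ_unique[OF lim[OF bc'] lim[OF bc]])
    qed
    with lim[OF bc] have "?h \<longlonglongrightarrow> K_GUE m x n1 x1 n2 x2" by simp
    moreover have "\<forall>\<^sub>F h in sequentially. ?h h = ?f (2 * h)"
      using eventually_gt_at_top[of 0] by eventually_elim (simp add: g_def floor)
    ultimately have lim2: "(\<lambda>h. ?f (2 * h)) \<longlonglongrightarrow> K_GUE m x n1 x1 n2 x2" by (rule Lim_transform_eventually)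
    show ?thesis
    proof (rule topological_tendstoI)
      fix U assume U: "open U" "K_GUE m x n1 x1 n2 x2 \<in> U"
      from topological_tendstoD[OF lim2 U] obtain h0 where h0: "\<And>h. h \<ge> h0 \<Longrightarrow> ?f (2 * h) \<in> U"
        unfolding eventually_sequentially by blast
      have "?f N \<in> U" if "N \<ge> 2 * h0" "even N" for N
      proof -
        obtain h where "N = 2 * h" using \<open>even N\<close> by (elim evenE)
        then show ?thesis using h0[of h] that by simp
      qed
      then show "\<forall>\<^sub>F N in inf sequentially (principal {N. even N}). ?f N \<in> U"
        unfolding eventually_inf_principal eventually_sequentially by (intro exI[of _ "2 * h0"]) simp
    qed
  qed
  note limit = this
  have "g N n y \<noteq> 0" for N n y by (simp add: g_def)
  then show ?thesis by (intro exI[of _ g] conjI allI impI ballI) (assumption, rule limit)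
qed

end
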